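(* Let $L:[0,T]\times TM\times\mathbb{R}^m\to\mathbb{R}$ and $g:TM\to\mathbb{R}$ be smooth, and let $$V(t,q,v)=\inf_{u\in U_T}\Big[\int_t^T L(s,q_u(s),v_u(s),u(s))\,ds+g(q_u(T),v_u(T))\Big]$$ be the value function, where $(q_u,v_u)$ solves $q_u'=v_u$, $\frac{Dv_u}{Dt}=-\nabla W(q_u)+\sum_{j=1}^m f_j(q_u)u_j$ with $(q_u(t),v_u(t))=(q,v)$. Suppose that $V\in C^1([0,T]\times TM)$ and that the Lagrangian is coercive in $u$: $L\ge\beta|u|^2$ with $\beta>0$. Then $V$ satisfies the Hamilton–Jacobi–Bellman equation $$\frac{\partial V}{\partial t}+H(t,q,v,\nabla V)=0$$ with terminal value $$V(T,q,v)=g(q,v),$$ where $\nabla V=(\nabla_qV,\nabla_vV)$ is the gradient associated with the Sasaki metric on $TM$ and $$H(t,q,v,p_1,p_2)=\inf_{u\in\Omega}\Big\{\langle p_1,v\rangle+\Big\langle p_2,-\nabla W(q)+\sum_{j=1}^m f_j(q)u_j\Big\rangle+L(t,q,v,u)\Big\}.$$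
   Context: $(M,\langle\cdot,\cdot\rangle)$ is the configuration manifold of a robot: a finite-dimensional Riemannian manifold (kinetic energy metric). $W\in C^\infty(M)$ has Riemannian gradient $\nabla W$, $f_1,\dots,f_m$ are smooth vector fields on $M$, $\frac{D}{Dt}$ is the Levi-Civita covariant derivative along a curve, $T>0$, and $\Omega\subset\mathbb{R}^m$ is the control set. A compact set $K\subset TM$ is fixed. $U_T$ is the set of admissible controls: the square-integrable controls with values in $\Omega$ whose trajectory, starting from the given initial state, is defined up to time $T$ and lies in the fixed compact $K$; in the definition of $V(t,q,v)$ this is understood for controls on $[t,T]$ and trajectories starting from $(q,v)$ at time $t$. $\nabla_qV,\nabla_vV\in T_qM$ are the horizontal and vertical components of the Sasaki gradient of $V(t,\cdot)$ under $T_{(q,v)}TM\cong T_qM\oplus T_qM$. *)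

theory Defs
  imports "HOL-Analysis.Analysis" "HOL-Library.Extended_Nat"
begin

section \<open>Functions of class \<open>C^n\<close>, \<open>n \<le> \<infinity>\<close>\<close>

fun C_diff_open ::
    "nat \<Rightarrow> ('b::euclidean_space \<Rightarrow> 'c::real_normed_vector) \<Rightarrow> 'b set \<Rightarrow> bool" where
  "C_diff_open 0 f S \<longleftrightarrow> continuous_on S f"
| "C_diff_open (Suc k) f S \<longleftrightarrow>
     (\<forall>x\<in>S. f differentiable (at x)) \<and>
     (\<forall>v. C_diff_open k (\<lambda>x. frechet_derivative f (at x) v) S)"

text \<open>On a set that need not be open (typically \<open>[0,T] \<times> open\<close>), a function is of class \<open>C^n\<close>
  if it is locally the restriction of a \<open>C^n\<close> function defined on an open set.\<close>

definition class_C_on ::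
    "enat \<Rightarrow> 'b::euclidean_space set \<Rightarrow> ('b \<Rightarrow> 'c::real_normed_vector) \<Rightarrow> bool" where
  "class_C_on n S f \<longleftrightarrow>
     (\<forall>x\<in>S. \<exists>N F. open N \<and> x \<in> N \<and> (\<forall>k. enat k \<le> n \<longrightarrow> C_diff_open k F N) \<and>
                 (\<forall>y\<in>N \<inter> S. F y = f y))"

section \<open>Manifolds\<close>

text \<open>A manifold is given by its atlas: the point set is the union of the chart domains and the
  topology is the one making all charts homeomorphisms onto open sets.  A chart is a pair of its
  domain and its map; values of the map outside the domain are irrelevant.\<close>

type_synonym ('a, 'e) chart = "'a set \<times> ('a \<Rightarrow> 'e)"
type_synonym ('a, 'e) atlas = "('a, 'e) chart set"

abbreviation chart_dom :: "('a, 'e) chart \<Rightarrow> 'a set" where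
  "chart_dom c \<equiv> fst c"

abbreviation chart_map :: "('a, 'e) chart \<Rightarrow> 'a \<Rightarrow> 'e" where
  "chart_map c \<equiv> snd c"

definition chart_inv :: "('a, 'e) chart \<Rightarrow> 'e \<Rightarrow> 'a" where
  "chart_inv c = inv_into (chart_dom c) (chart_map c)"

definition chart_image :: "('a, 'e) chart \<Rightarrow> 'e set" where
  "chart_image c = chart_map c ` chart_dom c"

definition points :: "('a, 'e) atlas \<Rightarrow> 'a set" where
  "points A = (\<Union>c\<in>A. chart_dom c)"

definition transition :: "('a, 'e) chart \<Rightarrow> ('a, 'e) chart \<Rightarrow> 'e \<Rightarrow> 'e" where
  "transition c c' = chart_map c' \<circ> chart_inv c"

definition smooth_atlas :: "('a, 'e::euclidean_space) atlas \<Rightarrow> bool" where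
  "smooth_atlas A \<longleftrightarrow>
     (\<forall>c\<in>A. inj_on (chart_map c) (chart_dom c) \<and> open (chart_image c)) \<and>
     (\<forall>c\<in>A. \<forall>c'\<in>A. open (chart_map c ` (chart_dom c \<inter> chart_dom c')) \<and>
        class_C_on \<infinity> (chart_map c ` (chart_dom c \<inter> chart_dom c')) (transition c c'))"

definition manifold_topology :: "('a, 'e::euclidean_space) atlas \<Rightarrow> 'a topology" where
  "manifold_topology A =
     topology (\<lambda>S. S \<subseteq> points A \<and> (\<forall>c\<in>A. open (chart_map c ` (S \<inter> chart_dom c))))"

lemma openin_manifold_topology:
  assumes "smooth_atlas A"
  shows "openin (manifold_topology A) S \<longleftrightarrow>
           S \<subseteq> points A \<and> (\<forall>c\<in>A. open (chart_map c ` (S \<inter> chart_dom c)))"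
proof -
  let ?P = "\<lambda>S. S \<subseteq> points A \<and> (\<forall>c\<in>A. open (chart_map c ` (S \<inter> chart_dom c)))"
  have "istopology ?P"
    unfolding istopology_def
  proof (rule conjI; intro allI impI)
    fix S S' assume S: "?P S" and S': "?P S'"
    have "open (chart_map c ` ((S \<inter> S') \<inter> chart_dom c))" if c: "c \<in> A" for c
    proof -
      have "inj_on (chart_map c) (chart_dom c)"
        using assms c by (auto simp: smooth_atlas_def)
      then have "chart_map c ` ((S \<inter> S') \<inter> chart_dom c)
          = chart_map c ` (S \<inter> chart_dom c) \<inter> chart_map c ` (S' \<inter> chart_dom c)"
        by (auto simp: inj_on_def)
      then show ?thesis
        using S S' c by (auto intro: open_Int)
    qed
    then show "?P (S \<inter> S')"
      using S by auto
  next
    fix \<K> assume K: "\<forall>S\<in>\<K>. ?P S"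
    have "open (chart_map c ` (\<Union>\<K> \<inter> chart_dom c))" if c: "c \<in> A" for c
    proof -
      have "chart_map c ` (\<Union>\<K> \<inter> chart_dom c) = (\<Union>S\<in>\<K>. chart_map c ` (S \<inter> chart_dom c))"
        by auto
      then show ?thesis
        using K c by auto
    qed
    then show "?P (\<Union>\<K>)"
      using K by auto
  qed
  then show ?thesis
    by (simp add: manifold_topology_def topology_inverse')
qed

definition smooth_manifold :: "('a, 'e::euclidean_space) atlas \<Rightarrow> bool" where
  "smooth_manifold A \<longleftrightarrow> smooth_atlas A \<and>
     Hausdorff_space (manifold_topology A) \<and> second_countable (manifold_topology A)"

definition smooth_function :: "('a, 'e::euclidean_space) atlas \<Rightarrow> ('a \<Rightarrow> real) \<Rightarrow> bool" where
  "smooth_function A F \<longleftrightarrow> (\<forall>c\<in>A. class_C_on \<infinity> (chart_image c) (F \<circ> chart_inv c))"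

section \<open>Tangent vectors and the tangent bundle\<close>

text \<open>A tangent vector at \<open>p\<close> is the family of its coordinates in all charts at \<open>p\<close>, related by the
  derivatives of the transition maps; it is set to zero at charts whose domain does not contain \<open>p\<close>.
  The vector space operations are the pointwise ones.\<close>

type_synonym ('a, 'e) tvec = "('a, 'e) chart \<Rightarrow> 'e"

definition tangent_space :: "('a, 'e::euclidean_space) atlas \<Rightarrow> 'a \<Rightarrow> ('a, 'e) tvec set" where
  "tangent_space A p = {\<xi>.
     (\<forall>c. \<not> (c \<in> A \<and> p \<in> chart_dom c) \<longrightarrow> \<xi> c = 0) \<and>
     (\<forall>c\<in>A. \<forall>c'\<in>A. p \<in> chart_dom c \<inter> chart_dom c' \<longrightarrow>
        \<xi> c' = frechet_derivative (transition c c') (at (chart_map c p)) (\<xi> c))}"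

text \<open>The tangent vector at \<open>p\<close> whose coordinates in the chart \<open>c\<close> are \<open>e\<close>.\<close>

definition vec_of_coords ::
    "('a, 'e::euclidean_space) atlas \<Rightarrow> ('a, 'e) chart \<Rightarrow> 'a \<Rightarrow> 'e \<Rightarrow> ('a, 'e) tvec" where
  "vec_of_coords A c p e = (\<lambda>c'. if c' \<in> A \<and> p \<in> chart_dom c'
     then frechet_derivative (transition c c') (at (chart_map c p)) e else 0)"

definition smooth_vector_field ::
    "('a, 'e::euclidean_space) atlas \<Rightarrow> ('a \<Rightarrow> ('a, 'e) tvec) \<Rightarrow> bool" where
  "smooth_vector_field A X \<longleftrightarrow>
     (\<forall>p\<in>points A. X p \<in> tangent_space A p) \<and>
     (\<forall>c\<in>A. class_C_on \<infinity> (chart_image c) (\<lambda>x. X (chart_inv c x) c))"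

type_synonym ('a, 'e) tpoint = "'a \<times> ('a, 'e) tvec"

definition tangent_chart ::
    "('a, 'e::euclidean_space) atlas \<Rightarrow> ('a, 'e) chart \<Rightarrow> (('a, 'e) tpoint, 'e \<times> 'e) chart" where
  "tangent_chart A c =
     ({(p, \<xi>). p \<in> chart_dom c \<and> \<xi> \<in> tangent_space A p}, \<lambda>(p, \<xi>). (chart_map c p, \<xi> c))"

definition tangent_atlas ::
    "('a, 'e::euclidean_space) atlas \<Rightarrow> (('a, 'e) tpoint, 'e \<times> 'e) atlas" where
  "tangent_atlas A = tangent_chart A ` A"

section \<open>Riemannian metrics\<close>

type_synonym ('a, 'e) metric_tensor = "'a \<Rightarrow> ('a, 'e) tvec \<Rightarrow> ('a, 'e) tvec \<Rightarrow> real"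

definition metric_coords ::
    "('a, 'e::euclidean_space) atlas \<Rightarrow> ('a, 'e) metric_tensor \<Rightarrow> ('a, 'e) chart
       \<Rightarrow> 'e \<Rightarrow> 'e \<Rightarrow> 'e \<Rightarrow> real" where
  "metric_coords A G c x a b =
     (let p = chart_inv c x in G p (vec_of_coords A c p a) (vec_of_coords A c p b))"

definition riemannian_metric ::
    "('a, 'e::euclidean_space) atlas \<Rightarrow> ('a, 'e) metric_tensor \<Rightarrow> bool" where
  "riemannian_metric A G \<longleftrightarrow>
     (\<forall>p\<in>points A. \<forall>\<xi>\<in>tangent_space A p.
        (\<forall>\<eta>\<in>tangent_space A p. G p \<xi> \<eta> = G p \<eta> \<xi> \<and>
           (\<forall>\<zeta>\<in>tangent_space A p. \<forall>a b.
              G p (\<lambda>c. a *\<^sub>R \<xi> c + b *\<^sub>R \<eta> c) \<zeta> = a * G p \<xi> \<zeta> + b * G p \<eta> \<zeta>)) \<and>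
        (\<xi> \<noteq> (\<lambda>_. 0) \<longrightarrow> G p \<xi> \<xi> > 0)) \<and>
     (\<forall>c\<in>A. \<forall>a b. class_C_on \<infinity> (chart_image c) (\<lambda>x. metric_coords A G c x a b))"

text \<open>The gradient of \<open>F\<close> at \<open>p\<close>: the tangent vector representing the differential of \<open>F\<close>.\<close>

definition gradient ::
    "('a, 'e::euclidean_space) atlas \<Rightarrow> ('a, 'e) metric_tensor \<Rightarrow> ('a \<Rightarrow> real) \<Rightarrow> 'a
       \<Rightarrow> ('a, 'e) tvec" where
  "gradient A G F p = (THE \<xi>. \<xi> \<in> tangent_space A p \<and>
     (\<forall>\<eta>\<in>tangent_space A p. \<forall>c\<in>A. p \<in> chart_dom c \<longrightarrow>
        G p \<xi> \<eta> = frechet_derivative (F \<circ> chart_inv c) (at (chart_map c p)) (\<eta> c)))"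

text \<open>The Levi-Civita connection at the point with coordinates \<open>x\<close>, as the bilinear map
  \<open>(a, b) \<mapsto> \<Gamma>\<^sup>k\<^sub>i\<^sub>j a\<^sup>i b\<^sup>j\<close>: the unique connection that is torsion free (\<open>\<Gamma>\<close> is symmetric) and
  metric, \<open>D\<^sub>a \<langle>b, d\<rangle> = \<langle>\<nabla>\<^sub>a b, d\<rangle> + \<langle>b, \<nabla>\<^sub>a d\<rangle>\<close> for constant coordinate fields \<open>b\<close>, \<open>d\<close>.\<close>

definition christoffel ::
    "('a, 'e::euclidean_space) atlas \<Rightarrow> ('a, 'e) metric_tensor \<Rightarrow> ('a, 'e) chart
       \<Rightarrow> 'e \<Rightarrow> 'e \<Rightarrow> 'e \<Rightarrow> 'e" where
  "christoffel A G c x = (THE \<Gamma>. bilinear \<Gamma> \<and> (\<forall>a b. \<Gamma> a b = \<Gamma> b a) \<and>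
     (\<forall>a b d. frechet_derivative (\<lambda>z. metric_coords A G c z b d) (at x) a
        = metric_coords A G c x (\<Gamma> a b) d + metric_coords A G c x b (\<Gamma> a d)))"

text \<open>Coordinates of the covariant derivative \<open>D\<eta>/Dt\<close> of a vector field \<open>\<eta>\<close> along a curve, from the
  position \<open>x\<close>, velocity \<open>x'\<close>, and the field \<open>y\<close> with its derivative \<open>y'\<close> in the chart \<open>c\<close>.\<close>

definition covariant_derivative_coords ::
    "('a, 'e::euclidean_space) atlas \<Rightarrow> ('a, 'e) metric_tensor \<Rightarrow> ('a, 'e) chart
       \<Rightarrow> 'e \<Rightarrow> 'e \<Rightarrow> 'e \<Rightarrow> 'e \<Rightarrow> 'e" where
  "covariant_derivative_coords A G c x x' y y' = y' + christoffel A G c x x' y"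

section \<open>The Sasaki metric\<close>

text \<open>Horizontal part (image under the differential of the projection \<open>TM \<rightarrow> M\<close>) and vertical part
  (image under the connection map, i.e. \<open>D\<eta>/Dt\<close> for a curve \<open>(q, \<eta>)\<close> in \<open>TM\<close> with velocity \<open>\<Xi>\<close>) of a
  tangent vector \<open>\<Xi>\<close> to \<open>TM\<close> at \<open>(q, v)\<close>.\<close>

definition horizontal_part ::
    "('a, 'e::euclidean_space) atlas \<Rightarrow> ('a, 'e) tpoint \<Rightarrow> (('a, 'e) tpoint, 'e \<times> 'e) tvec
       \<Rightarrow> ('a, 'e) tvec" where
  "horizontal_part A x \<Xi> =
     (\<lambda>c. if c \<in> A \<and> fst x \<in> chart_dom c then fst (\<Xi> (tangent_chart A c)) else 0)"

definition vertical_part ::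
    "('a, 'e::euclidean_space) atlas \<Rightarrow> ('a, 'e) metric_tensor \<Rightarrow> ('a, 'e) tpoint
       \<Rightarrow> (('a, 'e) tpoint, 'e \<times> 'e) tvec \<Rightarrow> ('a, 'e) tvec" where
  "vertical_part A G x \<Xi> =
     (\<lambda>c. if c \<in> A \<and> fst x \<in> chart_dom c
       then covariant_derivative_coords A G c (chart_map c (fst x))
              (fst (\<Xi> (tangent_chart A c))) (snd x c) (snd (\<Xi> (tangent_chart A c)))
       else 0)"

definition sasaki_metric ::
    "('a, 'e::euclidean_space) atlas \<Rightarrow> ('a, 'e) metric_tensor
       \<Rightarrow> (('a, 'e) tpoint, 'e \<times> 'e) metric_tensor" where
  "sasaki_metric A G x \<Xi> \<Theta> =
     G (fst x) (horizontal_part A x \<Xi>) (horizontal_part A x \<Theta>) +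
     G (fst x) (vertical_part A G x \<Xi>) (vertical_part A G x \<Theta>)"

section \<open>The control system\<close>

text \<open>The force \<open>-\<nabla>W(q) + \<Sum>\<^sub>j f\<^sub>j(q) u\<^sub>j\<close>.\<close>

definition force ::
    "('a, 'e::euclidean_space) atlas \<Rightarrow> ('a, 'e) metric_tensor \<Rightarrow> ('a \<Rightarrow> real)
       \<Rightarrow> ('m::finite \<Rightarrow> 'a \<Rightarrow> ('a, 'e) tvec) \<Rightarrow> 'a \<Rightarrow> real^'m \<Rightarrow> ('a, 'e) tvec" where
  "force A G W f q u =
     (\<lambda>c. - gradient A G W q c + (\<Sum>j\<in>UNIV. (u $ j) *\<^sub>R f j q c))"

text \<open>\<open>h\<close> is absolutely continuous on \<open>[a,b]\<close> with almost everywhere derivative \<open>h'\<close>.\<close>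

definition has_ac_derivative ::
    "(real \<Rightarrow> 'e::euclidean_space) \<Rightarrow> (real \<Rightarrow> 'e) \<Rightarrow> real \<Rightarrow> real \<Rightarrow> bool" where
  "has_ac_derivative h h' a b \<longleftrightarrow> integrable (lebesgue_on {a..b}) h' \<and>
     (\<forall>s\<in>{a..b}. h s = h a + integral\<^sup>L (lebesgue_on {a..s}) h')"

text \<open>Controls are merely square integrable, so the equations \<open>q' = v\<close>, \<open>Dv/Dt = force\<close> are
  understood in the sense of Caratheodory, and are required in every chart on every time interval
  during which the curve \<open>\<gamma> = (q, v)\<close> stays in the chart.\<close>

definition trajectory ::
    "('a, 'e::euclidean_space) atlas \<Rightarrow> ('a, 'e) metric_tensor \<Rightarrow> ('a \<Rightarrow> real)
       \<Rightarrow> ('m::finite \<Rightarrow> 'a \<Rightarrow> ('a, 'e) tvec) \<Rightarrow> real \<Rightarrow> real \<Rightarrow> ('a, 'e) tpoint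
       \<Rightarrow> (real \<Rightarrow> real^'m) \<Rightarrow> (real \<Rightarrow> ('a, 'e) tpoint) \<Rightarrow> bool" where
  "trajectory A G W f t T x\<^sub>0 u \<gamma> \<longleftrightarrow>
     continuous_map (top_of_set {t..T}) (manifold_topology (tangent_atlas A)) \<gamma> \<and>
     \<gamma> t = x\<^sub>0 \<and>
     (\<forall>c\<in>A. \<forall>a b. t \<le> a \<and> a \<le> b \<and> b \<le> T \<and> \<gamma> ` {a..b} \<subseteq> chart_dom (tangent_chart A c) \<longrightarrow>
        (let x = (\<lambda>s. chart_map c (fst (\<gamma> s))); y = (\<lambda>s. snd (\<gamma> s) c) in
         \<exists>x' y'. has_ac_derivative x x' a b \<and> has_ac_derivative y y' a b \<and>
           (AE s in lebesgue_on {a..b}.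
              x' s = y s \<and>
              covariant_derivative_coords A G c (x s) (x' s) (y s) (y' s)
                = force A G W f (fst (\<gamma> s)) (u s) c)))"

text \<open>A control is determined up to null sets, and it determines its trajectory on \<open>[t,T]\<close>; it is
  convenient to keep both as an admissible pair.\<close>

definition admissible ::
    "('a, 'e::euclidean_space) atlas \<Rightarrow> ('a, 'e) metric_tensor \<Rightarrow> ('a \<Rightarrow> real)
       \<Rightarrow> ('m::finite \<Rightarrow> 'a \<Rightarrow> ('a, 'e) tvec) \<Rightarrow> (real^'m) set \<Rightarrow> ('a, 'e) tpoint set
       \<Rightarrow> real \<Rightarrow> real \<Rightarrow> ('a, 'e) tpoint
       \<Rightarrow> ((real \<Rightarrow> real^'m) \<times> (real \<Rightarrow> ('a, 'e) tpoint)) set" where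
  "admissible A G W f \<Omega> K t T x\<^sub>0 = {(u, \<gamma>).
     u \<in> borel_measurable (lebesgue_on {t..T}) \<and>
     integrable (lebesgue_on {t..T}) (\<lambda>s. (norm (u s))\<^sup>2) \<and>
     (AE s in lebesgue_on {t..T}. u s \<in> \<Omega>) \<and>
     trajectory A G W f t T x\<^sub>0 u \<gamma> \<and>
     \<gamma> ` {t..T} \<subseteq> K}"

text \<open>\<open>L(s, \<gamma>(s), u(s))\<close> may fail to be integrable for a square integrable \<open>u\<close>, hence the extended
  Lebesgue integral.\<close>

definition cost ::
    "(real \<Rightarrow> ('a, 'e) tpoint \<Rightarrow> real^'m::finite \<Rightarrow> real) \<Rightarrow> (('a, 'e) tpoint \<Rightarrow> real)
       \<Rightarrow> real \<Rightarrow> real \<Rightarrow> (real \<Rightarrow> real^'m) \<Rightarrow> (real \<Rightarrow> ('a, 'e) tpoint) \<Rightarrow> ereal" where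
  "cost L g t T u \<gamma> =
     enn2ereal (\<integral>\<^sup>+ s. ennreal (L s (\<gamma> s) (u s)) \<partial>lebesgue_on {t..T})
     - enn2ereal (\<integral>\<^sup>+ s. ennreal (- L s (\<gamma> s) (u s)) \<partial>lebesgue_on {t..T})
     + ereal (g (\<gamma> T))"

text \<open>The value is \<open>\<infinity>\<close> at states from which no control is admissible, in particular outside \<open>K\<close>.\<close>

definition value_function ::
    "('a, 'e::euclidean_space) atlas \<Rightarrow> ('a, 'e) metric_tensor \<Rightarrow> ('a \<Rightarrow> real)
       \<Rightarrow> ('m::finite \<Rightarrow> 'a \<Rightarrow> ('a, 'e) tvec) \<Rightarrow> (real^'m) set \<Rightarrow> ('a, 'e) tpoint set
       \<Rightarrow> (real \<Rightarrow> ('a, 'e) tpoint \<Rightarrow> real^'m \<Rightarrow> real) \<Rightarrow> (('a, 'e) tpoint \<Rightarrow> real)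
       \<Rightarrow> real \<Rightarrow> real \<Rightarrow> ('a, 'e) tpoint \<Rightarrow> ereal" where
  "value_function A G W f \<Omega> K L g T t x =
     (INF (u, \<gamma>) \<in> admissible A G W f \<Omega> K t T x. cost L g t T u \<gamma>)"

definition hamiltonian ::
    "('a, 'e::euclidean_space) atlas \<Rightarrow> ('a, 'e) metric_tensor \<Rightarrow> ('a \<Rightarrow> real)
       \<Rightarrow> ('m::finite \<Rightarrow> 'a \<Rightarrow> ('a, 'e) tvec) \<Rightarrow> (real^'m) set
       \<Rightarrow> (real \<Rightarrow> ('a, 'e) tpoint \<Rightarrow> real^'m \<Rightarrow> real)
       \<Rightarrow> real \<Rightarrow> ('a, 'e) tpoint \<Rightarrow> ('a, 'e) tvec \<Rightarrow> ('a, 'e) tvec \<Rightarrow> ereal" where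
  "hamiltonian A G W f \<Omega> L t x p\<^sub>1 p\<^sub>2 =
     (INF u\<in>\<Omega>. ereal (G (fst x) p\<^sub>1 (snd x) + G (fst x) p\<^sub>2 (force A G W f (fst x) u) + L t x u))"

definition smooth_lagrangian ::
    "('a, 'e::euclidean_space) atlas \<Rightarrow> real
       \<Rightarrow> (real \<Rightarrow> ('a, 'e) tpoint \<Rightarrow> real^'m::finite \<Rightarrow> real) \<Rightarrow> bool" where
  "smooth_lagrangian A T L \<longleftrightarrow>
     (\<forall>c\<in>tangent_atlas A. class_C_on \<infinity> ({0..T} \<times> chart_image c \<times> UNIV)
        (\<lambda>(t, z, u). L t (chart_inv c z) u))"

text \<open>An extended-real valued function of \<open>(t, x)\<close> is finite and of class \<open>C\<^sup>1\<close> on \<open>[0,T] \<times> D\<close>, for an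
  open subset \<open>D\<close> of the manifold.\<close>

definition finite_C1_on ::
    "('a, 'e::euclidean_space) atlas \<Rightarrow> real \<Rightarrow> 'a set \<Rightarrow> (real \<Rightarrow> 'a \<Rightarrow> ereal) \<Rightarrow> bool" where
  "finite_C1_on A T D V \<longleftrightarrow>
     (\<forall>t\<in>{0..T}. \<forall>x\<in>D. \<bar>V t x\<bar> \<noteq> \<infinity>) \<and>
     (\<forall>c\<in>A. class_C_on 1 ({0..T} \<times> chart_map c ` (D \<inter> chart_dom c))
        (\<lambda>(t, z). real_of_ereal (V t (chart_inv c z))))"

end

theory Submission
  imports Defs
begin

text \<open>Everything is computed in one chart of \<open>TM\<close>, where the equations of motion become
  \<open>\<zeta>' = F(\<zeta>, u)\<close> with \<open>F\<close> affine in \<open>u\<close>.  The transformation law of the Christoffel symbols shows that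
  \<open>F(\<cdot>, u)\<close> is a vector field on \<open>TM\<close>, with horizontal part \<open>v\<close> and vertical part the force; pairing
  it with the Sasaki gradient of \<open>V\<close> gives the first two terms of the Hamiltonian.

  For \<open>\<le>\<close> in dynamic programming, apply a constant control for a short time and continue almost
  optimally: the one-sided derivative of \<open>\<integral> L + V\<close> at the initial time is nonnegative, hence
  \<open>V\<^sub>t + H \<ge> 0\<close>.  For the converse suppose that \<open>V\<^sub>t + H > 0\<close> at a point.  Coercivity bounds the
  \<open>L\<^sup>2\<close> norm of almost optimal controls, so their trajectories stay close to the point for a short
  time \<open>h\<close>.  There the integrand stays bounded below by a positive constant, uniformly in \<open>u\<close>, so
  such a control misses the optimal value by at least a multiple of \<open>h\<close>, which is a contradiction.
  Differentiability of \<open>V\<close> at the initial point suffices here because the differential commutes with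
  the integral.  The time \<open>T\<close> itself is reached by continuity, again using coercivity.\<close>

section \<open>Calculus\<close>

text \<open>Three obstacles shape the proof. The state constraint: a finite value at a state
  requires an admissible curve that starts there and stays in K, so D lies in K. A short curve with
  constant control that remains in the open set D is therefore allowed, and boundary points of K
  never have to be examined. The controls: they are only square integrable, so velocities have no
  pointwise bound. Young's inequality trades |u| for 1/\<kappa> + \<kappa> |u|^2 and makes the
  coordinate length of almost optimal curves small, uniformly, on short time intervals. The first
  order remainder of V is then at most \<epsilon> times duration plus length, which is an integral
  of \<epsilon> (1 + |\<zeta>'|); the positive lower bound of the integrand must have room for this
  term. The cost: L along an admissible pair is never shown to be measurable. Coercivity makes it
  nonnegative, so costs are suprema over simple functions below the integrand, and these can be
  split at an intermediate time for arbitrary integrands.\<close>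

lemma class_C_on_continuous:
  assumes "class_C_on n S f"
  shows "continuous_on S f"
  unfolding continuous_on_eq_continuous_within
proof
  fix x assume x: "x \<in> S"
  then obtain N F where N: "open N" "x \<in> N" "\<And>k. enat k \<le> n \<Longrightarrow> C_diff_open k F N"
    and eq: "\<And>y. y \<in> N \<inter> S \<Longrightarrow> F y = f y"
    using assms unfolding class_C_on_def by metis
  have "C_diff_open 0 F N"
    using N(3)[of 0] by (simp add: zero_enat_def[symmetric])
  then have "continuous (at x) F"
    using N by (simp add: continuous_on_eq_continuous_at)
  then have "continuous (at x within S) F"
    by (rule continuous_at_imp_continuous_within)
  moreover have "\<forall>\<^sub>F y in at x within S. F y = f y"
    using N(1,2) eq unfolding eventually_at_topological by auto
  ultimately show "continuous (at x within S) f"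
    using eq[of x] x N(2) unfolding continuous_within
    by (auto intro: Lim_transform_eventually)
qed

lemma class_C_on_differentiable:
  assumes "class_C_on \<infinity> S f" "open S" "x \<in> S"
  shows "f differentiable (at x)"
proof -
  obtain N F where N: "open N" "x \<in> N" "\<And>k. C_diff_open k F N"
    and eq: "\<And>y. y \<in> N \<inter> S \<Longrightarrow> F y = f y"
    using assms unfolding class_C_on_def by force
  have "F differentiable (at x)"
    using N(3)[of 1] N(2) by simp
  then show ?thesis
    using N eq assms(2,3) unfolding differentiable_def
    by (metis (no_types, lifting) IntI has_derivative_transform_within_open open_Int)
qed

text \<open>On an open set the derivative of a local extension is the derivative of \<open>f\<close>
  itself, so the extension of order one more serves for the derivative.\<close>

lemma class_C_on_frechet_derivative:
  assumes "class_C_on \<infinity> S f" "open S"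
  shows "class_C_on \<infinity> S (\<lambda>x. frechet_derivative f (at x) v)"
  unfolding class_C_on_def
proof
  fix x assume x: "x \<in> S"
  then obtain N F where N: "open N" "x \<in> N" "\<And>k. C_diff_open k F N"
    and eq: "\<And>y. y \<in> N \<inter> S \<Longrightarrow> F y = f y"
    using assms unfolding class_C_on_def by force
  have "C_diff_open k (\<lambda>x. frechet_derivative F (at x) v) N" for k
    using N(3)[of "Suc k"] by simp
  moreover have "frechet_derivative F (at y) v = frechet_derivative f (at y) v" if "y \<in> N \<inter> S" for y
  proof -
    have "F differentiable (at y)"
      using N(3)[of 1] that by simp
    then have "frechet_derivative F (at y) = frechet_derivative f (at y)"
      using N(1) assms(2) that eq
      by (intro frechet_derivative_transform_within_open[where X = "N \<inter> S"]) auto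
    then show ?thesis by simp
  qed
  ultimately show "\<exists>N F. open N \<and> x \<in> N \<and> (\<forall>k. enat k \<le> \<infinity> \<longrightarrow> C_diff_open k F N) \<and>
      (\<forall>y\<in>N \<inter> S. F y = frechet_derivative f (at y) v)"
    using N(1,2) by blast
qed

section \<open>Basis expansions and the symmetry of second derivatives\<close>

lemma linear_basis:
  fixes L :: "'b::euclidean_space \<Rightarrow> 'c::real_vector"
  assumes "linear L"
  shows "L v = (\<Sum>i\<in>Basis. (v \<bullet> i) *\<^sub>R L i)"
proof -
  have "L v = L (\<Sum>i\<in>Basis. (v \<bullet> i) *\<^sub>R i)"
    by (simp add: euclidean_representation)
  then show ?thesis
    by (simp add: linear_sum[OF assms] linear_scale[OF assms])
qed

lemmas frechet_derivative_basis = linear_basis[OF linear_frechet_derivative]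

text \<open>Young's argument: \<open>f (x + ta + tb) - f (x + ta) - f (x + tb) + f x\<close>, divided by \<open>t\<^sup>2\<close>, tends to
  either mixed derivative.\<close>

lemma second_difference_estimate:
  fixes f :: "'b::real_normed_vector \<Rightarrow> real"
  assumes S: "open S" "x \<in> S"
    and f: "\<And>y. y \<in> S \<Longrightarrow> (f has_derivative f' y) (at y)"
    and f': "((\<lambda>y. f' y a) has_derivative B) (at x)"
    and e: "e > 0"
  shows "\<forall>\<^sub>F t in at_right 0.
    \<bar>f (x + t *\<^sub>R a + t *\<^sub>R b) - f (x + t *\<^sub>R a) - f (x + t *\<^sub>R b) + f x - t\<^sup>2 * B b\<bar> \<le> e * t\<^sup>2"
proof -
  \<comment> \<open>The differential is compared with its linearization at two points, at distances
    at most t (|a| + |b|) and t |a| from \<open>x\<close>. Their sum is below t k; the summand 1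
    keeps \<open>k\<close> positive.\<close>
  define k where "k = 2 * norm a + norm b + 1"
  have k: "k > 0" unfolding k_def by (simp add: add_nonneg_pos)
  have B: "linear B" using f' by (rule has_derivative_linear)
  obtain r where r: "r > 0" "ball x r \<subseteq> S"
    using S by (auto simp: open_contains_ball)
  obtain d where d: "d > 0" and db: "\<And>y. norm (y - x) < d \<Longrightarrow>
      norm (f' y a - f' x a - B (y - x)) \<le> (e / k) * norm (y - x)"
    using f' e k unfolding has_derivative_at_alt by (meson divide_pos_pos)
  define t0 where "t0 = min r d / k"
  have t0: "t0 > 0" using r d k by (simp add: t0_def)
  have main: "\<bar>f (x + t *\<^sub>R a + t *\<^sub>R b) - f (x + t *\<^sub>R a) - f (x + t *\<^sub>R b) + f x - t\<^sup>2 * B b\<bar> \<le> e * t\<^sup>2"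
    if t: "0 < t" "t < t0" for t
  proof -
    have tk: "t * k < min r d"
      using t k by (simp add: t0_def pos_less_divide_eq)
    have near: "norm (s *\<^sub>R a + c *\<^sub>R b) \<le> t * (norm a + norm b)" if "0 \<le> s" "s \<le> t" "0 \<le> c" "c \<le> t" for s c
    proof -
      have "norm (s *\<^sub>R a + c *\<^sub>R b) \<le> s * norm a + c * norm b"
        using that norm_triangle_ineq[of "s *\<^sub>R a" "c *\<^sub>R b"] by simp
      also have "\<dots> \<le> t * norm a + t * norm b"
        using that by (intro add_mono mult_right_mono) auto
      finally show ?thesis by (simp add: algebra_simps)
    qed
    have tk2: "t * (norm a + norm b) < min r d"
    proof -
      have "t * (norm a + norm b) \<le> t * k"
        using t by (intro mult_left_mono) (auto simp: k_def)
      then show ?thesis using tk by linarith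
    qed
    have inS: "x + s *\<^sub>R a + c *\<^sub>R b \<in> S" if "0 \<le> s" "s \<le> t" "0 \<le> c" "c \<le> t" for s c
    proof -
      have "norm (s *\<^sub>R a + c *\<^sub>R b) < r" using near[OF that] tk2 by linarith
      then have "dist x (x + s *\<^sub>R a + c *\<^sub>R b) < r"
        by (simp add: dist_norm add.assoc norm_minus_cancel[of "s *\<^sub>R a + c *\<^sub>R b", symmetric] del: norm_minus_cancel)
      then show ?thesis using r by auto
    qed
    \<comment> \<open>The second difference is \<open>h t - h 0\<close>. The mean value theorem
      turns it into \<open>t\<close> times the change of \<open>f' _ a\<close> between two points
      that differ by t b.\<close>
    define h where "h s = f (x + s *\<^sub>R a + t *\<^sub>R b) - f (x + s *\<^sub>R a)" for s
    have dh: "(h has_real_derivative f' (x + s *\<^sub>R a + t *\<^sub>R b) a - f' (x + s *\<^sub>R a) a) (at s)"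
      if "0 \<le> s" "s \<le> t" for s
    proof -
      have 1: "x + s *\<^sub>R a + t *\<^sub>R b \<in> S" "x + s *\<^sub>R a \<in> S"
        using inS[of s t] inS[of s 0] that by auto
      have l: "linear (f' y)" if "y \<in> S" for y using f[OF that] by (rule has_derivative_linear)
      have "((\<lambda>s. f (x + s *\<^sub>R a + t *\<^sub>R b)) has_derivative (\<lambda>c. f' (x + s *\<^sub>R a + t *\<^sub>R b) (c *\<^sub>R a))) (at s)"
        by (rule has_derivative_compose[where g = f and f = "\<lambda>s. x + s *\<^sub>R a + t *\<^sub>R b", OF _ f[OF 1(1)]]) (auto intro!: derivative_eq_intros)
      moreover have "((\<lambda>s. f (x + s *\<^sub>R a)) has_derivative (\<lambda>c. f' (x + s *\<^sub>R a) (c *\<^sub>R a))) (at s)"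
        by (rule has_derivative_compose[where g = f and f = "\<lambda>s. x + s *\<^sub>R a", OF _ f[OF 1(2)]]) (auto intro!: derivative_eq_intros)
      ultimately have "(h has_derivative (\<lambda>c. f' (x + s *\<^sub>R a + t *\<^sub>R b) (c *\<^sub>R a) - f' (x + s *\<^sub>R a) (c *\<^sub>R a))) (at s)"
        unfolding h_def by (rule has_derivative_diff)
      then show ?thesis
        unfolding has_field_derivative_def
        by (rule has_derivative_eq_rhs)
          (simp add: fun_eq_iff linear_scale[OF l[OF 1(1)]] linear_scale[OF l[OF 1(2)]] right_diff_distrib left_diff_distrib mult.commute)
    qed
    obtain s where s: "0 < s" "s < t"
      "h t - h 0 = (t - 0) * (f' (x + s *\<^sub>R a + t *\<^sub>R b) a - f' (x + s *\<^sub>R a) a)"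
      using MVT2[of 0 t h "\<lambda>s. f' (x + s *\<^sub>R a + t *\<^sub>R b) a - f' (x + s *\<^sub>R a) a"] t dh by auto
    let ?y = "x + s *\<^sub>R a + t *\<^sub>R b" and ?z = "x + s *\<^sub>R a"
    have y: "norm (?y - x) \<le> t * (norm a + norm b)"
      using near[of s t] s t by (simp add: algebra_simps)
    have z: "norm (?z - x) \<le> t * norm a"
      using s t by (simp add: mult_right_mono)
    have "t * norm a \<le> t * (norm a + norm b)" using t by (simp add: algebra_simps)
    then have "norm (?z - x) < d" "norm (?y - x) < d" using z y tk2 by linarith+
    from db[OF this(1)] db[OF this(2)]
    have "\<bar>f' ?y a - f' x a - B (?y - x)\<bar> \<le> (e / k) * (t * (norm a + norm b))"
      "\<bar>f' ?z a - f' x a - B (?z - x)\<bar> \<le> (e / k) * (t * norm a)"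
      using mult_left_mono[OF y, of "e/k"] mult_left_mono[OF z, of "e/k"] e k by auto
    then have "\<bar>f' ?y a - f' ?z a - (B (?y - x) - B (?z - x))\<bar> \<le> (e / k) * (t * (norm a + norm b)) + (e / k) * (t * norm a)"
      by linarith
    also have "B (?y - x) - B (?z - x) = t * B b"
      by (simp add: linear_add[OF B] linear_scale[OF B] add.assoc)
    also have "(e / k) * (t * (norm a + norm b)) + (e / k) * (t * norm a) \<le> (e / k) * (t * k)"
    proof -
      have "t * (norm a + norm b) + t * norm a \<le> t * k"
        using t by (simp add: k_def algebra_simps)
      then have "(e / k) * (t * (norm a + norm b) + t * norm a) \<le> (e/k) * (t * k)"
        using e k by (intro mult_left_mono) auto
      then show ?thesis by (simp only: distrib_left)
    qed
    also have "\<dots> = e * t" using k by simp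
    finally have *: "\<bar>f' ?y a - f' ?z a - t * B b\<bar> \<le> e * t" .
    have "f (x + t *\<^sub>R a + t *\<^sub>R b) - f (x + t *\<^sub>R a) - f (x + t *\<^sub>R b) + f x - t\<^sup>2 * B b
        = t * (f' ?y a - f' ?z a - t * B b)"
      using s(3) by (simp add: h_def algebra_simps power2_eq_square)
    then have "\<bar>f (x + t *\<^sub>R a + t *\<^sub>R b) - f (x + t *\<^sub>R a) - f (x + t *\<^sub>R b) + f x - t\<^sup>2 * B b\<bar>
        = t * \<bar>f' ?y a - f' ?z a - t * B b\<bar>"
      using t by (simp add: abs_mult)
    also have "\<dots> \<le> t * (e * t)" using * t by (intro mult_left_mono) auto
    finally show ?thesis by (simp add: power2_eq_square algebra_simps)
  qed
  show ?thesis
    unfolding eventually_at_right_field using main t0 by blast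
qed

text \<open>The second difference does not change when \<open>a\<close> and \<open>b\<close> are
  exchanged, so t^2 A b and t^2 B a both approximate it up to e t^2. Divide by t^2 and let
  \<open>e\<close> tend to 0.\<close>

lemma second_derivative_symmetric_real:
  fixes f :: "'b::real_normed_vector \<Rightarrow> real"
  assumes S: "open S" "x \<in> S"
    and f: "\<And>y. y \<in> S \<Longrightarrow> (f has_derivative f' y) (at y)"
    and A: "((\<lambda>y. f' y a) has_derivative A) (at x)"
    and B: "((\<lambda>y. f' y b) has_derivative B) (at x)"
  shows "A b = B a"
proof -
  have *: "\<bar>A b - B a\<bar> \<le> 2 * e" if e: "e > 0" for e
  proof -
    have ev: "\<forall>\<^sub>F t in at_right (0::real). t > 0 \<and>
      \<bar>f (x + t *\<^sub>R a + t *\<^sub>R b) - f (x + t *\<^sub>R a) - f (x + t *\<^sub>R b) + f x - t\<^sup>2 * A b\<bar> \<le> e * t\<^sup>2 \<and>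
      \<bar>f (x + t *\<^sub>R b + t *\<^sub>R a) - f (x + t *\<^sub>R b) - f (x + t *\<^sub>R a) + f x - t\<^sup>2 * B a\<bar> \<le> e * t\<^sup>2"
      using second_difference_estimate[OF S f A e, of b] second_difference_estimate[OF S f B e, of a]
        eventually_at_right_less[of "0::real"]
      by (intro eventually_conj) auto
    then obtain t where t: "t > 0"
      "\<bar>f (x + t *\<^sub>R a + t *\<^sub>R b) - f (x + t *\<^sub>R a) - f (x + t *\<^sub>R b) + f x - t\<^sup>2 * A b\<bar> \<le> e * t\<^sup>2"
      "\<bar>f (x + t *\<^sub>R b + t *\<^sub>R a) - f (x + t *\<^sub>R b) - f (x + t *\<^sub>R a) + f x - t\<^sup>2 * B a\<bar> \<le> e * t\<^sup>2"
      using eventually_happens[OF ev] by auto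
    have "x + t *\<^sub>R b + t *\<^sub>R a = x + t *\<^sub>R a + t *\<^sub>R b" by simp
    moreover have "\<bar>X - Y\<bar> \<le> 2 * E" if "\<bar>p - q - r + s - X\<bar> \<le> E" "\<bar>p - r - q + s - Y\<bar> \<le> E"
      for p q r s X Y E :: real using that by linarith
    ultimately have "\<bar>t\<^sup>2 * A b - t\<^sup>2 * B a\<bar> \<le> 2 * (e * t\<^sup>2)"
      using t(2,3) by metis
    moreover have "\<bar>t\<^sup>2 * A b - t\<^sup>2 * B a\<bar> = t\<^sup>2 * \<bar>A b - B a\<bar>"
      by (simp add: abs_mult right_diff_distrib[symmetric])
    ultimately have "t\<^sup>2 * \<bar>A b - B a\<bar> \<le> t\<^sup>2 * (2 * e)" by (simp add: mult_ac)
    then show ?thesis using mult_le_cancel_left_pos[of "t\<^sup>2" "\<bar>A b - B a\<bar>" "2 * e"] t(1) by simp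
  qed
  then have "\<bar>A b - B a\<bar> \<le> e" if "e > 0" for e
    using *[of "e/2"] that by simp
  then have "\<bar>A b - B a\<bar> \<le> 0"
    using field_le_epsilon[of "\<bar>A b - B a\<bar>" 0] by simp
  then show ?thesis by simp
qed

lemma second_derivative_symmetric:
  fixes f :: "'b::euclidean_space \<Rightarrow> 'c::euclidean_space"
  assumes f: "class_C_on \<infinity> S f" and S: "open S" "x \<in> S"
  shows "frechet_derivative (\<lambda>y. frechet_derivative f (at y) b) (at x) a
       = frechet_derivative (\<lambda>y. frechet_derivative f (at y) a) (at x) b"
proof (rule euclidean_eqI)
  fix i :: 'c assume "i \<in> Basis"
  have *: "((\<lambda>y. frechet_derivative f (at y) v \<bullet> i) has_derivative
       (\<lambda>w. frechet_derivative (\<lambda>y. frechet_derivative f (at y) v) (at x) w \<bullet> i)) (at x)" for v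
    using class_C_on_differentiable[OF class_C_on_frechet_derivative[OF f S(1)] S]
    by (intro has_derivative_inner_left) (simp add: frechet_derivative_works)
  have "((\<lambda>y. f y \<bullet> i) has_derivative (\<lambda>v. frechet_derivative f (at y) v \<bullet> i)) (at y)" if "y \<in> S" for y
    using class_C_on_differentiable[OF f S(1) that]
    by (intro has_derivative_inner_left) (simp add: frechet_derivative_works)
  from second_derivative_symmetric_real[OF S this * *, of b a]
  show "frechet_derivative (\<lambda>y. frechet_derivative f (at y) b) (at x) a \<bullet> i
       = frechet_derivative (\<lambda>y. frechet_derivative f (at y) a) (at x) b \<bullet> i"
    by simp
qed

section \<open>Local Lipschitz continuity\<close>

text \<open>The regularity used for all objects derived from the metric. It suffices for Picard's
  theorem and passes to vectors that are only known as solutions of linear equations, such as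
  gradients and Christoffel symbols.\<close>

definition loclip_at :: "('b::metric_space \<Rightarrow> 'c::real_normed_vector) \<Rightarrow> 'b \<Rightarrow> bool" where
  "loclip_at h z \<longleftrightarrow> (\<exists>C r. r > 0 \<and> C-lipschitz_on (ball z r) h)"

lemma loclip_atI:
  assumes "r > 0" "\<And>x y. x \<in> ball z r \<Longrightarrow> y \<in> ball z r \<Longrightarrow> norm (h x - h y) \<le> C * dist x y"
  shows "loclip_at h z"
proof -
  have "norm (h x - h y) \<le> \<bar>C\<bar> * dist x y" if "x \<in> ball z r" "y \<in> ball z r" for x y
    using assms(2)[OF that] by (smt (verit) mult_right_mono zero_le_dist)
  then show ?thesis
    unfolding loclip_at_def using \<open>r > 0\<close>
    by (intro exI[of _ "\<bar>C\<bar>"] exI[of _ r]) (auto intro!: lipschitz_onI simp: dist_norm)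
qed

lemma loclip_atE:
  assumes "loclip_at h z"
  obtains C r where "C \<ge> 0" "r > 0"
    "\<And>x y. x \<in> ball z r \<Longrightarrow> y \<in> ball z r \<Longrightarrow> norm (h x - h y) \<le> C * dist x y"
  using assms lipschitz_on_nonneg lipschitz_onD unfolding loclip_at_def by (metis dist_norm)

lemma loclip_atE2:
  assumes "loclip_at h z" "loclip_at k z"
  obtains C r where "r > 0" "C-lipschitz_on (ball z r) h" "C-lipschitz_on (ball z r) k"
proof -
  obtain C r D s where "r > 0" "C-lipschitz_on (ball z r) h" "s > 0" "D-lipschitz_on (ball z s) k"
    using assms unfolding loclip_at_def by blast
  then show ?thesis
    by (intro that[of "min r s" "max C D"]) (auto elim!: lipschitz_on_mono)
qed

lemma loclip_at_bounded:
  assumes "loclip_at h z"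
  obtains M r where "M > 0" "r > 0" "\<And>x. x \<in> ball z r \<Longrightarrow> norm (h x) \<le> M"
proof -
  obtain C r where C: "C \<ge> 0" "r > 0"
    "\<And>x y. x \<in> ball z r \<Longrightarrow> y \<in> ball z r \<Longrightarrow> norm (h x - h y) \<le> C * dist x y"
    using loclip_atE[OF assms] by blast
  have "norm (h x) \<le> norm (h z) + C * r + 1" if "x \<in> ball z r" for x
  proof -
    have "norm (h x - h z) \<le> C * dist x z" using C that by auto
    also have "\<dots> \<le> C * r" using C that by (intro mult_left_mono) (auto simp: dist_commute)
    finally show ?thesis using norm_triangle_ineq2[of "h x" "h z"] by linarith
  qed
  moreover have "norm (h z) + C * r + 1 > 0" using C by (simp add: add_nonneg_pos)
  ultimately show ?thesis using C that by blast
qed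

lemma loclip_at_continuous:
  assumes "loclip_at h z"
  shows "continuous (at z) h"
proof -
  obtain C r where "r > 0" "C-lipschitz_on (ball z r) h" using assms unfolding loclip_at_def by blast
  then show ?thesis
    using lipschitz_on_continuous_within[of C "ball z r" h z] by (simp add: at_within_open[OF _ open_ball])
qed

lemma loclip_at_cong:
  assumes "loclip_at h z" "open U" "z \<in> U" "\<And>x. x \<in> U \<Longrightarrow> h x = k x"
  shows "loclip_at k z"
proof -
  obtain C r where C: "r > 0" "C-lipschitz_on (ball z r) h" using assms(1) unfolding loclip_at_def by blast
  obtain d where d: "d > 0" "ball z d \<subseteq> U" using assms by (meson openE)
  have "C-lipschitz_on (ball z (min r d)) h" by (rule lipschitz_on_subset[OF C(2)]) auto
  then have "C-lipschitz_on (ball z (min r d)) k"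
    by (rule lipschitz_on_transform) (use d assms(4) in auto)
  then show ?thesis unfolding loclip_at_def using C(1) d(1) by (metis min_less_iff_conj)
qed

lemma loclip_at_const: "loclip_at (\<lambda>x. c) z"
  by (rule loclip_atI[of 1 _ _ 0]) auto

lemma loclip_at_comp_lipschitz:
  assumes "loclip_at h (p z)" "\<And>x y. dist (p x) (p y) \<le> dist x y"
  shows "loclip_at (\<lambda>x. h (p x)) z"
proof -
  obtain C r where C: "C \<ge> 0" "r > 0"
    "\<And>x y. x \<in> ball (p z) r \<Longrightarrow> y \<in> ball (p z) r \<Longrightarrow> norm (h x - h y) \<le> C * dist x y"
    using loclip_atE[OF assms(1)] by blast
  show ?thesis
  proof (rule loclip_atI[of r _ _ C])
    fix x y assume "x \<in> ball z r" "y \<in> ball z r"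
    then have "p x \<in> ball (p z) r" "p y \<in> ball (p z) r"
      using assms(2)[of z x] assms(2)[of z y] by auto
    then have "norm (h (p x) - h (p y)) \<le> C * dist (p x) (p y)" by (rule C)
    also have "\<dots> \<le> C * dist x y" using C assms(2) by (intro mult_left_mono)
    finally show "norm (h (p x) - h (p y)) \<le> C * dist x y" .
  qed (use C in auto)
qed

lemma loclip_at_add:
  assumes "loclip_at h z" "loclip_at k z"
  shows "loclip_at (\<lambda>x. h x + k x) z"
  using loclip_atE2[OF assms] lipschitz_on_add unfolding loclip_at_def by metis

lemma loclip_at_sum:
  assumes "\<And>i. i \<in> I \<Longrightarrow> loclip_at (h i) z"
  shows "loclip_at (\<lambda>x. \<Sum>i\<in>I. h i x) z"
  using assms
  by (induction I rule: infinite_finite_induct) (auto intro!: loclip_at_const loclip_at_add)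

lemma loclip_at_scaleR:
  assumes "loclip_at h z" "loclip_at k z"
  shows "loclip_at (\<lambda>x. h x *\<^sub>R k x) z"
proof -
  obtain C r where C: "r > 0" "C-lipschitz_on (ball z r) h" "C-lipschitz_on (ball z r) k"
    using loclip_atE2[OF assms] by blast
  obtain M r1 where M: "M > 0" "r1 > 0" "\<And>x. x \<in> ball z r1 \<Longrightarrow> norm (h x) \<le> M"
    using loclip_at_bounded[OF assms(1)] by blast
  obtain N s1 where N: "N > 0" "s1 > 0" "\<And>x. x \<in> ball z s1 \<Longrightarrow> norm (k x) \<le> N"
    using loclip_at_bounded[OF assms(2)] by blast
  show ?thesis
  proof (rule loclip_atI[of "min r (min r1 s1)" _ _ "C * N + M * C"])
    fix x y assume xy: "x \<in> ball z (min r (min r1 s1))" "y \<in> ball z (min r (min r1 s1))"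
    have "h x *\<^sub>R k x - h y *\<^sub>R k y = (h x - h y) *\<^sub>R k x + h y *\<^sub>R (k x - k y)"
      by (simp add: algebra_simps)
    then have "norm (h x *\<^sub>R k x - h y *\<^sub>R k y) \<le> norm (h x - h y) * norm (k x) + norm (h y) * norm (k x - k y)"
      by (metis norm_scaleR norm_triangle_ineq real_norm_def)
    also have "\<dots> \<le> (C * dist x y) * N + M * (C * dist x y)"
      using lipschitz_onD[OF C(2), of x y] lipschitz_onD[OF C(3), of x y] lipschitz_on_nonneg[OF C(2)] M N xy
      by (intro add_mono mult_mono) (auto simp: dist_norm)
    finally show "norm (h x *\<^sub>R k x - h y *\<^sub>R k y) \<le> (C * N + M * C) * dist x y"
      by (simp add: algebra_simps)
  qed (use C M N in auto)
qed

lemma loclip_at_Pair: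
  assumes "loclip_at h z" "loclip_at k z"
  shows "loclip_at (\<lambda>x. (h x, k x)) z"
proof -
  obtain C r where C: "r > 0" "C-lipschitz_on (ball z r) h" "C-lipschitz_on (ball z r) k"
    using loclip_atE2[OF assms] by blast
  show ?thesis
  proof (rule loclip_atI[OF C(1), where C = "C + C"])
    fix x y assume "x \<in> ball z r" "y \<in> ball z r"
    then show "norm ((h x, k x) - (h y, k y)) \<le> (C + C) * dist x y"
      using norm_Pair_le[of "h x - h y" "k x - k y"] lipschitz_onD[OF C(2)] lipschitz_onD[OF C(3)]
      by (fastforce simp: dist_norm distrib_right)
  qed
qed

lemma loclip_at_bounded_linear:
  assumes "bounded_linear h" shows "loclip_at h z"
proof -
  obtain K where "\<And>x. norm (h x) \<le> norm x * K"
    using assms bounded_linear.bounded by blast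
  then have "norm (h x - h y) \<le> K * dist x y" for x y
    using linear_diff[OF bounded_linear.linear[OF assms]] by (metis dist_norm mult.commute)
  then show ?thesis by (intro loclip_atI[of 1]) auto
qed

text \<open>The partial derivatives are continuous, hence bounded on a compact ball, and the sum of
  their norms dominates the operator norm of the derivative. The mean value inequality on the convex
  ball gives the Lipschitz bound.\<close>

lemma class_C_on_loclip:
  fixes f :: "'b::euclidean_space \<Rightarrow> 'c::real_normed_vector"
  assumes f: "class_C_on \<infinity> S f" and S: "open S" "x \<in> S"
  shows "loclip_at f x"
proof -
  obtain r where r: "r > 0" "cball x r \<subseteq> S"
    using S by (auto simp: open_contains_cball)
  define M where "M y = (\<Sum>i\<in>Basis. norm (frechet_derivative f (at y) i))" for y
  have "continuous_on (cball x r) M"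
    unfolding M_def
    using class_C_on_continuous[OF class_C_on_frechet_derivative[OF f S(1)]] r
    by (intro continuous_intros) (auto intro: continuous_on_subset)
  then obtain C where C: "\<And>y. y \<in> cball x r \<Longrightarrow> M y \<le> C"
    using compact_continuous_image[of "cball x r" M] compact_imp_bounded bounded_iff
    by (metis abs_le_D1 compact_cball image_eqI real_norm_def)
  have d: "f differentiable (at y)" if "y \<in> cball x r" for y
    using class_C_on_differentiable[OF f S(1)] r that by auto
  have "norm (f y - f z) \<le> C * norm (y - z)" if yz: "y \<in> cball x r" "z \<in> cball x r" for y z
  proof (rule differentiable_bound[where S = "cball x r" and f' = "\<lambda>y. frechet_derivative f (at y)"])
    fix y assume y: "y \<in> cball x r"
    show "(f has_derivative frechet_derivative f (at y)) (at y within cball x r)"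
      using d[OF y] frechet_derivative_works has_derivative_at_withinI by blast
    show "onorm (frechet_derivative f (at y)) \<le> C"
    proof (rule onorm_le)
      fix v
      have "norm (frechet_derivative f (at y) v) \<le> (\<Sum>i\<in>Basis. norm ((v \<bullet> i) *\<^sub>R frechet_derivative f (at y) i))"
        unfolding frechet_derivative_basis[OF d[OF y], of v] by (rule norm_sum)
      also have "\<dots> \<le> (\<Sum>i\<in>Basis. norm v * norm (frechet_derivative f (at y) i))"
        by (intro sum_mono) (auto intro!: mult_right_mono Basis_le_norm)
      also have "\<dots> = norm v * M y" by (simp add: M_def sum_distrib_left)
      also have "\<dots> \<le> norm v * C" using C[OF y] by (intro mult_left_mono) auto
      finally show "norm (frechet_derivative f (at y) v) \<le> C * norm v" by (simp add: mult.commute)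
    qed
  qed (use yz in auto)
  then show ?thesis
    using r(1) by (intro loclip_atI[of r _ _ C]) (auto simp: dist_norm)
qed

section \<open>Riesz representation and its dependence on parameters\<close>

text \<open>The map \<open>J\<close> lists the values \<open>B w i\<close> on the basis, so the
  claim is a square linear system. Positivity makes \<open>J\<close> injective, and in finite
  dimension it is then surjective.\<close>

lemma riesz_bilinear:
  fixes B :: "'e::euclidean_space \<Rightarrow> 'e \<Rightarrow> real"
  assumes B: "bilinear B" and pos: "\<And>a. a \<noteq> 0 \<Longrightarrow> B a a > 0" and \<phi>: "linear \<phi>"
  shows "\<exists>w. \<forall>b. B w b = \<phi> b"
proof -
  define J where "J w = (\<Sum>i\<in>Basis. B w i *\<^sub>R i)" for w
  have "linear J"
    unfolding J_def
    by (intro linearI)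
      (simp_all add: bilinear_ladd[OF B] bilinear_lmul[OF B] algebra_simps sum.distrib scaleR_sum_right)
  have Bsum: "B w b = (\<Sum>i\<in>Basis. (b \<bullet> i) * B w i)" for w b
    using linear_basis[of "B w" b] B by (simp add: bilinear_def)
  have J_coord: "J w \<bullet> i = B w i" if "i \<in> Basis" for w i
    using that by (simp add: J_def)
  have "inj J"
  proof (rule linear_injective_0[OF \<open>linear J\<close>, THEN iffD2], intro allI impI)
    fix a assume "J a = 0"
    then have "B a i = 0" if "i \<in> Basis" for i using J_coord[OF that, of a] by simp
    then have "B a a = 0" by (subst Bsum) simp
    then show "a = 0" using pos[of a] by force
  qed
  then have "surj J" using \<open>linear J\<close> linear_injective_imp_surjective by blast
  then obtain w where w: "(\<Sum>i\<in>Basis. \<phi> i *\<^sub>R i) = J w" by (meson surjD)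
  have "B w b = \<phi> b" for b
  proof -
    have "B w i = \<phi> i" if "i \<in> Basis" for i
      using J_coord[OF that, of w] w that by (metis inner_sum_left_Basis)
    then have "B w b = (\<Sum>i\<in>Basis. (b \<bullet> i) * \<phi> i)" by (subst Bsum) simp
    then show ?thesis using linear_basis[OF \<phi>, of b] by simp
  qed
  then show ?thesis by blast
qed

lemma posdef_unique:
  fixes B :: "'e::real_vector \<Rightarrow> 'e \<Rightarrow> real"
  assumes B: "bilinear B" and pos: "\<And>a. a \<noteq> 0 \<Longrightarrow> B a a > 0" and eq: "\<And>b. B w b = B w' b"
  shows "w = w'"
proof (rule ccontr)
  assume "w \<noteq> w'"
  then have "B (w - w') (w - w') > 0" by (intro pos) simp
  then show False by (simp add: bilinear_lsub[OF B] eq)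
qed

text \<open>The functional is the inner product with the vector of its values on the basis.
  Lipschitz continuity of that single vector becomes an estimate uniform in the argument by the
  Cauchy-Schwarz inequality.\<close>

lemma loclip_at_linear_functional:
  fixes \<phi> :: "'z::metric_space \<Rightarrow> 'e::euclidean_space \<Rightarrow> real"
  assumes "open U" "z \<in> U" "\<And>x. x \<in> U \<Longrightarrow> linear (\<phi> x)" and loc: "\<And>b. loclip_at (\<lambda>x. \<phi> x b) z"
  obtains C r where "C \<ge> 0" "r > 0" "ball z r \<subseteq> U"
    "\<And>x y b. x \<in> ball z r \<Longrightarrow> y \<in> ball z r \<Longrightarrow> \<bar>\<phi> x b - \<phi> y b\<bar> \<le> C * dist x y * norm b"
    "\<And>x b. x \<in> ball z r \<Longrightarrow> \<bar>\<phi> x b\<bar> \<le> C * norm b"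
proof -
  have "loclip_at (\<lambda>x. \<Sum>i\<in>Basis. \<phi> x i *\<^sub>R i) z" (is "loclip_at ?h z")
    by (intro loclip_at_sum loclip_at_scaleR loclip_at_const loc)
  note loc_h = this
  obtain C r where C: "C \<ge> 0" "r > 0"
    "\<And>x y. x \<in> ball z r \<Longrightarrow> y \<in> ball z r \<Longrightarrow> norm (?h x - ?h y) \<le> C * dist x y"
    using loclip_atE[OF loc_h] by blast
  obtain M s where M: "M > 0" "s > 0" "\<And>x. x \<in> ball z s \<Longrightarrow> norm (?h x) \<le> M"
    using loclip_at_bounded[OF loc_h] by blast
  obtain d where d: "d > 0" "ball z d \<subseteq> U" using assms(1,2) openE by blast
  have inner: "\<phi> x b = ?h x \<bullet> b" if "x \<in> U" for x b
  proof -
    have "\<phi> x b = (\<Sum>i\<in>Basis. (b \<bullet> i) *\<^sub>R \<phi> x i)" using assms(3)[OF that] by (rule linear_basis)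
    then show ?thesis by (simp add: inner_sum_right inner_commute[of _ b] mult.commute)
  qed
  let ?r = "min (min r s) d"
  have 1: "\<bar>\<phi> x b - \<phi> y b\<bar> \<le> max C M * dist x y * norm b" if "x \<in> ball z ?r" "y \<in> ball z ?r" for x y b
  proof -
    have "x \<in> U" "y \<in> U" using that d by auto
    then have "\<bar>\<phi> x b - \<phi> y b\<bar> = \<bar>(?h x - ?h y) \<bullet> b\<bar>"
      unfolding inner_diff_left using inner[of x b] inner[of y b] by presburger
    also have "\<dots> \<le> norm (?h x - ?h y) * norm b" by (rule Cauchy_Schwarz_ineq2)
    also have "\<dots> \<le> (C * dist x y) * norm b" using C that by (intro mult_right_mono) auto
    also have "\<dots> \<le> max C M * dist x y * norm b" by (intro mult_right_mono) auto
    finally show ?thesis .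
  qed
  have 2: "\<bar>\<phi> x b\<bar> \<le> max C M * norm b" if "x \<in> ball z ?r" for x b
  proof -
    have "x \<in> U" using that d by auto
    then have "\<bar>\<phi> x b\<bar> = \<bar>?h x \<bullet> b\<bar>" using inner[of x b] by presburger
    also have "\<dots> \<le> norm (?h x) * norm b" by (rule Cauchy_Schwarz_ineq2)
    also have "\<dots> \<le> max C M * norm b" using M that by (intro mult_right_mono) (auto simp: le_max_iff_disj)
    finally show ?thesis .
  qed
  show ?thesis
    by (rule that[of "max C M" ?r, OF _ _ _ 1 2]) (use C M d in auto)
qed

lemma bilinear_basis_sum:
  fixes B :: "'e::euclidean_space \<Rightarrow> 'e \<Rightarrow> 'f::real_vector"
  assumes B: "bilinear B"
  shows "B a b = (\<Sum>i\<in>Basis. \<Sum>j\<in>Basis. ((a \<bullet> i) * (b \<bullet> j)) *\<^sub>R B i j)"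
proof -
  have "B a b = B (\<Sum>i\<in>Basis. (a \<bullet> i) *\<^sub>R i) (\<Sum>j\<in>Basis. (b \<bullet> j) *\<^sub>R j)"
    by (simp add: euclidean_representation)
  also have "\<dots> = (\<Sum>(i,j)\<in>Basis \<times> Basis. B ((a \<bullet> i) *\<^sub>R i) ((b \<bullet> j) *\<^sub>R j))"
    by (rule bilinear_sum[OF B])
  also have "\<dots> = (\<Sum>(i,j)\<in>Basis \<times> Basis. ((a \<bullet> i) * (b \<bullet> j)) *\<^sub>R B i j)"
    by (intro sum.cong) (auto simp: bilinear_lmul[OF B] bilinear_rmul[OF B])
  finally show ?thesis by (simp add: sum.cartesian_product)
qed

lemma bilinear_basis:
  fixes B :: "'e::euclidean_space \<Rightarrow> 'e \<Rightarrow> real"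
  assumes "bilinear B"
  shows "B a b = (\<Sum>i\<in>Basis. \<Sum>j\<in>Basis. (a \<bullet> i) * (b \<bullet> j) * B i j)"
  by (rule bilinear_basis_sum[OF assms, unfolded real_scaleR_def])

text \<open>Lipschitz dependence is obtained by testing the difference of the two equations with
  \<open>w x - w y\<close>, without inverting the Gram matrix.\<close>

lemma loclip_at_riesz:
  fixes B :: "'z::metric_space \<Rightarrow> 'e::euclidean_space \<Rightarrow> 'e \<Rightarrow> real"
  assumes U: "open U" "z \<in> U"
    and B: "\<And>x. x \<in> U \<Longrightarrow> bilinear (B x)"
    and pos: "\<And>a. a \<noteq> 0 \<Longrightarrow> B z a a > 0"
    and locB: "\<And>a b. loclip_at (\<lambda>x. B x a b) z"
    and \<phi>: "\<And>x. x \<in> U \<Longrightarrow> linear (\<phi> x)"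
    and loc\<phi>: "\<And>b. loclip_at (\<lambda>x. \<phi> x b) z"
    and w: "\<And>x b. x \<in> U \<Longrightarrow> B x (w x) b = \<phi> x b"
  shows "loclip_at w z"
proof -
  obtain C r where C: "C \<ge> 0" "r > 0" "ball z r \<subseteq> U"
    "\<And>x y b. x \<in> ball z r \<Longrightarrow> y \<in> ball z r \<Longrightarrow> \<bar>\<phi> x b - \<phi> y b\<bar> \<le> C * dist x y * norm b"
    "\<And>x b. x \<in> ball z r \<Longrightarrow> \<bar>\<phi> x b\<bar> \<le> C * norm b"
    using loclip_at_linear_functional[OF U \<phi> loc\<phi>] by (metis (no_types))
  \<comment> \<open>There are finitely many matrix entries: the sum of their Lipschitz constants and
    the minimum of their radii serve for all of them.\<close>
  have "\<exists>D s. D \<ge> 0 \<and> s > 0 \<and> (\<forall>x\<in>ball z s. \<forall>y\<in>ball z s. \<forall>i\<in>Basis. \<forall>j\<in>Basis.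
          \<bar>B x i j - B y i j\<bar> \<le> D * dist x y)"
  proof -
    have "\<forall>p\<in>Basis \<times> Basis. \<exists>D s. D \<ge> 0 \<and> s > 0 \<and> (\<forall>x\<in>ball z s. \<forall>y\<in>ball z s.
          \<bar>B x (fst p) (snd p) - B y (fst p) (snd p)\<bar> \<le> D * dist x y)"
      using loclip_atE[OF locB] by (metis real_norm_def)
    then obtain D s where Ds: "\<And>p. p \<in> Basis \<times> Basis \<Longrightarrow> D p \<ge> 0 \<and> s p > 0 \<and> (\<forall>x\<in>ball z (s p). \<forall>y\<in>ball z (s p).
          \<bar>B x (fst p) (snd p) - B y (fst p) (snd p)\<bar> \<le> D p * dist x y)"
      by metis
    let ?P = "Basis \<times> Basis :: ('e \<times> 'e) set"
    have fin: "finite ?P" "?P \<noteq> {}" by auto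
    have "Min (s ` ?P) > 0" using Ds fin by (subst Min_gr_iff) auto
    moreover have "0 \<le> sum D ?P" using Ds by (auto intro!: sum_nonneg)
    moreover have "\<bar>B x i j - B y i j\<bar> \<le> sum D ?P * dist x y"
      if "x \<in> ball z (Min (s ` ?P))" "y \<in> ball z (Min (s ` ?P))" "i \<in> Basis" "j \<in> Basis" for x y i j
    proof -
      have p: "(i, j) \<in> ?P" using that by auto
      have "Min (s ` ?P) \<le> s (i, j)" using p fin by (intro Min_le) auto
      then have "\<bar>B x i j - B y i j\<bar> \<le> D (i, j) * dist x y"
        using Ds[OF p] that by auto
      also have "\<dots> \<le> sum D ?P * dist x y"
        using Ds p fin by (intro mult_right_mono member_le_sum) auto
      finally show ?thesis .
    qed
    ultimately show ?thesis by blast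
  qed
  then obtain D0 s where D0: "D0 \<ge> 0" "s > 0"
    "\<And>x y i j. x \<in> ball z s \<Longrightarrow> y \<in> ball z s \<Longrightarrow> i \<in> Basis \<Longrightarrow> j \<in> Basis \<Longrightarrow>
        \<bar>B x i j - B y i j\<bar> \<le> D0 * dist x y"
    by blast
  \<comment> \<open>The number of pairs of basis vectors; each pair contributes at most |a| |b|
    times the bound for one entry.\<close>
  define N where "N = real (DIM('e)) * real (DIM('e))"
  define D where "D = N * D0"
  have D: "D \<ge> 0" using D0 by (simp add: D_def N_def)
  have Blip: "\<bar>B x a b - B y a b\<bar> \<le> D * dist x y * norm a * norm b"
    if xy: "x \<in> ball z (min r s)" "y \<in> ball z (min r s)" for x y a b
  proof -
    have "x \<in> U" "y \<in> U" using xy C(3) by auto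
    then have "B x a b - B y a b = (\<Sum>i\<in>Basis. \<Sum>j\<in>Basis. (a \<bullet> i) * (b \<bullet> j) * (B x i j - B y i j))"
      by (simp add: bilinear_basis[OF B, of _ a b] sum_subtractf[symmetric] right_diff_distrib)
    also have "\<bar>\<dots>\<bar> \<le> (\<Sum>i\<in>Basis. \<bar>\<Sum>j\<in>Basis. (a \<bullet> i) * (b \<bullet> j) * (B x i j - B y i j)\<bar>)"
      by (rule sum_abs)
    also have "\<dots> \<le> (\<Sum>i\<in>Basis. \<Sum>j\<in>Basis. \<bar>(a \<bullet> i) * (b \<bullet> j) * (B x i j - B y i j)\<bar>)"
      by (intro sum_mono sum_abs)
    also have "\<dots> \<le> (\<Sum>i\<in>(Basis::'e set). \<Sum>j\<in>(Basis::'e set). norm a * norm b * (D0 * dist x y))"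
      unfolding abs_mult using D0 xy
      by (intro sum_mono mult_mono) (auto intro!: Basis_le_norm)
    also have "\<dots> = D * dist x y * norm a * norm b"
      by (simp add: D_def N_def)
    finally show ?thesis .
  qed
  \<comment> \<open>The minimum of the quadratic form on the unit sphere, attained by compactness
    and positive; homogeneity extends the bound to all vectors.\<close>
  obtain l where l: "l > 0" "\<And>a. B z a a \<ge> l * (norm a)\<^sup>2"
  proof -
    have "continuous_on (sphere 0 1) (\<lambda>a. \<Sum>i\<in>Basis. \<Sum>j\<in>Basis. (a \<bullet> i) * (a \<bullet> j) * B z i j)"
      by (intro continuous_intros)
    then have "continuous_on (sphere 0 1) (\<lambda>a. B z a a)"
      by (simp only: bilinear_basis[OF B[OF U(2)], symmetric])
    moreover have "sphere (0::'e) 1 \<noteq> {}" by simp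
    ultimately obtain a0 where a0: "a0 \<in> sphere 0 1" "\<And>a. a \<in> sphere 0 1 \<Longrightarrow> B z a0 a0 \<le> B z a a"
      using continuous_attains_inf[of "sphere (0::'e) 1" "\<lambda>a. B z a a"] by auto
    have "B z a0 a0 > 0" using a0(1) by (intro pos) auto
    moreover have "B z a a \<ge> B z a0 a0 * (norm a)\<^sup>2" for a
    proof (cases "a = 0")
      case False
      have "B z a a = (norm a)\<^sup>2 * B z (a /\<^sub>R norm a) (a /\<^sub>R norm a)"
        using False by (simp add: bilinear_lmul[OF B[OF U(2)]] bilinear_rmul[OF B[OF U(2)]] power2_eq_square field_simps)
      moreover have "B z a0 a0 \<le> B z (a /\<^sub>R norm a) (a /\<^sub>R norm a)"
        using False by (intro a0) simp
      ultimately show ?thesis by (metis mult.commute mult_left_mono zero_le_power2)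
    qed (simp add: bilinear_lzero[OF B[OF U(2)]])
    ultimately show ?thesis by (rule that)
  qed
  \<comment> \<open>Within this radius the quadratic form has moved by at most l/2 times the squared
    norm, so half of the coercivity constant survives.\<close>
  define t where "t = min (min r s) (l / (2 * (D + 1)))"
  have t: "t > 0" using C D0 l D by (simp add: t_def)
  have coer: "B x a a \<ge> l / 2 * (norm a)\<^sup>2" if x: "x \<in> ball z t" for x a
  proof -
    have "D * dist x z \<le> (D + 1) * (l / (2 * (D + 1)))"
      using x D by (intro mult_mono) (auto simp: t_def dist_commute)
    also have "\<dots> = l / 2" using D by (simp add: divide_simps)
    finally have "D * dist x z * (norm a)\<^sup>2 \<le> l / 2 * (norm a)\<^sup>2" by (intro mult_right_mono) auto
    moreover have "\<bar>B x a a - B z a a\<bar> \<le> D * dist x z * (norm a)\<^sup>2"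
      using Blip[of x z a a] x t by (auto simp: t_def power2_eq_square mult.assoc)
    ultimately show ?thesis using l(2)[of a] by (simp add: field_simps)
  qed
  \<comment> \<open>Testing the equation with its solution gives l/2 |w x|^2 \<le> C |w x|, and so
    this bound.\<close>
  define R where "R = 2 * C / l"
  have R: "R \<ge> 0" using C l by (simp add: R_def)
  have tU: "x \<in> U" "x \<in> ball z r" "x \<in> ball z (min r s)" if "x \<in> ball z t" for x
    using that C(3) by (auto simp: t_def)
  have wb: "norm (w x) \<le> R" if x: "x \<in> ball z t" for x
  proof (cases "w x = 0")
    case False
    have "l / 2 * (norm (w x))\<^sup>2 \<le> C * norm (w x)"
      using coer[OF x, of "w x"] w[OF tU(1)[OF x], of "w x"] C(5)[OF tU(2)[OF x], of "w x"] by linarith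
    then have "l / 2 * norm (w x) \<le> C" using False by (simp add: power2_eq_square)
    then show ?thesis using l by (simp add: R_def field_simps)
  qed (use R in simp)
  show ?thesis
  proof (rule loclip_atI[OF t, where C = "2 / l * (C + D * R)"])
    fix x y assume x: "x \<in> ball z t" and y: "y \<in> ball z t"
    let ?d = "w x - w y"
    have Bx: "bilinear (B x)" using B tU x by blast
    have "B x ?d ?d = (\<phi> x ?d - \<phi> y ?d) + (B y (w y) ?d - B x (w y) ?d)"
      using w[OF tU(1)[OF x], of ?d] w[OF tU(1)[OF y], of ?d] by (simp add: bilinear_lsub[OF Bx])
    also have "\<dots> \<le> C * dist x y * norm ?d + D * dist y x * norm (w y) * norm ?d"
      using C(4)[OF tU(2)[OF x] tU(2)[OF y], of ?d] Blip[OF tU(3)[OF y] tU(3)[OF x], of "w y" ?d] by linarith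
    also have "D * dist y x * norm (w y) * norm ?d \<le> D * dist y x * R * norm ?d"
      using wb[OF y] D by (intro mult_right_mono mult_left_mono) auto
    finally have "B x ?d ?d \<le> (C + D * R) * dist x y * norm ?d"
      by (simp add: algebra_simps dist_commute)
    then have *: "l / 2 * (norm ?d)\<^sup>2 \<le> (C + D * R) * dist x y * norm ?d"
      using coer[OF x, of ?d] by linarith
    show "norm ?d \<le> 2 / l * (C + D * R) * dist x y"
    proof (cases "?d = 0")
      case False
      then have "l / 2 * norm ?d \<le> (C + D * R) * dist x y"
        using * by (simp add: power2_eq_square)
      then show ?thesis using l by (simp add: field_simps)
    qed (use C D R l in auto)
  qed
qed

section \<open>Local existence for ordinary differential equations\<close>

text \<open>The Picard operator acts on bounded continuous functions on the whole line, with time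
  frozen outside the interval by \<open>cl\<close>. Since \<open>X\<close> is bounded and globally
  Lipschitz it maps this space into itself, and h C < 1 makes it a contraction.\<close>

lemma picard_global:
  fixes X :: "'z::euclidean_space \<Rightarrow> 'z"
  assumes lip: "\<And>x y. norm (X x - X y) \<le> C * norm (x - y)" and C: "C \<ge> 0"
    and bdd: "\<And>x. norm (X x) \<le> M"
    and h: "h \<ge> 0" "h * C < 1"
  obtains \<phi> where "\<phi> t = z" "continuous_on {t..t+h} \<phi>"
    "\<And>s. s \<in> {t..t+h} \<Longrightarrow> (\<phi> has_vector_derivative X (\<phi> s)) (at s within {t..t+h})"
proof -
  define cl where "cl s = max t (min s (t + h))" for s :: real
  have cl: "cl s \<in> {t..t+h}" for s using h by (auto simp: cl_def)
  have cont_cl: "continuous_on S cl" for S unfolding cl_def by (intro continuous_intros)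
  have contX: "continuous_on S X" for S
    by (rule lipschitz_on_continuous_on[of C])
       (use lip C in \<open>auto simp: lipschitz_on_def dist_norm\<close>)
  define P where "P \<phi> s = z + integral {t..cl s} (\<lambda>\<tau>. X (apply_bcontfun \<phi> \<tau>))" for \<phi> :: "real \<Rightarrow>\<^sub>C 'z" and s
  have contXp: "continuous_on S (\<lambda>\<tau>. X (apply_bcontfun \<phi> \<tau>))" for \<phi> :: "real \<Rightarrow>\<^sub>C 'z" and S
    by (rule continuous_on_compose2[OF contX[of UNIV]]) (auto intro!: continuous_intros)
  have int: "(\<lambda>\<tau>. X (apply_bcontfun \<phi> \<tau>)) integrable_on {a..b}" for \<phi> :: "real \<Rightarrow>\<^sub>C 'z" and a b
    by (intro integrable_continuous_interval contXp)
  have P: "P \<phi> \<in> bcontfun" for \<phi>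
  proof (rule bcontfun_normI)
    have "continuous_on {t..t+h} (\<lambda>s. integral {t..s} (\<lambda>\<tau>. X (apply_bcontfun \<phi> \<tau>)))"
      by (rule indefinite_integral_continuous_1[OF int])
    then show "continuous_on UNIV (P \<phi>)"
      unfolding P_def using cl by (intro continuous_intros continuous_on_compose2[OF _ cont_cl]) auto
    show "norm (P \<phi> s) \<le> norm z + M * h" for s
    proof -
      have M: "M \<ge> 0" using bdd[of z] norm_ge_zero order_trans by blast
      have "norm (integral {t..cl s} (\<lambda>\<tau>. X (apply_bcontfun \<phi> \<tau>))) \<le> M * (cl s - t)"
        using cl[of s] by (intro integral_bound contXp bdd) auto
      also have "\<dots> \<le> M * h" using cl[of s] M by (intro mult_left_mono) auto
      finally show ?thesis unfolding P_def by (rule order_trans[OF norm_triangle_ineq add_left_mono])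
    qed
  qed
  have contr: "dist (Bcontfun (P \<phi>)) (Bcontfun (P \<psi>)) \<le> (h * C) * dist \<phi> \<psi>" for \<phi> \<psi>
  proof (rule dist_bound)
    fix s
    have "dist (P \<phi> s) (P \<psi> s) = norm (integral {t..cl s} (\<lambda>\<tau>. X (apply_bcontfun \<phi> \<tau>) - X (apply_bcontfun \<psi> \<tau>)))"
      by (simp add: P_def dist_norm integral_diff[OF int int])
    also have "\<dots> \<le> (C * dist \<phi> \<psi>) * (cl s - t)"
    proof (rule integral_bound)
      show "continuous_on {t..cl s} (\<lambda>\<tau>. X (apply_bcontfun \<phi> \<tau>) - X (apply_bcontfun \<psi> \<tau>))"
        by (intro continuous_intros contXp)
      show "norm (X (apply_bcontfun \<phi> \<tau>) - X (apply_bcontfun \<psi> \<tau>)) \<le> C * dist \<phi> \<psi>" for \<tau>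
        using lip[of "apply_bcontfun \<phi> \<tau>" "apply_bcontfun \<psi> \<tau>"] mult_left_mono[OF dist_bounded[of \<phi> \<tau> \<psi>] C]
        by (simp add: dist_norm)
    qed (use cl in auto)
    also have "\<dots> \<le> (C * dist \<phi> \<psi>) * h" using cl[of s] C by (intro mult_left_mono) auto
    finally show "dist (apply_bcontfun (Bcontfun (P \<phi>)) s) (apply_bcontfun (Bcontfun (P \<psi>)) s) \<le> (h * C) * dist \<phi> \<psi>"
      by (simp add: Bcontfun_inverse[OF P] mult_ac)
  qed
  obtain \<phi> where \<phi>: "Bcontfun (P \<phi>) = \<phi>"
    using banach_fix_type[of "h * C" "\<lambda>\<phi>. Bcontfun (P \<phi>)"] contr h C by auto
  then have fp: "apply_bcontfun \<phi> s = P \<phi> s" for s by (metis Bcontfun_inverse[OF P])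
  show ?thesis
  proof (rule that[of "apply_bcontfun \<phi>"])
    show "apply_bcontfun \<phi> t = z" using fp[of t] h by (simp add: P_def cl_def)
    show "continuous_on {t..t+h} (apply_bcontfun \<phi>)"
      using apply_bcontfun[of \<phi>] by (auto simp: bcontfun_def intro: continuous_on_subset)
    fix s assume s: "s \<in> {t..t+h}"
    have "((\<lambda>s. integral {t..s} (\<lambda>\<tau>. X (apply_bcontfun \<phi> \<tau>))) has_vector_derivative X (apply_bcontfun \<phi> s)) (at s within {t..t+h})"
      using s by (intro integral_has_vector_derivative contXp)
    then have "((\<lambda>s. z + integral {t..s} (\<lambda>\<tau>. X (apply_bcontfun \<phi> \<tau>))) has_vector_derivative X (apply_bcontfun \<phi> s)) (at s within {t..t+h})"
      using has_vector_derivative_add[OF has_vector_derivative_const] by fastforce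
    then show "(apply_bcontfun \<phi> has_vector_derivative X (apply_bcontfun \<phi> s)) (at s within {t..t+h})"
    proof (rule has_vector_derivative_transform[OF s, rotated])
      show "apply_bcontfun \<phi> x = z + integral {t..x} (\<lambda>\<tau>. X (apply_bcontfun \<phi> \<tau>))"
        if "x \<in> {t..t+h}" for x
        using fp[of x] that by (simp add: P_def cl_def)
    qed
  qed
qed

text \<open>Precomposing \<open>X\<close> with the nearest point projection onto a small ball, a map
  that does not increase distances, gives a bounded and globally Lipschitz field. Its solution stays
  in the ball for a short time, and there the two fields agree. The length \<open>h0\<close> does
  not depend on the initial time, since the field is autonomous.\<close>

lemma picard_local:
  fixes X :: "'z::euclidean_space \<Rightarrow> 'z"
  assumes X: "loclip_at X z" and U: "open U" "z \<in> U"
  obtains h0 where "h0 > 0" "\<And>t h. 0 \<le> h \<Longrightarrow> h \<le> h0 \<Longrightarrow> \<exists>\<phi>. \<phi> t = z \<and> \<phi> ` {t..t+h} \<subseteq> U \<and>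
     continuous_on {t..t+h} \<phi> \<and>
     (\<forall>s\<in>{t..t+h}. (\<phi> has_vector_derivative X (\<phi> s)) (at s within {t..t+h}))"
proof -
  obtain C r where C: "C \<ge> 0" "r > 0"
    "\<And>x y. x \<in> ball z r \<Longrightarrow> y \<in> ball z r \<Longrightarrow> norm (X x - X y) \<le> C * dist x y"
    using loclip_atE[OF X] by blast
  obtain M s where M: "M > 0" "s > 0" "\<And>x. x \<in> ball z s \<Longrightarrow> norm (X x) \<le> M"
    using loclip_at_bounded[OF X] by blast
  obtain d where d: "d > 0" "ball z d \<subseteq> U" using U openE by blast
  define \<rho> where "\<rho> = min (min r s) d / 2"
  have \<rho>: "\<rho> > 0" "cball z \<rho> \<subseteq> ball z r" "cball z \<rho> \<subseteq> ball z s" "cball z \<rho> \<subseteq> U"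
    using C M d by (auto simp: \<rho>_def)
  let ?p = "closest_point (cball z \<rho>)"
  have p: "?p x \<in> cball z \<rho>" for x using \<rho> by (intro closest_point_in_set) auto
  define Y where "Y x = X (?p x)" for x
  have Ylip: "norm (Y x - Y y) \<le> C * norm (x - y)" for x y
  proof -
    have "norm (Y x - Y y) \<le> C * dist (?p x) (?p y)"
      unfolding Y_def using p \<rho> C by blast
    also have "\<dots> \<le> C * dist x y"
      using C \<rho> by (intro mult_left_mono closest_point_lipschitz) auto
    finally show ?thesis by (simp add: dist_norm)
  qed
  have Ybdd: "norm (Y x) \<le> M" for x unfolding Y_def using p \<rho> M by blast
  \<comment> \<open>The first bound keeps a curve of speed at most \<open>M\<close> within distance
    \<rho>; the second makes the Picard operator a contraction.\<close>
  define h0 where "h0 = min (\<rho> / M) (1 / (C + 1))"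
  have h0: "h0 > 0" using \<rho> M C by (simp add: h0_def)
  have "\<exists>\<phi>. \<phi> t = z \<and> \<phi> ` {t..t+h} \<subseteq> U \<and> continuous_on {t..t+h} \<phi> \<and>
     (\<forall>s\<in>{t..t+h}. (\<phi> has_vector_derivative X (\<phi> s)) (at s within {t..t+h}))" if h: "0 \<le> h" "h \<le> h0" for t h
  proof -
    have hM: "h * M \<le> \<rho>" using h(2) M by (simp add: h0_def pos_le_divide_eq)
    have "h * (C + 1) \<le> 1" using h(2) C by (simp add: h0_def pos_le_divide_eq)
    then have hC: "h * C < 1" using h C by (cases "h = 0") (auto simp: algebra_simps)
    obtain \<phi> where \<phi>: "\<phi> t = z" "continuous_on {t..t+h} \<phi>"
      "\<And>s. s \<in> {t..t+h} \<Longrightarrow> (\<phi> has_vector_derivative Y (\<phi> s)) (at s within {t..t+h})"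
      using picard_global[OF Ylip C(1) Ybdd h(1) hC] by blast
    have in_ball: "\<phi> s \<in> cball z \<rho>" if s: "s \<in> {t..t+h}" for s
    proof -
      have "norm (\<phi> s - \<phi> t) \<le> M * norm (s - t)"
      proof (rule differentiable_bound[where S = "{t..t+h}" and f' = "\<lambda>s c. c *\<^sub>R Y (\<phi> s)"])
        fix x assume "x \<in> {t..t+h}"
        then show "(\<phi> has_derivative (\<lambda>c. c *\<^sub>R Y (\<phi> x))) (at x within {t..t+h})"
          using \<phi>(3) by (simp add: has_vector_derivative_def)
        show "onorm (\<lambda>c. c *\<^sub>R Y (\<phi> x)) \<le> M"
        proof (rule onorm_le)
          show "norm (c *\<^sub>R Y (\<phi> x)) \<le> M * norm c" for c
            using mult_right_mono[OF Ybdd[of "\<phi> x"], of "\<bar>c\<bar>"] by (simp add: mult.commute)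
        qed
      qed (use s h in auto)
      also have "\<dots> \<le> M * h" using s M by (intro mult_left_mono) auto
      finally have "norm (\<phi> s - z) \<le> \<rho>" using hM \<phi>(1) by (simp add: mult.commute)
      then show ?thesis by (simp add: dist_norm norm_minus_commute)
    qed
    have "Y (\<phi> s) = X (\<phi> s)" if "s \<in> {t..t+h}" for s
      using in_ball[OF that] by (simp add: Y_def closest_point_self)
    then show ?thesis using \<phi> in_ball \<rho>(4) by (intro exI[of _ \<phi>]) auto
  qed
  then show ?thesis using that h0 by blast
qed

section \<open>Tangent vectors and gradients in charts\<close>

text \<open>Isolates what the atlas of M and the atlas of TM have in common, so that tangent
  vectors, topology and gradients are treated once for both. For TM only differentiability of the
  transition maps is established.\<close>

locale differentiable_atlas =
  fixes A :: "('a, 'e::euclidean_space) atlas"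
  assumes inj: "c \<in> A \<Longrightarrow> inj_on (chart_map c) (chart_dom c)"
    and open_image: "c \<in> A \<Longrightarrow> open (chart_image c)"
    and open_overlap: "c \<in> A \<Longrightarrow> c' \<in> A \<Longrightarrow> open (chart_map c ` (chart_dom c \<inter> chart_dom c'))"
    and transition_differentiable: "c \<in> A \<Longrightarrow> c' \<in> A \<Longrightarrow> p \<in> chart_dom c \<Longrightarrow> p \<in> chart_dom c' \<Longrightarrow>
      transition c c' differentiable (at (chart_map c p))"
begin

lemma chart_inv_map: "c \<in> A \<Longrightarrow> p \<in> chart_dom c \<Longrightarrow> chart_inv c (chart_map c p) = p"
  using inj by (simp add: chart_inv_def)

lemma chart_map_inv: "z \<in> chart_image c \<Longrightarrow> chart_map c (chart_inv c z) = z"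
  by (simp add: chart_inv_def chart_image_def f_inv_into_f)

lemma chart_inv_dom: "z \<in> chart_image c \<Longrightarrow> chart_inv c z \<in> chart_dom c"
  by (simp add: chart_inv_def chart_image_def inv_into_into)

lemma chart_map_image: "p \<in> chart_dom c \<Longrightarrow> chart_map c p \<in> chart_image c"
  by (simp add: chart_image_def)

lemma transition_map: "c \<in> A \<Longrightarrow> p \<in> chart_dom c \<Longrightarrow> transition c c' (chart_map c p) = chart_map c' p"
  by (simp add: transition_def chart_inv_map)

text \<open>Indexed by the point of the manifold instead of its coordinates, so that the chain rule
  becomes a cocycle identity at a fixed \<open>p\<close>.\<close>

definition dtrans :: "('a, 'e) chart \<Rightarrow> ('a, 'e) chart \<Rightarrow> 'a \<Rightarrow> 'e \<Rightarrow> 'e" where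
  "dtrans c c' p = frechet_derivative (transition c c') (at (chart_map c p))"

lemma dtrans_has_derivative:
  assumes "c \<in> A" "c' \<in> A" "p \<in> chart_dom c" "p \<in> chart_dom c'"
  shows "(transition c c' has_derivative dtrans c c' p) (at (chart_map c p))"
  unfolding dtrans_def using transition_differentiable[OF assms] frechet_derivative_works by blast

lemma dtrans_linear:
  assumes "c \<in> A" "c' \<in> A" "p \<in> chart_dom c" "p \<in> chart_dom c'"
  shows "linear (dtrans c c' p)"
  using dtrans_has_derivative[OF assms] by (rule has_derivative_linear)

lemma dtrans_comp:
  assumes c: "c \<in> A" "p \<in> chart_dom c" and c': "c' \<in> A" "p \<in> chart_dom c'"
    and c'': "c'' \<in> A" "p \<in> chart_dom c''"
  shows "dtrans c' c'' p (dtrans c c' p v) = dtrans c c'' p v"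
proof -
  have "(transition c' c'' has_derivative dtrans c' c'' p) (at (transition c c' (chart_map c p)))"
    using dtrans_has_derivative[OF c'(1) c''(1) c'(2) c''(2)] by (simp add: transition_map c)
  from has_derivative_compose[OF dtrans_has_derivative[OF c(1) c'(1) c(2) c'(2)] this]
  have 1: "((\<lambda>z. transition c' c'' (transition c c' z)) has_derivative (\<lambda>v. dtrans c' c'' p (dtrans c c' p v))) (at (chart_map c p))" .
  have "((\<lambda>z. transition c c'' z) has_derivative (\<lambda>v. dtrans c' c'' p (dtrans c c' p v))) (at (chart_map c p))"
    by (rule has_derivative_transform_within_open[OF 1 open_overlap[OF c(1) c'(1)]])
      (use c c' in \<open>auto simp: transition_map\<close>)
  then show ?thesis
    using dtrans_has_derivative[OF c(1) c''(1) c(2) c''(2)] has_derivative_unique by metis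
qed

lemma dtrans_self:
  assumes c: "c \<in> A" "p \<in> chart_dom c"
  shows "dtrans c c p v = v"
proof -
  have "((\<lambda>z. z) has_derivative dtrans c c p) (at (chart_map c p))"
    by (rule has_derivative_transform_within_open[OF dtrans_has_derivative[OF c(1) c(1) c(2) c(2)] open_overlap[OF c(1) c(1)]])
      (use c in \<open>auto simp: transition_map\<close>)
  then show ?thesis
    using has_derivative_ident has_derivative_unique by metis
qed

lemma tangent_dtrans:
  assumes "\<xi> \<in> tangent_space A p" "c \<in> A" "p \<in> chart_dom c" "c' \<in> A" "p \<in> chart_dom c'"
  shows "\<xi> c' = dtrans c c' p (\<xi> c)"
  using assms unfolding tangent_space_def dtrans_def by blast

lemma vec_coord:
  assumes "c \<in> A" "p \<in> chart_dom c" "c' \<in> A" "p \<in> chart_dom c'"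
  shows "vec_of_coords A c p v c' = dtrans c c' p v"
  using assms by (simp add: vec_of_coords_def dtrans_def)

lemma vec_coord_self:
  assumes "c \<in> A" "p \<in> chart_dom c"
  shows "vec_of_coords A c p v c = v"
  using assms by (simp add: vec_coord dtrans_self)

lemma vec_tangent:
  assumes c: "c \<in> A" "p \<in> chart_dom c"
  shows "vec_of_coords A c p v \<in> tangent_space A p"
  unfolding tangent_space_def
  using dtrans_comp[OF c] c by (auto simp: vec_of_coords_def dtrans_def[symmetric])

lemma vec_of_tangent:
  assumes "\<xi> \<in> tangent_space A p" "c \<in> A" "p \<in> chart_dom c"
  shows "vec_of_coords A c p (\<xi> c) = \<xi>"
proof
  fix c'
  show "vec_of_coords A c p (\<xi> c) c' = \<xi> c'"
  proof (cases "c' \<in> A \<and> p \<in> chart_dom c'")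
    case True
    then show ?thesis using vec_coord[OF assms(2,3)] tangent_dtrans[OF assms] by metis
  next
    case False
    then have "\<xi> c' = 0" using assms(1) unfolding tangent_space_def by blast
    then show ?thesis unfolding vec_of_coords_def by (simp only: False if_False)
  qed
qed

lemma tangent_eqI:
  assumes "\<xi> \<in> tangent_space A p" "\<eta> \<in> tangent_space A p" "c \<in> A" "p \<in> chart_dom c" "\<xi> c = \<eta> c"
  shows "\<xi> = \<eta>"
  using vec_of_tangent[OF assms(1,3,4)] vec_of_tangent[OF assms(2,3,4)] assms(5) by metis

lemma tangent_lincomb:
  assumes "\<xi> \<in> tangent_space A p" "\<eta> \<in> tangent_space A p"
  shows "(\<lambda>c. a *\<^sub>R \<xi> c + b *\<^sub>R \<eta> c) \<in> tangent_space A p"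
proof -
  have "a *\<^sub>R \<xi> c' + b *\<^sub>R \<eta> c' = dtrans c c' p (a *\<^sub>R \<xi> c + b *\<^sub>R \<eta> c)"
    if "c \<in> A" "p \<in> chart_dom c" "c' \<in> A" "p \<in> chart_dom c'" for c c'
    using dtrans_linear[of c c' p] that tangent_dtrans[OF assms(1) that] tangent_dtrans[OF assms(2) that]
    by (simp add: linear_add linear_scale)
  moreover have "a *\<^sub>R \<xi> c + b *\<^sub>R \<eta> c = 0" if "\<not> (c \<in> A \<and> p \<in> chart_dom c)" for c
  proof -
    have "\<xi> c = 0" "\<eta> c = 0" using assms that unfolding tangent_space_def by blast+
    then show ?thesis by simp
  qed
  ultimately show ?thesis unfolding tangent_space_def dtrans_def by blast
qed

lemma tangent_zero:
  assumes "p \<in> points A"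
  shows "(\<lambda>_. 0) \<in> tangent_space A p"
proof -
  obtain c where "c \<in> A" "p \<in> chart_dom c" using assms by (auto simp: points_def)
  from tangent_lincomb[OF vec_tangent[OF this, of 0] vec_tangent[OF this, of 0], of 0 0]
  show ?thesis by simp
qed

lemma tangent_sum:
  assumes "p \<in> points A" "\<And>j. j \<in> J \<Longrightarrow> \<xi> j \<in> tangent_space A p"
  shows "(\<lambda>c. \<Sum>j\<in>J. a j *\<^sub>R \<xi> j c) \<in> tangent_space A p"
  using assms(2)
proof (induction J rule: infinite_finite_induct)
  case (insert j J)
  then show ?case
    using tangent_lincomb[of "\<xi> j" p "\<lambda>c. \<Sum>j\<in>J. a j *\<^sub>R \<xi> j c" "a j" 1] by simp
qed (use tangent_zero[OF assms(1)] in auto)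

lemma vec_lincomb:
  assumes "c \<in> A" "p \<in> chart_dom c"
  shows "vec_of_coords A c p (a *\<^sub>R v + b *\<^sub>R w) = (\<lambda>c'. a *\<^sub>R vec_of_coords A c p v c' + b *\<^sub>R vec_of_coords A c p w c')"
  by (rule tangent_eqI[of _ p _ c])
    (use assms in \<open>auto simp: vec_tangent vec_coord_self intro!: tangent_lincomb\<close>)

section \<open>The manifold topology seen in charts\<close>

text \<open>Injectivity of the charts lets images commute with intersections. Stated in this locale,
  the description of open sets is available for TM as well.\<close>

lemma openin_topology:
  "openin (manifold_topology A) S \<longleftrightarrow>
     S \<subseteq> points A \<and> (\<forall>c\<in>A. open (chart_map c ` (S \<inter> chart_dom c)))"
proof -
  let ?P = "\<lambda>S. S \<subseteq> points A \<and> (\<forall>c\<in>A. open (chart_map c ` (S \<inter> chart_dom c)))"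
  have "istopology ?P"
    unfolding istopology_def
  proof (intro conjI allI impI)
    fix S S' assume S: "?P S" "?P S'"
    have "chart_map c ` ((S \<inter> S') \<inter> chart_dom c)
        = chart_map c ` (S \<inter> chart_dom c) \<inter> chart_map c ` (S' \<inter> chart_dom c)" if "c \<in> A" for c
      using inj[OF that] by (auto simp: inj_on_def)
    then show "S \<inter> S' \<subseteq> points A" "\<forall>c\<in>A. open (chart_map c ` ((S \<inter> S') \<inter> chart_dom c))"
      using S by (auto intro: open_Int)
  next
    fix \<K> assume K: "\<forall>S\<in>\<K>. ?P S"
    show "\<Union>\<K> \<subseteq> points A" using K by auto
    show "\<forall>c\<in>A. open (chart_map c ` (\<Union>\<K> \<inter> chart_dom c))"
    proof
      fix c assume c: "c \<in> A"
      have "chart_map c ` (\<Union>\<K> \<inter> chart_dom c) = (\<Union>S\<in>\<K>. chart_map c ` (S \<inter> chart_dom c))"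
        by blast
      moreover have "open \<dots>" using K c by (intro open_UN) blast
      ultimately show "open (chart_map c ` (\<Union>\<K> \<inter> chart_dom c))" by argo
    qed
  qed
  then show ?thesis by (simp add: manifold_topology_def topology_inverse')
qed

lemma openin_points: "openin (manifold_topology A) (points A)"
proof -
  have "chart_map c ` (points A \<inter> chart_dom c) = chart_image c" if "c \<in> A" for c
    using that by (auto simp: points_def chart_image_def)
  then show ?thesis by (simp add: openin_topology open_image)
qed

lemma topspace_manifold: "topspace (manifold_topology A) = points A"
  using openin_points openin_topology openin_subset[OF openin_points] openin_topspace[of "manifold_topology A"]
  by blast

text \<open>In another chart the set is the preimage of \<open>U\<close> under a transition map,
  which is continuous because it is differentiable.\<close>

lemma openin_chart_preimage:
  assumes c: "c \<in> A" and U: "open U"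
  shows "openin (manifold_topology A) {p \<in> chart_dom c. chart_map c p \<in> U}"
proof -
  have "open (chart_map c' ` ({p \<in> chart_dom c. chart_map c p \<in> U} \<inter> chart_dom c'))" if c': "c' \<in> A" for c'
  proof -
    have eq: "chart_map c' ` ({p \<in> chart_dom c. chart_map c p \<in> U} \<inter> chart_dom c')
        = chart_map c' ` (chart_dom c' \<inter> chart_dom c) \<inter> transition c' c -` U"
      using c' by (auto simp: transition_map)
    have "transition c' c differentiable (at z)" if "z \<in> chart_map c' ` (chart_dom c' \<inter> chart_dom c)" for z
      using that transition_differentiable[OF c' c] by blast
    then have "continuous_on (chart_map c' ` (chart_dom c' \<inter> chart_dom c)) (transition c' c)"
      by (intro continuous_at_imp_continuous_on ballI differentiable_imp_continuous_within)
    then show ?thesis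
      unfolding eq using continuous_on_open_vimage open_overlap[OF c' c] U by (metis Int_commute)
  qed
  then show ?thesis using c by (auto simp: openin_topology points_def)
qed

lemma open_chart_image_Int:
  assumes "openin (manifold_topology A) S" "c \<in> A"
  shows "open (chart_map c ` (S \<inter> chart_dom c))"
  using assms openin_topology by blast

lemma continuous_map_chart_inv:
  assumes c: "c \<in> A" and \<phi>: "continuous_on S \<phi>" "\<phi> ` S \<subseteq> chart_image c"
  shows "continuous_map (top_of_set S) (manifold_topology A) (\<lambda>s. chart_inv c (\<phi> s))"
  unfolding continuous_map
proof (intro conjI allI impI)
  show "(\<lambda>s. chart_inv c (\<phi> s)) ` topspace (top_of_set S) \<subseteq> topspace (manifold_topology A)"
  proof (clarsimp simp del: split_paired_Ex simp: topspace_manifold)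
    fix s assume "s \<in> S"
    then have "chart_inv c (\<phi> s) \<in> chart_dom c" using \<phi>(2) by (intro chart_inv_dom) blast
    then show "chart_inv c (\<phi> s) \<in> points A" using c unfolding points_def by blast
  qed
  fix Y assume Y: "openin (manifold_topology A) Y"
  have "{s \<in> topspace (top_of_set S). chart_inv c (\<phi> s) \<in> Y} = S \<inter> \<phi> -` (chart_map c ` (Y \<inter> chart_dom c))"
  proof (intro set_eqI iffI)
    fix s assume "s \<in> {s \<in> topspace (top_of_set S). chart_inv c (\<phi> s) \<in> Y}"
    then have s: "s \<in> S" "chart_inv c (\<phi> s) \<in> Y" by simp_all
    then have "\<phi> s \<in> chart_image c" using \<phi>(2) by blast
    then have "\<phi> s \<in> chart_map c ` (Y \<inter> chart_dom c)"
      using s(2) chart_map_inv[of "\<phi> s" c] chart_inv_dom[of "\<phi> s" c] by (metis Int_iff imageI)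
    then show "s \<in> S \<inter> \<phi> -` (chart_map c ` (Y \<inter> chart_dom c))" using s by blast
  next
    fix s assume s: "s \<in> S \<inter> \<phi> -` (chart_map c ` (Y \<inter> chart_dom c))"
    then obtain p where "p \<in> Y" "p \<in> chart_dom c" "\<phi> s = chart_map c p" by blast
    then have "chart_inv c (\<phi> s) = p" using chart_inv_map[OF c] by simp
    then show "s \<in> {s \<in> topspace (top_of_set S). chart_inv c (\<phi> s) \<in> Y}"
      using s \<open>p \<in> Y\<close> by simp
  qed
  moreover have "openin (top_of_set S) (S \<inter> \<phi> -` (chart_map c ` (Y \<inter> chart_dom c)))"
    using open_chart_image_Int[OF Y c] \<phi>(1) by (simp add: continuous_openin_preimage_gen)
  ultimately show "openin (top_of_set S) {s \<in> topspace (top_of_set S). chart_inv c (\<phi> s) \<in> Y}"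
    by simp
qed

section \<open>Inner products on tangent spaces and gradients\<close>

text \<open>The pointwise clauses of \<open>riemannian_metric\<close>, separated from smoothness. A
  gradient at a point only requires these, and the Sasaki metric is used only through them.\<close>

definition inner_product_at :: "(('a, 'e) tvec \<Rightarrow> ('a, 'e) tvec \<Rightarrow> real) \<Rightarrow> 'a \<Rightarrow> bool" where
  "inner_product_at B p \<longleftrightarrow> (\<forall>\<xi>\<in>tangent_space A p.
     (\<forall>\<eta>\<in>tangent_space A p. B \<xi> \<eta> = B \<eta> \<xi> \<and>
        (\<forall>\<zeta>\<in>tangent_space A p. \<forall>a b. B (\<lambda>c. a *\<^sub>R \<xi> c + b *\<^sub>R \<eta> c) \<zeta> = a * B \<xi> \<zeta> + b * B \<eta> \<zeta>)) \<and>
     (\<xi> \<noteq> (\<lambda>_. 0) \<longrightarrow> B \<xi> \<xi> > 0))"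

lemma inner_product_coords:
  assumes B: "inner_product_at B p" and c: "c \<in> A" "p \<in> chart_dom c"
  defines "b \<equiv> \<lambda>v w. B (vec_of_coords A c p v) (vec_of_coords A c p w)"
  shows "bilinear b" "b v w = b w v" "v \<noteq> 0 \<Longrightarrow> b v v > 0"
proof -
  note t = vec_tangent[OF c]
  show sym: "b v w = b w v" for v w using B t unfolding inner_product_at_def b_def by blast
  have lin: "b (r *\<^sub>R v + s *\<^sub>R w) u = r * b v u + s * b w u" for r s v w u
    using B t[of v] t[of w] t[of u] unfolding inner_product_at_def b_def vec_lincomb[OF c] by blast
  have "linear (\<lambda>v. b v u)" for u
    using lin[of 1 _ 1] lin[of _ _ 0] by (intro linearI) simp_all
  moreover have "b u = (\<lambda>v. b v u)" for u using sym by blast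
  ultimately show "bilinear b" unfolding bilinear_def by metis
  assume "v \<noteq> 0"
  then have "vec_of_coords A c p v \<noteq> (\<lambda>_. 0)" using vec_coord_self[OF c, of v] by metis
  then show "b v v > 0" using B t[of v] unfolding inner_product_at_def b_def by blast
qed

lemma differential_change:
  assumes c: "c \<in> A" "p \<in> chart_dom c" and c': "c' \<in> A" "p \<in> chart_dom c'"
    and F: "(F \<circ> chart_inv c') differentiable (at (chart_map c' p))"
  shows "frechet_derivative (F \<circ> chart_inv c) (at (chart_map c p)) v
       = frechet_derivative (F \<circ> chart_inv c') (at (chart_map c' p)) (dtrans c c' p v)"
proof -
  have "((F \<circ> chart_inv c') has_derivative frechet_derivative (F \<circ> chart_inv c') (at (chart_map c' p)))
      (at (transition c c' (chart_map c p)))"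
    using F by (simp add: frechet_derivative_works transition_map c)
  from has_derivative_compose[OF dtrans_has_derivative[OF c(1) c'(1) c(2) c'(2)] this]
  have "((F \<circ> chart_inv c) has_derivative
      (\<lambda>v. frechet_derivative (F \<circ> chart_inv c') (at (chart_map c' p)) (dtrans c c' p v))) (at (chart_map c p))"
    by (rule has_derivative_transform_within_open[OF _ open_overlap[OF c(1) c'(1)]])
      (use c c' in \<open>auto simp: transition_map chart_inv_map\<close>)
  then show ?thesis using frechet_derivative_at by metis
qed

text \<open>Justifies the definite description in \<open>gradient\<close>: Riesz representation in
  one chart gives existence, positivity gives uniqueness, and \<open>differential_change\<close>
  carries the defining identity to all other charts.\<close>

lemma gradient_properties:
  assumes B: "inner_product_at (G p) p" and p: "p \<in> points A"
    and F: "\<And>c. c \<in> A \<Longrightarrow> p \<in> chart_dom c \<Longrightarrow> (F \<circ> chart_inv c) differentiable (at (chart_map c p))"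
  shows "gradient A G F p \<in> tangent_space A p"
    and "\<And>\<eta> c. \<eta> \<in> tangent_space A p \<Longrightarrow> c \<in> A \<Longrightarrow> p \<in> chart_dom c \<Longrightarrow>
      G p (gradient A G F p) \<eta> = frechet_derivative (F \<circ> chart_inv c) (at (chart_map c p)) (\<eta> c)"
proof -
  obtain c where c: "c \<in> A" "p \<in> chart_dom c" using p by (auto simp: points_def)
  let ?dF = "\<lambda>c. frechet_derivative (F \<circ> chart_inv c) (at (chart_map c p))"
  note b = inner_product_coords[OF B c]
  have "linear (?dF c)" using F[OF c] by (rule linear_frechet_derivative)
  then obtain w where w: "\<And>v. G p (vec_of_coords A c p w) (vec_of_coords A c p v) = ?dF c v"
    using riesz_bilinear[OF b(1,3)] by metis
  let ?P = "\<lambda>\<xi>. \<xi> \<in> tangent_space A p \<and>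
     (\<forall>\<eta>\<in>tangent_space A p. \<forall>c\<in>A. p \<in> chart_dom c \<longrightarrow> G p \<xi> \<eta> = ?dF c (\<eta> c))"
  have "?P (gradient A G F p)"
    unfolding gradient_def
  proof (rule theI[of ?P])
    show "?P (vec_of_coords A c p w)"
    proof (intro conjI ballI impI vec_tangent c)
      fix \<eta> c' assume \<eta>: "\<eta> \<in> tangent_space A p" and c': "c' \<in> A" "p \<in> chart_dom c'"
      have "G p (vec_of_coords A c p w) \<eta> = ?dF c (\<eta> c)"
        using w[of "\<eta> c"] by (simp add: vec_of_tangent[OF \<eta> c])
      also have "\<dots> = ?dF c' (\<eta> c')"
        by (simp add: differential_change[OF c c' F[OF c']] tangent_dtrans[OF \<eta> c c', symmetric])
      finally show "G p (vec_of_coords A c p w) \<eta> = ?dF c' (\<eta> c')" .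
    qed
    fix \<xi> assume \<xi>: "?P \<xi>"
    have "\<xi> c = w"
    proof (rule posdef_unique[OF b(1,3)])
      show "G p (vec_of_coords A c p (\<xi> c)) (vec_of_coords A c p v)
          = G p (vec_of_coords A c p w) (vec_of_coords A c p v)" for v
        using \<xi> c vec_tangent[OF c, of v] by (simp add: w vec_of_tangent vec_coord_self)
    qed
    then show "\<xi> = vec_of_coords A c p w"
      using \<xi> vec_of_tangent[of \<xi> p c] c by simp
  qed
  then show "gradient A G F p \<in> tangent_space A p"
    and "\<And>\<eta> c. \<eta> \<in> tangent_space A p \<Longrightarrow> c \<in> A \<Longrightarrow> p \<in> chart_dom c \<Longrightarrow>
      G p (gradient A G F p) \<eta> = ?dF c (\<eta> c)"
    by blast+
qed

end

section \<open>The Levi-Civita connection in charts\<close>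

text \<open>The product rule for a form that varies with the base point, reduced to scalar products
  by expansion in a basis. Bilinearity of \<open>B'\<close> in its two vector arguments comes from
  differentiating that expansion and uniqueness of derivatives.\<close>

lemma has_derivative_bilinear_family:
  fixes B :: "'y::real_normed_vector \<Rightarrow> 'e::euclidean_space \<Rightarrow> 'e \<Rightarrow> real"
    and \<phi> :: "'x::real_normed_vector \<Rightarrow> 'y"
  assumes V: "open V" "\<phi> x \<in> V" and B: "\<And>y. y \<in> V \<Longrightarrow> bilinear (B y)"
    and B': "\<And>a b. ((\<lambda>y. B y a b) has_derivative B' a b) (at (\<phi> x))"
    and \<phi>: "(\<phi> has_derivative \<phi>') (at x)"
    and f: "(f has_derivative f') (at x)" and g: "(g has_derivative g') (at x)"
  shows "((\<lambda>z. B (\<phi> z) (f z) (g z)) has_derivative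
    (\<lambda>h. B' (f x) (g x) (\<phi>' h) + B (\<phi> x) (f' h) (g x) + B (\<phi> x) (f x) (g' h))) (at x)"
proof -
  have expand: "B' a b = (\<lambda>k. \<Sum>i\<in>Basis. \<Sum>j\<in>Basis. (a \<bullet> i) * (b \<bullet> j) * B' i j k)" for a b
  proof -
    have "((\<lambda>y. \<Sum>i\<in>Basis. \<Sum>j\<in>Basis. (a \<bullet> i) * (b \<bullet> j) * B y i j) has_derivative
        (\<lambda>k. \<Sum>i\<in>Basis. \<Sum>j\<in>Basis. (a \<bullet> i) * (b \<bullet> j) * B' i j k)) (at (\<phi> x))"
      by (intro has_derivative_sum has_derivative_mult_right B')
    then have "((\<lambda>y. B y a b) has_derivative
        (\<lambda>k. \<Sum>i\<in>Basis. \<Sum>j\<in>Basis. (a \<bullet> i) * (b \<bullet> j) * B' i j k)) (at (\<phi> x))"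
      by (rule has_derivative_transform_within_open[OF _ V]) (rule bilinear_basis[OF B, symmetric])
    then show ?thesis using B' has_derivative_unique by blast
  qed
  have "((\<lambda>z. \<Sum>i\<in>Basis. \<Sum>j\<in>Basis. (f z \<bullet> i) * (g z \<bullet> j) * B (\<phi> z) i j) has_derivative
      (\<lambda>h. \<Sum>i\<in>Basis. \<Sum>j\<in>Basis. (f x \<bullet> i) * (g x \<bullet> j) * B' i j (\<phi>' h)
         + ((f x \<bullet> i) * (g' h \<bullet> j) + (f' h \<bullet> i) * (g x \<bullet> j)) * B (\<phi> x) i j)) (at x)"
    by (intro has_derivative_sum has_derivative_mult has_derivative_inner_left f g
        has_derivative_compose[OF \<phi>, where g = "\<lambda>y. B y i j" for i j] B')
  moreover have "\<forall>\<^sub>F z in at x. \<phi> z \<in> V"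
    using has_derivative_continuous[OF \<phi>] V unfolding continuous_within by (rule topological_tendstoD)
  then have "\<forall>\<^sub>F z in at x. (\<Sum>i\<in>Basis. \<Sum>j\<in>Basis. (f z \<bullet> i) * (g z \<bullet> j) * B (\<phi> z) i j) = B (\<phi> z) (f z) (g z)"
    by (rule eventually_mono) (rule bilinear_basis[OF B, symmetric])
  moreover have "(\<Sum>i\<in>Basis. \<Sum>j\<in>Basis. (f x \<bullet> i) * (g x \<bullet> j) * B (\<phi> x) i j) = B (\<phi> x) (f x) (g x)"
    by (rule bilinear_basis[OF B[OF V(2)], symmetric])
  ultimately have "((\<lambda>z. B (\<phi> z) (f z) (g z)) has_derivative
      (\<lambda>h. \<Sum>i\<in>Basis. \<Sum>j\<in>Basis. (f x \<bullet> i) * (g x \<bullet> j) * B' i j (\<phi>' h)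
         + ((f x \<bullet> i) * (g' h \<bullet> j) + (f' h \<bullet> i) * (g x \<bullet> j)) * B (\<phi> x) i j)) (at x)"
    by (rule has_derivative_transform_eventually) simp_all
  then show ?thesis
  proof (rule has_derivative_eq_rhs, intro ext)
    fix h
    have *: "B (\<phi> x) u v = (\<Sum>i\<in>Basis. \<Sum>j\<in>Basis. (u \<bullet> i) * (v \<bullet> j) * B (\<phi> x) i j)" for u v
      by (rule bilinear_basis[OF B[OF V(2)]])
    have "B' (f x) (g x) (\<phi>' h) = (\<Sum>i\<in>Basis. \<Sum>j\<in>Basis. (f x \<bullet> i) * (g x \<bullet> j) * B' i j (\<phi>' h))"
      by (metis expand)
    then show "(\<Sum>i\<in>Basis. \<Sum>j\<in>Basis. (f x \<bullet> i) * (g x \<bullet> j) * B' i j (\<phi>' h)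
         + ((f x \<bullet> i) * (g' h \<bullet> j) + (f' h \<bullet> i) * (g x \<bullet> j)) * B (\<phi> x) i j)
        = B' (f x) (g x) (\<phi>' h) + B (\<phi> x) (f' h) (g x) + B (\<phi> x) (f x) (g' h)"
      using *[of "f' h" "g x"] *[of "f x" "g' h"]
      by (simp only: distrib_right sum.distrib)
  qed
qed

lemma smooth_atlas_differentiable:
  assumes "smooth_atlas A"
  shows "differentiable_atlas A"
proof
  fix c c' p assume c: "c \<in> A" "c' \<in> A" "p \<in> chart_dom c" "p \<in> chart_dom c'"
  have "class_C_on \<infinity> (chart_map c ` (chart_dom c \<inter> chart_dom c')) (transition c c')"
    "open (chart_map c ` (chart_dom c \<inter> chart_dom c'))"
    using assms c unfolding smooth_atlas_def by blast+
  then show "transition c c' differentiable (at (chart_map c p))"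
    using c by (intro class_C_on_differentiable) auto
qed (use assms in \<open>unfold smooth_atlas_def, blast+\<close>)

locale riemannian_manifold =
  fixes A :: "('a, 'e::euclidean_space) atlas" and G :: "('a, 'e) metric_tensor"
  assumes smooth_manifold: "smooth_manifold A" and riemannian_metric: "riemannian_metric A G"
begin

sublocale differentiable_atlas A
  by (rule smooth_atlas_differentiable) (use smooth_manifold in \<open>simp add: smooth_manifold_def\<close>)

abbreviation overlap :: "('a, 'e) chart \<Rightarrow> ('a, 'e) chart \<Rightarrow> 'e set" where
  "overlap c c' \<equiv> chart_map c ` (chart_dom c \<inter> chart_dom c')"

abbreviation gc :: "('a, 'e) chart \<Rightarrow> 'e \<Rightarrow> 'e \<Rightarrow> 'e \<Rightarrow> real" where
  "gc \<equiv> metric_coords A G"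

abbreviation \<Gamma> :: "('a, 'e) chart \<Rightarrow> 'e \<Rightarrow> 'e \<Rightarrow> 'e \<Rightarrow> 'e" where
  "\<Gamma> \<equiv> christoffel A G"

lemma transition_smooth:
  assumes "c \<in> A" "c' \<in> A"
  shows "class_C_on \<infinity> (overlap c c') (transition c c')"
  using smooth_manifold assms unfolding smooth_manifold_def smooth_atlas_def by blast

lemma inner_product_G: "p \<in> points A \<Longrightarrow> inner_product_at (G p) p"
  using riemannian_metric unfolding riemannian_metric_def inner_product_at_def by blast

lemma gc_map:
  assumes "c \<in> A" "p \<in> chart_dom c"
  shows "gc c (chart_map c p) a b = G p (vec_of_coords A c p a) (vec_of_coords A c p b)"
  by (simp add: metric_coords_def chart_inv_map assms)

lemma gc_tangent:
  assumes "c \<in> A" "p \<in> chart_dom c" "\<xi> \<in> tangent_space A p" "\<eta> \<in> tangent_space A p"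
  shows "G p \<xi> \<eta> = gc c (chart_map c p) (\<xi> c) (\<eta> c)"
  using assms by (simp add: gc_map vec_of_tangent)

lemma gc_inner_product:
  assumes c: "c \<in> A" and x: "x \<in> chart_image c"
  shows "bilinear (gc c x)" "gc c x a b = gc c x b a" "a \<noteq> 0 \<Longrightarrow> gc c x a a > 0"
proof -
  have p: "chart_inv c x \<in> chart_dom c" "chart_inv c x \<in> points A"
    using c x chart_inv_dom[OF x] by (auto simp: points_def)
  have eq: "gc c x = (\<lambda>v w. G (chart_inv c x) (vec_of_coords A c (chart_inv c x) v) (vec_of_coords A c (chart_inv c x) w))"
    by (simp add: metric_coords_def fun_eq_iff Let_def)
  note * = inner_product_coords[OF inner_product_G[OF p(2)] c p(1)]
  show "bilinear (gc c x)" "gc c x a b = gc c x b a" unfolding eq by (fact *(1), fact *(2))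
  show "a \<noteq> 0 \<Longrightarrow> gc c x a a > 0" unfolding eq by (fact *(3))
qed

lemma gc_smooth: "c \<in> A \<Longrightarrow> class_C_on \<infinity> (chart_image c) (\<lambda>x. gc c x a b)"
  using riemannian_metric unfolding riemannian_metric_def by blast

section \<open>Derivatives of the metric and Christoffel symbols\<close>

definition dg :: "('a, 'e) chart \<Rightarrow> 'e \<Rightarrow> 'e \<Rightarrow> 'e \<Rightarrow> 'e \<Rightarrow> real" where
  "dg c x a b d = frechet_derivative (\<lambda>z. gc c z b d) (at x) a"

lemma dg_has_derivative:
  assumes "c \<in> A" "x \<in> chart_image c"
  shows "((\<lambda>z. gc c z b d) has_derivative (\<lambda>a. dg c x a b d)) (at x)"
  using class_C_on_differentiable[OF gc_smooth open_image] assms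
  unfolding dg_def by (simp add: frechet_derivative_works)

lemma dg_linear1:
  assumes "c \<in> A" "x \<in> chart_image c"
  shows "linear (\<lambda>a. dg c x a b d)"
  using dg_has_derivative[OF assms] by (rule has_derivative_linear)

lemma dg_sym:
  assumes "c \<in> A" "x \<in> chart_image c"
  shows "dg c x a b d = dg c x a d b"
proof -
  have "((\<lambda>z. gc c z b d) has_derivative (\<lambda>a. dg c x a d b)) (at x)"
    by (rule has_derivative_transform_within_open[OF dg_has_derivative[OF assms] open_image[OF assms(1)] assms(2)])
      (rule gc_inner_product(2)[OF assms(1)])
  from fun_cong[OF has_derivative_unique[OF dg_has_derivative[OF assms] this]]
  show ?thesis .
qed

lemma dg_linear2:
  assumes "c \<in> A" "x \<in> chart_image c"
  shows "linear (\<lambda>b. dg c x a b d)"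
proof -
  have "dg c x a (r *\<^sub>R b + s *\<^sub>R b') d = r * dg c x a b d + s * dg c x a b' d" for r s b b'
  proof -
    have "((\<lambda>z. r * gc c z b d + s * gc c z b' d) has_derivative (\<lambda>a. r * dg c x a b d + s * dg c x a b' d)) (at x)"
      by (intro has_derivative_add has_derivative_mult_right dg_has_derivative assms)
    then have "((\<lambda>z. gc c z (r *\<^sub>R b + s *\<^sub>R b') d) has_derivative (\<lambda>a. r * dg c x a b d + s * dg c x a b' d)) (at x)"
      by (rule has_derivative_transform_within_open[OF _ open_image[OF assms(1)] assms(2)])
        (simp add: bilinear_ladd[OF gc_inner_product(1)] bilinear_lmul[OF gc_inner_product(1)] assms(1))
    from fun_cong[OF has_derivative_unique[OF dg_has_derivative[OF assms] this]]
    show ?thesis .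
  qed
  from this[of 1 _ 1] this[of _ _ 0 0] show ?thesis by (intro linearI) (metis scaleR_one mult_1, simp)
qed

lemma dg_linear3:
  assumes "c \<in> A" "x \<in> chart_image c"
  shows "linear (\<lambda>d. dg c x a b d)"
proof -
  have "(\<lambda>d. dg c x a b d) = (\<lambda>d. dg c x a d b)"
    by (rule ext) (rule dg_sym[OF assms])
  then show ?thesis using dg_linear2[OF assms, of a b] by simp
qed

lemma dg_linear:
  assumes "c \<in> A" "x \<in> chart_image c"
  shows "dg c x (a + a') b d = dg c x a b d + dg c x a' b d" "dg c x (r *\<^sub>R a) b d = r * dg c x a b d"
    "dg c x a (b + b') d = dg c x a b d + dg c x a b' d" "dg c x a (r *\<^sub>R b) d = r * dg c x a b d"
    "dg c x a b (d + d') = dg c x a b d + dg c x a b d'" "dg c x a b (r *\<^sub>R d) = r * dg c x a b d"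
  using linear_add[OF dg_linear1[OF assms]] linear_scale[OF dg_linear1[OF assms]]
    linear_add[OF dg_linear2[OF assms]] linear_scale[OF dg_linear2[OF assms]]
    linear_add[OF dg_linear3[OF assms]] linear_scale[OF dg_linear3[OF assms]] by simp_all

lemma dg_smooth: "c \<in> A \<Longrightarrow> class_C_on \<infinity> (chart_image c) (\<lambda>x. dg c x a b d)"
  unfolding dg_def by (intro class_C_on_frechet_derivative gc_smooth open_image)

text \<open>The Koszul formula for constant coordinate fields, whose brackets vanish; classically
  the Christoffel symbols of the first kind.\<close>

definition koszul :: "('a, 'e) chart \<Rightarrow> 'e \<Rightarrow> 'e \<Rightarrow> 'e \<Rightarrow> 'e \<Rightarrow> real" where
  "koszul c x a b d = (dg c x a b d + dg c x b a d - dg c x d a b) / 2"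

lemma koszul_linear:
  assumes "c \<in> A" "x \<in> chart_image c"
  shows "linear (koszul c x a b)"
  unfolding koszul_def
  by (intro linearI) (simp_all add: dg_linear[OF assms] algebra_simps add_divide_distrib diff_divide_distrib)

text \<open>Write the metric identity with each of \<open>a\<close>, \<open>b\<close>,
  \<open>d\<close> as the direction of differentiation. By symmetry of \<open>Q\<close> the
  combination in \<open>koszul\<close> cancels everything except the product of \<open>Q a b\<close>
  with \<open>d\<close>.\<close>

lemma koszul_of_metric_connection:
  assumes c: "c \<in> A" "x \<in> chart_image c"
    and sym: "\<And>a b. Q a b = Q b a"
    and met: "\<And>a b d. dg c x a b d = gc c x (Q a b) d + gc c x b (Q a d)"
  shows "gc c x (Q a b) d = koszul c x a b d"
proof -
  note s = gc_inner_product(2)[OF c]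
  have "dg c x a b d = gc c x (Q a b) d + gc c x (Q a d) b"
    "dg c x b a d = gc c x (Q a b) d + gc c x (Q b d) a"
    "dg c x d a b = gc c x (Q a d) b + gc c x (Q b d) a"
    using met[of a b d] met[of b a d] met[of d a b] s[of b "Q a d"] s[of a "Q b d"] s[of a "Q d b"]
      sym[of a b] sym[of d a] sym[of d b] by simp_all
  then show ?thesis unfolding koszul_def by simp
qed

text \<open>Justifies the definite description in \<open>christoffel\<close>: representing the
  Koszul functional by a vector gives a connection, and any symmetric metric connection must satisfy
  the same formula.\<close>

lemma christoffel_properties:
  assumes c: "c \<in> A" "x \<in> chart_image c"
  shows "bilinear (\<Gamma> c x)" "\<Gamma> c x a b = \<Gamma> c x b a"
    "dg c x a b d = gc c x (\<Gamma> c x a b) d + gc c x b (\<Gamma> c x a d)"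
proof -
  note b = gc_inner_product[OF c]
  let ?P = "\<lambda>Q. bilinear Q \<and> (\<forall>a b. Q a b = Q b a) \<and>
     (\<forall>a b d. dg c x a b d = gc c x (Q a b) d + gc c x b (Q a d))"
  have "\<exists>w. \<forall>d. gc c x w d = koszul c x a b d" for a b
    using riesz_bilinear[OF b(1) b(3) koszul_linear[OF c]] .
  then obtain Q where Q: "\<And>a b d. gc c x (Q a b) d = koszul c x a b d" by metis
  have sym: "Q a b = Q b a" for a b
    by (rule posdef_unique[OF b(1) b(3)]) (simp_all add: Q koszul_def dg_sym[OF c, of _ b a])
  have lin: "linear (\<lambda>a. Q a b)" for b
  proof -
    have K: "koszul c x (r *\<^sub>R a + s *\<^sub>R a') b d = r * koszul c x a b d + s * koszul c x a' b d" for r s a a' d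
      unfolding koszul_def
      by (simp add: dg_linear[OF c] algebra_simps add_divide_distrib diff_divide_distrib)
    have "Q (r *\<^sub>R a + s *\<^sub>R a') b = r *\<^sub>R Q a b + s *\<^sub>R Q a' b" for r s a a'
      by (rule posdef_unique[OF b(1) b(3)])
        (simp_all add: bilinear_ladd[OF b(1)] bilinear_lmul[OF b(1)] Q K)
    from this[of 1 _ 1] this[of _ _ 0] show ?thesis by (intro linearI) simp_all
  qed
  moreover have "Q a = (\<lambda>b. Q b a)" for a using sym by blast
  ultimately have "bilinear Q" unfolding bilinear_def by metis
  moreover have "dg c x a b d = gc c x (Q a b) d + gc c x b (Q a d)" for a b d
    unfolding b(2)[of b] Q koszul_def using dg_sym[OF c, of a d b] dg_sym[OF c, of b d a] dg_sym[OF c, of d b a] by (simp add: field_simps)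
  ultimately have PQ: "?P Q" using sym by blast
  have uniq: "Q' = Q" if "?P Q'" for Q'
  proof (intro ext)
    fix u v
    have "gc c x (Q' u v) d = gc c x (Q u v) d" for d
      using koszul_of_metric_connection[OF c, of Q'] that by (simp add: Q)
    then show "Q' u v = Q u v" by - (rule posdef_unique[OF b(1) b(3)], simp_all)
  qed
  have "?P (\<Gamma> c x)"
    unfolding christoffel_def dg_def[symmetric] by (rule theI[of ?P, OF PQ uniq])
  then show "bilinear (\<Gamma> c x)" "\<Gamma> c x a b = \<Gamma> c x b a"
    "dg c x a b d = gc c x (\<Gamma> c x a b) d + gc c x b (\<Gamma> c x a d)" by blast+
qed

lemma christoffel_koszul:
  assumes "c \<in> A" "x \<in> chart_image c"
  shows "gc c x (\<Gamma> c x a b) d = koszul c x a b d"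
  using koszul_of_metric_connection[OF assms] christoffel_properties[OF assms] by blast

text \<open>Symmetry and the metric identity determine \<open>Q\<close> through the Koszul formula,
  so a candidate is recognized without examining its linearity. This serves the transformation
  law.\<close>

lemma christoffel_unique:
  assumes c: "c \<in> A" "x \<in> chart_image c"
    and Q: "\<And>a b. Q a b = Q b a" "\<And>a b d. dg c x a b d = gc c x (Q a b) d + gc c x b (Q a d)"
  shows "Q a b = \<Gamma> c x a b"
  by (rule posdef_unique[OF gc_inner_product(1,3)[OF c]])
    (simp_all add: christoffel_koszul[OF c] koszul_of_metric_connection[OF c Q])

text \<open>The symbol is the solution of a linear equation whose form and right-hand side are
  smooth in the base point, so it inherits Lipschitz dependence from
  \<open>loclip_at_riesz\<close>.\<close>

lemma christoffel_loclip:
  assumes c: "c \<in> A" "x \<in> chart_image c"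
  shows "loclip_at (\<lambda>x. \<Gamma> c x a b) x"
proof (rule loclip_at_riesz[OF open_image[OF c(1)] c(2), where B = "gc c" and \<phi> = "\<lambda>x. koszul c x a b"])
  have "loclip_at (\<lambda>x. dg c x u v w) x" for u v w
    using class_C_on_loclip[OF dg_smooth open_image] c by blast
  then have "loclip_at (\<lambda>x. (1/2) *\<^sub>R (dg c x a b d + dg c x b a d + (-1) *\<^sub>R dg c x d a b)) x" for d
    by (intro loclip_at_scaleR loclip_at_add loclip_at_const)
  then show "loclip_at (\<lambda>x. koszul c x a b d) x" for d by (simp add: koszul_def)
  show "loclip_at (\<lambda>x. gc c x u v) x" for u v
    using class_C_on_loclip[OF gc_smooth open_image] c by blast
  show "bilinear (gc c y)" if "y \<in> chart_image c" for y using gc_inner_product(1)[OF c(1) that] .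
  show "gc c x v v > 0" if "v \<noteq> 0" for v using gc_inner_product(3)[OF c that] .
  show "linear (koszul c y a b)" if "y \<in> chart_image c" for y using koszul_linear[OF c(1) that] .
  show "gc c y (\<Gamma> c y a b) d = koszul c y a b d" if "y \<in> chart_image c" for y d
    using christoffel_koszul[OF c(1) that] .
qed

section \<open>Second derivatives of transition maps and the transformation law\<close>

definition hess :: "('a, 'e) chart \<Rightarrow> ('a, 'e) chart \<Rightarrow> 'a \<Rightarrow> 'e \<Rightarrow> 'e \<Rightarrow> 'e" where
  "hess c c' p a b = frechet_derivative (\<lambda>z. frechet_derivative (transition c c') (at z) b) (at (chart_map c p)) a"

lemma hess_has_derivative:
  assumes "c \<in> A" "c' \<in> A" "p \<in> chart_dom c" "p \<in> chart_dom c'"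
  shows "((\<lambda>z. frechet_derivative (transition c c') (at z) b) has_derivative (\<lambda>a. hess c c' p a b)) (at (chart_map c p))"
  using class_C_on_differentiable[OF class_C_on_frechet_derivative[OF transition_smooth open_overlap] open_overlap] assms
  unfolding hess_def by (simp add: frechet_derivative_works)

lemma hess_sym:
  assumes "c \<in> A" "c' \<in> A" "p \<in> chart_dom c" "p \<in> chart_dom c'"
  shows "hess c c' p a b = hess c c' p b a"
  unfolding hess_def
  by (rule second_derivative_symmetric[OF transition_smooth open_overlap]) (use assms in auto)

lemma hess_linear:
  assumes "c \<in> A" "c' \<in> A" "p \<in> chart_dom c" "p \<in> chart_dom c'"
  shows "linear (\<lambda>a. hess c c' p a b)" "linear (hess c c' p b)"
proof -
  show *: "linear (\<lambda>a. hess c c' p a b)" using hess_has_derivative[OF assms] by (rule has_derivative_linear)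
  moreover have "hess c c' p b = (\<lambda>a. hess c c' p a b)" using hess_sym[OF assms] by blast
  ultimately show "linear (hess c c' p b)" by simp
qed

lemma frechet_transition:
  assumes "c \<in> A" "c' \<in> A" "z \<in> overlap c c'"
  shows "frechet_derivative (transition c c') (at z) = dtrans c c' (chart_inv c z)"
  using assms unfolding dtrans_def by (auto simp: chart_inv_map)

lemma gc_change:
  assumes "c \<in> A" "c' \<in> A" "p \<in> chart_dom c" "p \<in> chart_dom c'"
  shows "gc c (chart_map c p) a b = gc c' (chart_map c' p) (dtrans c c' p a) (dtrans c c' p b)"
proof -
  have "G p (vec_of_coords A c p a) (vec_of_coords A c p b)
      = gc c' (chart_map c' p) (vec_of_coords A c p a c') (vec_of_coords A c p b c')"
    using assms by (intro gc_tangent vec_tangent) auto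
  then show ?thesis using assms by (simp add: gc_map vec_coord)
qed

text \<open>The right-hand side, pulled back by the inverse transition, is a symmetric metric connection.\<close>

lemma christoffel_change:
  assumes c: "c \<in> A" "p \<in> chart_dom c" and c': "c' \<in> A" "p \<in> chart_dom c'"
  shows "dtrans c c' p (\<Gamma> c (chart_map c p) a b) =
    \<Gamma> c' (chart_map c' p) (dtrans c c' p a) (dtrans c c' p b) + hess c c' p a b"
proof -
  let ?x = "chart_map c p" and ?x' = "chart_map c' p" and ?J = "dtrans c c' p"
  have x: "?x \<in> chart_image c" "?x' \<in> chart_image c'" using c c' by (auto simp: chart_map_image)
  note cc' = c(1) c'(1) c(2) c'(2)
  let ?R = "\<lambda>a b. \<Gamma> c' ?x' (?J a) (?J b) + hess c c' p a b"
  define Q where "Q a b = dtrans c' c p (?R a b)" for a b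
  have JQ: "?J (Q a b) = ?R a b" for a b
    unfolding Q_def using dtrans_comp[OF c' c c'] dtrans_self[OF c'] by simp
  have "Q a b = \<Gamma> c ?x a b"
  proof (rule christoffel_unique[OF c(1) x(1)])
    show "Q a b = Q b a" for a b
      unfolding Q_def using christoffel_properties(2)[OF c'(1) x(2), of "?J a" "?J b"] hess_sym[OF cc', of a b] by simp
    fix a b d
    let ?F = "\<lambda>z. frechet_derivative (transition c c') (at z)"
    \<comment> \<open>Differentiate the transformation rule of the metric coefficients. The
      transformed vectors depend on the base point through the derivative of the transition map, and
      this produces the two terms with \<open>hess\<close>.\<close>
    have "((\<lambda>z. gc c' (transition c c' z) (?F z b) (?F z d)) has_derivative
      (\<lambda>h. dg c' (transition c c' ?x) (?J h) (?F ?x b) (?F ?x d)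
          + gc c' (transition c c' ?x) (hess c c' p h b) (?F ?x d)
          + gc c' (transition c c' ?x) (?F ?x b) (hess c c' p h d))) (at ?x)"
      by (rule has_derivative_bilinear_family[where V = "chart_image c'" and B' = "\<lambda>a b h. dg c' (transition c c' ?x) h a b"])
        (use x c' in \<open>auto simp: transition_map c open_image gc_inner_product(1)
          intro!: dg_has_derivative dtrans_has_derivative hess_has_derivative cc'\<close>)
    then have "((\<lambda>z. gc c z b d) has_derivative
      (\<lambda>h. dg c' (transition c c' ?x) (?J h) (?F ?x b) (?F ?x d)
          + gc c' (transition c c' ?x) (hess c c' p h b) (?F ?x d)
          + gc c' (transition c c' ?x) (?F ?x b) (hess c c' p h d))) (at ?x)"
    proof (rule has_derivative_transform_within_open[OF _ open_overlap[OF c(1) c'(1)]])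
      show "?x \<in> overlap c c'" using c c' by auto
      fix z assume "z \<in> overlap c c'"
      then obtain r where r: "r \<in> chart_dom c" "r \<in> chart_dom c'" "z = chart_map c r" by auto
      show "gc c' (transition c c' z) (?F z b) (?F z d) = gc c z b d"
        unfolding r(3) gc_change[OF c(1) c'(1) r(1,2)] dtrans_def transition_map[OF c(1) r(1)] ..
    qed
    from fun_cong[OF has_derivative_unique[OF dg_has_derivative[OF c(1) x(1)] this], of a]
    have "dg c ?x a b d = dg c' ?x' (?J a) (?J b) (?J d)
          + gc c' ?x' (hess c c' p a b) (?J d) + gc c' ?x' (?J b) (hess c c' p a d)"
      unfolding dtrans_def[symmetric] transition_map[OF c] .
    also have "dg c' ?x' (?J a) (?J b) (?J d) = gc c' ?x' (\<Gamma> c' ?x' (?J a) (?J b)) (?J d)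
          + gc c' ?x' (?J b) (\<Gamma> c' ?x' (?J a) (?J d))"
      by (rule christoffel_properties(3)[OF c'(1) x(2)])
    finally show "dg c ?x a b d = gc c ?x (Q a b) d + gc c ?x b (Q a d)"
      unfolding gc_change[OF cc'] JQ
      by (simp add: bilinear_ladd[OF gc_inner_product(1)[OF c'(1) x(2)]] bilinear_radd[OF gc_inner_product(1)[OF c'(1) x(2)]])
  qed
  then show ?thesis using JQ by metis
qed

end

section \<open>The tangent bundle and the Sasaki metric\<close>

context riemannian_manifold
begin

abbreviation TA :: "(('a, 'e) tpoint, 'e \<times> 'e) atlas" where
  "TA \<equiv> tangent_atlas A"

abbreviation tc :: "('a, 'e) chart \<Rightarrow> (('a, 'e) tpoint, 'e \<times> 'e) chart" where
  "tc \<equiv> tangent_chart A"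

section \<open>The atlas of the tangent bundle\<close>

lemma tc_dom: "x \<in> chart_dom (tc c) \<longleftrightarrow> fst x \<in> chart_dom c \<and> snd x \<in> tangent_space A (fst x)"
  by (cases x) (simp add: tangent_chart_def)

lemma tc_map: "chart_map (tc c) x = (chart_map c (fst x), snd x c)"
  by (cases x) (simp add: tangent_chart_def)

lemma tc_atlas: "c \<in> A \<Longrightarrow> tc c \<in> TA"
  by (simp add: tangent_atlas_def)

lemma points_TA: "x \<in> points TA \<longleftrightarrow> fst x \<in> points A \<and> snd x \<in> tangent_space A (fst x)"
proof -
  have "x \<in> points TA \<longleftrightarrow> (\<exists>c\<in>A. x \<in> chart_dom (tc c))"
    unfolding points_def tangent_atlas_def by blast
  then show ?thesis unfolding tc_dom points_def by blast
qed

lemma tc_inj: "c \<in> A \<Longrightarrow> inj_on (chart_map (tc c)) (chart_dom (tc c))"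
proof (rule inj_onI)
  fix x y assume c: "c \<in> A" and x: "x \<in> chart_dom (tc c)" and y: "y \<in> chart_dom (tc c)"
    and eq: "chart_map (tc c) x = chart_map (tc c) y"
  have e: "chart_map c (fst x) = chart_map c (fst y)" "snd x c = snd y c"
    using eq by (simp_all add: tc_map)
  have d: "fst x \<in> chart_dom c" "fst y \<in> chart_dom c"
    "snd x \<in> tangent_space A (fst x)" "snd y \<in> tangent_space A (fst y)"
    using x y tc_dom by blast+
  have f: "fst x = fst y" using inj_onD[OF inj[OF c] e(1) d(1,2)] .
  have "snd x = snd y" by (rule tangent_eqI[OF d(3) d(4)[folded f] c d(1) e(2)])
  then show "x = y" using f by (rule prod_eqI[rotated])
qed

text \<open>Every coordinate vector is realized over every base point by
  \<open>vec_of_coords\<close>, so the image is a full product.\<close>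

lemma tc_image_of:
  assumes c: "c \<in> A" and S: "S \<subseteq> chart_dom c"
  shows "chart_map (tc c) ` {x \<in> chart_dom (tc c). fst x \<in> S} = (chart_map c ` S) \<times> UNIV"
proof (intro set_eqI iffI)
  fix z assume "z \<in> (chart_map c ` S) \<times> (UNIV :: 'e set)"
  then obtain p y where p: "p \<in> S" "z = (chart_map c p, y)" by auto
  then have pd: "p \<in> chart_dom c" using S by auto
  have "(p, vec_of_coords A c p y) \<in> {x \<in> chart_dom (tc c). fst x \<in> S}"
    using p pd c by (simp add: tc_dom vec_tangent)
  moreover have "chart_map (tc c) (p, vec_of_coords A c p y) = z"
    using p pd c by (simp add: tc_map vec_coord_self)
  ultimately show "z \<in> chart_map (tc c) ` {x \<in> chart_dom (tc c). fst x \<in> S}" by blast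
qed (auto simp: tc_map)

lemma tc_image: "c \<in> A \<Longrightarrow> chart_image (tc c) = chart_image c \<times> UNIV"
  using tc_image_of[of c "chart_dom c"] tc_dom unfolding chart_image_def
  by (metis (no_types, lifting) Collect_cong Collect_mem_eq order_refl)

lemma tc_overlap:
  assumes "c \<in> A"
  shows "chart_map (tc c) ` (chart_dom (tc c) \<inter> chart_dom (tc c')) = overlap c c' \<times> UNIV"
proof -
  have "chart_dom (tc c) \<inter> chart_dom (tc c') = {x \<in> chart_dom (tc c). fst x \<in> chart_dom c \<inter> chart_dom c'}"
    using tc_dom by blast
  then show ?thesis using tc_image_of[OF assms, of "chart_dom c \<inter> chart_dom c'"] by simp
qed

lemma tc_inv:
  assumes c: "c \<in> A" "z \<in> chart_image c"
  shows "chart_inv (tc c) (z, y) = (chart_inv c z, vec_of_coords A c (chart_inv c z) y)"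
proof -
  let ?x = "(chart_inv c z, vec_of_coords A c (chart_inv c z) y)"
  have p: "chart_inv c z \<in> chart_dom c" using c(2) by (rule chart_inv_dom)
  have "?x \<in> chart_dom (tc c)" using p c by (simp add: tc_dom vec_tangent)
  then have "chart_inv (tc c) (chart_map (tc c) ?x) = ?x"
    using tc_inj[OF c(1)] by (simp add: chart_inv_def)
  then show ?thesis using p c by (simp add: tc_map vec_coord_self chart_map_inv)
qed

lemma tc_transition:
  assumes c: "c \<in> A" "c' \<in> A" and z: "z \<in> overlap c c'"
  shows "transition (tc c) (tc c') (z, y) = (transition c c' z, frechet_derivative (transition c c') (at z) y)"
proof -
  have p: "chart_inv c z \<in> chart_dom c" "chart_inv c z \<in> chart_dom c'" "z \<in> chart_image c"
    using z c by (auto simp: chart_inv_map chart_image_def)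
  show ?thesis
    using p c frechet_transition[OF c z] by (simp add: transition_def tc_inv tc_map vec_coord)
qed

text \<open>The second component of the transition map is the derivative of
  \<open>transition c c'\<close> applied to the fibre coordinate. Written as a sum over the basis it
  is a sum of scalar functions times vectors, and the product rule yields the Hessian term and the
  linear term.\<close>

lemma tc_transition_derivative:
  assumes c: "c \<in> A" "p \<in> chart_dom c" and c': "c' \<in> A" "p \<in> chart_dom c'"
  shows "(transition (tc c) (tc c') has_derivative
    (\<lambda>h. (dtrans c c' p (fst h), hess c c' p (fst h) y + dtrans c c' p (snd h)))) (at (chart_map c p, y))"
proof -
  note cc' = c(1) c'(1) c(2) c'(2)
  let ?F = "\<lambda>z. frechet_derivative (transition c c') (at z)"
  let ?x = "chart_map c p"
  have F: "((\<lambda>w. ?F (fst w) i) has_derivative (\<lambda>h. hess c c' p (fst h) i)) (at (?x, y))" for i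
    by (rule has_derivative_compose[where f = fst and g = "\<lambda>z. ?F z i"])
      (auto intro!: derivative_eq_intros hess_has_derivative cc')
  have "((\<lambda>w. \<Sum>i\<in>Basis. (snd w \<bullet> i) *\<^sub>R ?F (fst w) i) has_derivative
      (\<lambda>h. \<Sum>i\<in>Basis. (snd (?x, y) \<bullet> i) *\<^sub>R hess c c' p (fst h) i + (snd h \<bullet> i) *\<^sub>R ?F (fst (?x, y)) i)) (at (?x, y))"
    by (intro has_derivative_sum has_derivative_scaleR F has_derivative_inner_left)
      (auto intro!: derivative_eq_intros)
  moreover have "(\<Sum>i\<in>Basis. (snd (?x, y) \<bullet> i) *\<^sub>R hess c c' p (fst h) i + (snd h \<bullet> i) *\<^sub>R ?F (fst (?x, y)) i)
      = hess c c' p (fst h) y + dtrans c c' p (snd h)" for h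
  proof -
    show ?thesis
      using linear_basis[OF hess_linear(2)[OF cc', of "fst h"], of y] linear_basis[OF dtrans_linear[OF cc'], of "snd h"]
      by (simp add: sum.distrib dtrans_def)
  qed
  ultimately have "((\<lambda>w. \<Sum>i\<in>Basis. (snd w \<bullet> i) *\<^sub>R ?F (fst w) i) has_derivative
      (\<lambda>h. hess c c' p (fst h) y + dtrans c c' p (snd h))) (at (?x, y))"
    by simp
  moreover have "((\<lambda>w. transition c c' (fst w)) has_derivative (\<lambda>h. dtrans c c' p (fst h))) (at (?x, y))"
    by (rule has_derivative_compose[where f = fst and g = "transition c c'"])
      (auto intro!: derivative_eq_intros dtrans_has_derivative cc')
  ultimately have "((\<lambda>w. (transition c c' (fst w), \<Sum>i\<in>Basis. (snd w \<bullet> i) *\<^sub>R ?F (fst w) i)) has_derivative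
      (\<lambda>h. (dtrans c c' p (fst h), hess c c' p (fst h) y + dtrans c c' p (snd h)))) (at (?x, y))"
    by (intro has_derivative_Pair)
  then show ?thesis
  proof (rule has_derivative_transform_within_open)
    show "open (overlap c c' \<times> (UNIV :: 'e set))" by (intro open_Times open_overlap c c' open_UNIV)
    show "(?x, y) \<in> overlap c c' \<times> UNIV" using c c' by auto
    fix w :: "'e \<times> 'e" assume w: "w \<in> overlap c c' \<times> UNIV"
    then have "transition c c' differentiable (at (fst w))"
      using transition_differentiable[OF c(1) c'(1)] by auto
    then have "?F (fst w) (snd w) = (\<Sum>i\<in>Basis. (snd w \<bullet> i) *\<^sub>R ?F (fst w) i)"
      by (rule frechet_derivative_basis)
    then show "(transition c c' (fst w), \<Sum>i\<in>Basis. (snd w \<bullet> i) *\<^sub>R ?F (fst w) i) = transition (tc c) (tc c') w"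
      using tc_transition[OF c(1) c'(1), of "fst w" "snd w"] w by (cases w) auto
  qed
qed

sublocale T: differentiable_atlas "tangent_atlas A"
proof
  fix C assume "C \<in> TA"
  then obtain c where c: "c \<in> A" "C = tc c" by (auto simp: tangent_atlas_def)
  show "inj_on (chart_map C) (chart_dom C)" using c tc_inj by simp
  show "open (chart_image C)" unfolding c(2) tc_image[OF c(1)] by (intro open_Times open_image c open_UNIV)
  fix C' assume "C' \<in> TA"
  then obtain c' where c': "c' \<in> A" "C' = tc c'" by (auto simp: tangent_atlas_def)
  show "open (chart_map C ` (chart_dom C \<inter> chart_dom C'))"
    unfolding c(2) c'(2) tc_overlap[OF c(1)] by (intro open_Times open_overlap c c' open_UNIV)
  fix x assume "x \<in> chart_dom C" "x \<in> chart_dom C'"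
  then have "fst x \<in> chart_dom c" "fst x \<in> chart_dom c'" using c c' tc_dom by auto
  from tc_transition_derivative[OF c(1) this(1) c'(1) this(2)]
  show "transition C C' differentiable (at (chart_map C x))"
    unfolding c(2) c'(2) tc_map differentiable_def by blast
qed

lemma T_dtrans:
  assumes "c \<in> A" "c' \<in> A" "x \<in> chart_dom (tc c)" "x \<in> chart_dom (tc c')"
  shows "T.dtrans (tc c) (tc c') x h =
    (dtrans c c' (fst x) (fst h), hess c c' (fst x) (fst h) (snd x c) + dtrans c c' (fst x) (snd h))"
proof -
  have "(transition (tc c) (tc c') has_derivative
    (\<lambda>h. (dtrans c c' (fst x) (fst h), hess c c' (fst x) (fst h) (snd x c) + dtrans c c' (fst x) (snd h))))
    (at (chart_map (tc c) x))"
    unfolding tc_map by (rule tc_transition_derivative) (use assms tc_dom in auto)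
  from fun_cong[OF has_derivative_unique[OF T.dtrans_has_derivative[OF tc_atlas tc_atlas] this]]
  show ?thesis using assms by blast
qed

section \<open>Topology of the tangent bundle\<close>

lemma continuous_map_fst: "continuous_map (manifold_topology TA) (manifold_topology A) fst"
  unfolding continuous_map
proof (intro conjI allI impI)
  show "fst ` topspace (manifold_topology TA) \<subseteq> topspace (manifold_topology A)"
    unfolding T.topspace_manifold topspace_manifold using points_TA by blast
  fix U assume U: "openin (manifold_topology A) U"
  have "open (chart_map C ` ({x \<in> points TA. fst x \<in> U} \<inter> chart_dom C))" if C: "C \<in> TA" for C
  proof -
    obtain c where c: "c \<in> A" "C = tc c" using C by (auto simp: tangent_atlas_def)
    have "{x \<in> points TA. fst x \<in> U} \<inter> chart_dom C = {x \<in> chart_dom (tc c). fst x \<in> U \<inter> chart_dom c}"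
      using c C tc_dom unfolding points_def by blast
    then have "chart_map C ` ({x \<in> points TA. fst x \<in> U} \<inter> chart_dom C) = chart_map c ` (U \<inter> chart_dom c) \<times> UNIV"
      using tc_image_of[OF c(1), of "U \<inter> chart_dom c"] c(2) by simp
    then show ?thesis using open_chart_image_Int[OF U c(1)] by (simp add: open_Times)
  qed
  then show "openin (manifold_topology TA) {x \<in> topspace (manifold_topology TA). fst x \<in> U}"
    unfolding T.topspace_manifold T.openin_topology by blast
qed

text \<open>Vectors over different base points are separated by preimages of open sets of M. Two
  vectors at the same base point lie in one common chart and are separated by their
  coordinates.\<close>

lemma Hausdorff_TA: "Hausdorff_space (manifold_topology TA)"
  unfolding Hausdorff_space_def T.topspace_manifold
proof (intro allI impI)
  fix x y assume xy: "x \<in> points TA \<and> y \<in> points TA \<and> x \<noteq> y"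
  show "\<exists>U V. openin (manifold_topology TA) U \<and> openin (manifold_topology TA) V \<and> x \<in> U \<and> y \<in> V \<and> disjnt U V"
  proof (cases "fst x = fst y")
    case False
    have "Hausdorff_space (manifold_topology A)" using smooth_manifold by (simp add: smooth_manifold_def)
    moreover have "fst x \<in> points A" "fst y \<in> points A" using xy points_TA by auto
    ultimately obtain U V where UV: "openin (manifold_topology A) U" "openin (manifold_topology A) V"
      "fst x \<in> U" "fst y \<in> V" "disjnt U V"
      using False unfolding Hausdorff_space_def topspace_manifold by meson
    let ?P = "\<lambda>U. {x \<in> points TA. fst x \<in> U}"
    have "openin (manifold_topology TA) (?P U)" "openin (manifold_topology TA) (?P V)"
      using openin_continuous_map_preimage[OF continuous_map_fst] UV T.topspace_manifold by auto
    moreover have "x \<in> ?P U" "y \<in> ?P V" "disjnt (?P U) (?P V)" using xy UV unfolding disjnt_def by blast+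
    ultimately show ?thesis by blast
  next
    case True
    obtain c where c: "c \<in> A" "fst x \<in> chart_dom c" using xy points_TA unfolding points_def by blast
    then have d: "x \<in> chart_dom (tc c)" "y \<in> chart_dom (tc c)" using xy points_TA True tc_dom by metis+
    then have "chart_map (tc c) x \<noteq> chart_map (tc c) y" using tc_inj[OF c(1)] xy unfolding inj_on_def by blast
    then obtain U V where UV: "open U" "open V" "chart_map (tc c) x \<in> U" "chart_map (tc c) y \<in> V" "U \<inter> V = {}"
      by (meson hausdorff)
    let ?P = "\<lambda>U. {x \<in> chart_dom (tc c). chart_map (tc c) x \<in> U}"
    have "openin (manifold_topology TA) (?P U)" "openin (manifold_topology TA) (?P V)"
      using UV by (simp_all add: T.openin_chart_preimage tc_atlas c)
    moreover have "x \<in> ?P U" "y \<in> ?P V" "disjnt (?P U) (?P V)" using d UV unfolding disjnt_def by blast+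
    ultimately show ?thesis by blast
  qed
qed

section \<open>Horizontal and vertical parts, Sasaki gradient\<close>

lemma horizontal_coord:
  assumes "c \<in> A" "fst x \<in> chart_dom c"
  shows "horizontal_part A x \<Xi> c = fst (\<Xi> (tc c))"
  using assms by (simp add: horizontal_part_def)

lemma vertical_coord:
  assumes "c \<in> A" "fst x \<in> chart_dom c"
  shows "vertical_part A G x \<Xi> c = snd (\<Xi> (tc c)) + \<Gamma> c (chart_map c (fst x)) (fst (\<Xi> (tc c))) (snd x c)"
  using assms by (simp add: vertical_part_def covariant_derivative_coords_def)

text \<open>The second coordinates of \<Xi> change with a Hessian term, and this term is exactly the
  inhomogeneous term in the transformation law of the Christoffel symbols. So the vertical part
  changes like a tangent vector of M.\<close>

lemma horizontal_vertical_tangent: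
  assumes x: "x \<in> points TA" and \<Xi>: "\<Xi> \<in> tangent_space TA x"
  shows "horizontal_part A x \<Xi> \<in> tangent_space A (fst x)" "vertical_part A G x \<Xi> \<in> tangent_space A (fst x)"
proof -
  have change: "horizontal_part A x \<Xi> c' = dtrans c c' (fst x) (horizontal_part A x \<Xi> c) \<and>
      vertical_part A G x \<Xi> c' = dtrans c c' (fst x) (vertical_part A G x \<Xi> c)"
    if c: "c \<in> A" "c' \<in> A" "fst x \<in> chart_dom c" "fst x \<in> chart_dom c'" for c c'
  proof -
    have d: "x \<in> chart_dom (tc c)" "x \<in> chart_dom (tc c')" using x c points_TA tc_dom by auto
    have v: "snd x c' = dtrans c c' (fst x) (snd x c)"
      using x c points_TA by (intro tangent_dtrans) auto
    have "\<Xi> (tc c') = T.dtrans (tc c) (tc c') x (\<Xi> (tc c))"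
      by (rule T.tangent_dtrans[OF \<Xi>]) (use c d tc_atlas in auto)
    then have \<Xi>': "fst (\<Xi> (tc c')) = dtrans c c' (fst x) (fst (\<Xi> (tc c)))"
      "snd (\<Xi> (tc c')) = hess c c' (fst x) (fst (\<Xi> (tc c))) (snd x c) + dtrans c c' (fst x) (snd (\<Xi> (tc c)))"
      by (simp_all add: T_dtrans[OF c(1,2) d])
    show ?thesis
      unfolding horizontal_coord[OF c(1,3)] horizontal_coord[OF c(2,4)] vertical_coord[OF c(1,3)] vertical_coord[OF c(2,4)] \<Xi>' v
        linear_add[OF dtrans_linear[OF c]] christoffel_change[OF c(1,3) c(2,4)]
      by simp
  qed
  have z: "horizontal_part A x \<Xi> c = 0" "vertical_part A G x \<Xi> c = 0" if "\<not> (c \<in> A \<and> fst x \<in> chart_dom c)" for c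
    unfolding horizontal_part_def vertical_part_def using that by (simp_all only: if_False)
  show "horizontal_part A x \<Xi> \<in> tangent_space A (fst x)" "vertical_part A G x \<Xi> \<in> tangent_space A (fst x)"
    unfolding tangent_space_def dtrans_def[symmetric] using change z by blast+
qed

lemma horizontal_vertical_lincomb:
  assumes x: "x \<in> points TA"
  shows "horizontal_part A x (\<lambda>C. a *\<^sub>R \<Xi> C + b *\<^sub>R \<Theta> C) = (\<lambda>c. a *\<^sub>R horizontal_part A x \<Xi> c + b *\<^sub>R horizontal_part A x \<Theta> c)"
    "vertical_part A G x (\<lambda>C. a *\<^sub>R \<Xi> C + b *\<^sub>R \<Theta> C) = (\<lambda>c. a *\<^sub>R vertical_part A G x \<Xi> c + b *\<^sub>R vertical_part A G x \<Theta> c)"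
proof -
  show "horizontal_part A x (\<lambda>C. a *\<^sub>R \<Xi> C + b *\<^sub>R \<Theta> C) = (\<lambda>c. a *\<^sub>R horizontal_part A x \<Xi> c + b *\<^sub>R horizontal_part A x \<Theta> c)"
    by (rule ext) (simp add: horizontal_part_def)
  show "vertical_part A G x (\<lambda>C. a *\<^sub>R \<Xi> C + b *\<^sub>R \<Theta> C) = (\<lambda>c. a *\<^sub>R vertical_part A G x \<Xi> c + b *\<^sub>R vertical_part A G x \<Theta> c)"
  proof
    fix c
    show "vertical_part A G x (\<lambda>C. a *\<^sub>R \<Xi> C + b *\<^sub>R \<Theta> C) c = a *\<^sub>R vertical_part A G x \<Xi> c + b *\<^sub>R vertical_part A G x \<Theta> c"
    proof (cases "c \<in> A \<and> fst x \<in> chart_dom c")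
      case True
      then have "chart_map c (fst x) \<in> chart_image c" by (simp add: chart_map_image)
      then have "bilinear (\<Gamma> c (chart_map c (fst x)))" using True christoffel_properties(1) by blast
      then show ?thesis
        using True by (simp add: vertical_coord bilinear_ladd bilinear_lmul algebra_simps)
    next
      case False
      then show ?thesis unfolding vertical_part_def by (simp only: if_False) simp
    qed
  qed
qed

text \<open>Definiteness is the only point beyond properties of \<open>G\<close>. If the horizontal
  part vanishes, so does the first coordinate of \<Xi>; the Christoffel term in the vertical part is
  then zero, and a vanishing vertical part kills the second coordinate.\<close>

lemma sasaki_inner_product:
  assumes x: "x \<in> points TA"
  shows "T.inner_product_at (sasaki_metric A G x) x"
proof -
  let ?p = "fst x" and ?H = "horizontal_part A x" and ?V = "vertical_part A G x"
  have p: "?p \<in> points A" using x points_TA by blast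
  note t = horizontal_vertical_tangent[OF x]
  note G = inner_product_G[OF p, unfolded inner_product_at_def, rule_format]
  have sym: "G ?p \<xi> \<eta> = G ?p \<eta> \<xi>" if "\<xi> \<in> tangent_space A ?p" "\<eta> \<in> tangent_space A ?p" for \<xi> \<eta>
    using G that by blast
  have lin: "G ?p (\<lambda>c. a *\<^sub>R \<xi> c + b *\<^sub>R \<eta> c) \<zeta> = a * G ?p \<xi> \<zeta> + b * G ?p \<eta> \<zeta>"
    if "\<xi> \<in> tangent_space A ?p" "\<eta> \<in> tangent_space A ?p" "\<zeta> \<in> tangent_space A ?p" for \<xi> \<eta> \<zeta> a b
    using G that by blast
  have pos: "G ?p \<xi> \<xi> > 0" if "\<xi> \<in> tangent_space A ?p" "\<xi> \<noteq> (\<lambda>_. 0)" for \<xi>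
    using G that by blast
  have nonneg: "G ?p \<xi> \<xi> \<ge> 0" if "\<xi> \<in> tangent_space A ?p" for \<xi>
  proof (cases "\<xi> = (\<lambda>_. 0)")
    case True
    then show ?thesis using lin[OF that that that, of 0 0] by simp
  next
    case False
    then show ?thesis using pos[OF that] by (simp add: less_imp_le)
  qed
  have "sasaki_metric A G x \<Xi> \<Xi> > 0" if \<Xi>: "\<Xi> \<in> tangent_space TA x" "\<Xi> \<noteq> (\<lambda>_. 0)" for \<Xi>
  proof -
    have "?H \<Xi> \<noteq> (\<lambda>_. 0) \<or> ?V \<Xi> \<noteq> (\<lambda>_. 0)"
    proof (rule ccontr)
      assume "\<not> ?thesis"
      then have 0: "?H \<Xi> = (\<lambda>_. 0)" "?V \<Xi> = (\<lambda>_. 0)" by auto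
      obtain c where c: "c \<in> A" "?p \<in> chart_dom c" using p unfolding points_def by blast
      have "bilinear (\<Gamma> c (chart_map c ?p))"
        using christoffel_properties(1)[OF c(1) chart_map_image[OF c(2)]] .
      then have "\<Xi> (tc c) = 0"
        using fun_cong[OF 0(1), of c] fun_cong[OF 0(2), of c] c
        by (simp add: horizontal_coord vertical_coord bilinear_lzero prod_eq_iff)
      moreover have "x \<in> chart_dom (tc c)" using c x points_TA tc_dom by blast
      ultimately show False
        using T.tangent_eqI[OF \<Xi>(1) T.tangent_zero[OF x] tc_atlas[OF c(1)]] \<Xi>(2) by blast
    qed
    then show ?thesis
      unfolding sasaki_metric_def
      using pos[OF t(1)[OF \<Xi>(1)]] pos[OF t(2)[OF \<Xi>(1)]] nonneg[OF t(1)[OF \<Xi>(1)]] nonneg[OF t(2)[OF \<Xi>(1)]]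
      by linarith
  qed
  moreover have "sasaki_metric A G x \<Xi> \<Theta> = sasaki_metric A G x \<Theta> \<Xi>"
    if "\<Xi> \<in> tangent_space TA x" "\<Theta> \<in> tangent_space TA x" for \<Xi> \<Theta>
    unfolding sasaki_metric_def using sym t that by metis
  moreover have "sasaki_metric A G x (\<lambda>C. a *\<^sub>R \<Xi> C + b *\<^sub>R \<Theta> C) \<Psi>
      = a * sasaki_metric A G x \<Xi> \<Psi> + b * sasaki_metric A G x \<Theta> \<Psi>"
    if "\<Xi> \<in> tangent_space TA x" "\<Theta> \<in> tangent_space TA x" "\<Psi> \<in> tangent_space TA x" for \<Xi> \<Theta> \<Psi> a b
    unfolding sasaki_metric_def horizontal_vertical_lincomb[OF x]
    using t that by (simp add: lin algebra_simps)
  ultimately show ?thesis unfolding T.inner_product_at_def by blast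
qed

text \<open>Coordinates of the tangent vector to \<open>TM\<close> at \<open>x = (q, v)\<close> with horizontal part \<open>v\<close> and
  vertical part \<open>F\<close>.\<close>

definition spray :: "('a, 'e) chart \<Rightarrow> ('a, 'e) tpoint \<Rightarrow> ('a, 'e) tvec \<Rightarrow> 'e \<times> 'e" where
  "spray c x F = (snd x c, F c - \<Gamma> c (chart_map c (fst x)) (snd x c) (snd x c))"

text \<open>Expresses that the second order equation is independent of the chart. It is needed
  because \<open>trajectory\<close> imposes the equation in every chart that contains a piece of the
  curve.\<close>

lemma spray_change:
  assumes c: "c \<in> A" "c' \<in> A" "x \<in> chart_dom (tc c)" "x \<in> chart_dom (tc c')"
    and F: "F \<in> tangent_space A (fst x)"
  shows "T.dtrans (tc c) (tc c') x (spray c x F) = spray c' x F"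
proof -
  have p: "fst x \<in> chart_dom c" "fst x \<in> chart_dom c'" "snd x \<in> tangent_space A (fst x)"
    using c tc_dom by auto
  have v: "snd x c' = dtrans c c' (fst x) (snd x c)" "F c' = dtrans c c' (fst x) (F c)"
    using tangent_dtrans p c F by blast+
  show ?thesis
    unfolding T_dtrans[OF c] spray_def fst_conv snd_conv v
      linear_diff[OF dtrans_linear[OF c(1,2) p(1,2)]] christoffel_change[OF c(1) p(1) c(2) p(2)]
    by simp
qed

text \<open>The tangent vector of TM with coordinates \<open>spray c x F\<close> has horizontal part
  v and vertical part \<open>F\<close>, so both products together are its Sasaki product with the
  gradient, that is, the differential of \<Phi> in its direction.\<close>

lemma gradient_spray:
  assumes x: "x \<in> points TA" and c: "c \<in> A" "fst x \<in> chart_dom c"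
    and F: "F \<in> tangent_space A (fst x)"
    and \<Phi>: "\<And>C. C \<in> TA \<Longrightarrow> x \<in> chart_dom C \<Longrightarrow> (\<Phi> \<circ> chart_inv C) differentiable (at (chart_map C x))"
  defines "gr \<equiv> gradient TA (sasaki_metric A G) \<Phi> x"
  shows "G (fst x) (horizontal_part A x gr) (snd x) + G (fst x) (vertical_part A G x gr) F
    = frechet_derivative (\<Phi> \<circ> chart_inv (tc c)) (at (chart_map (tc c) x)) (spray c x F)"
proof -
  have d: "x \<in> chart_dom (tc c)" using x c points_TA tc_dom by blast
  define \<Xi> where "\<Xi> = vec_of_coords TA (tc c) x (spray c x F)"
  have \<Xi>: "\<Xi> \<in> tangent_space TA x" unfolding \<Xi>_def by (rule T.vec_tangent[OF tc_atlas[OF c(1)] d])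
  have \<Xi>c: "\<Xi> (tc c) = spray c x F" unfolding \<Xi>_def by (rule T.vec_coord_self[OF tc_atlas[OF c(1)] d])
  have v: "snd x \<in> tangent_space A (fst x)" using x points_TA by blast
  have "horizontal_part A x \<Xi> = snd x"
    by (rule tangent_eqI[OF horizontal_vertical_tangent(1)[OF x \<Xi>] v c])
      (simp add: horizontal_coord c \<Xi>c spray_def)
  moreover have "vertical_part A G x \<Xi> = F"
    by (rule tangent_eqI[OF horizontal_vertical_tangent(2)[OF x \<Xi>] F c])
      (simp add: vertical_coord c \<Xi>c spray_def)
  ultimately have "G (fst x) (horizontal_part A x gr) (snd x) + G (fst x) (vertical_part A G x gr) F
      = sasaki_metric A G x gr \<Xi>"
    by (simp add: sasaki_metric_def)
  also have "\<dots> = frechet_derivative (\<Phi> \<circ> chart_inv (tc c)) (at (chart_map (tc c) x)) (\<Xi> (tc c))"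
    unfolding gr_def
    by (rule T.gradient_properties(2)[where G = "sasaki_metric A G" and F = \<Phi>, OF sasaki_inner_product[OF x] x \<Phi> \<Xi> tc_atlas[OF c(1)] d])
  finally show ?thesis by (simp only: \<Xi>c)
qed

end

section \<open>Absolutely continuous curves\<close>

lemma has_ac_derivativeD:
  assumes "has_ac_derivative h h' a b"
  shows "integrable (lebesgue_on {a..b}) h'"
    "s \<in> {a..b} \<Longrightarrow> h s = h a + integral\<^sup>L (lebesgue_on {a..s}) h'"
    "s \<in> {a..b} \<Longrightarrow> integrable (lebesgue_on {a..s}) h'"
proof -
  show 1: "integrable (lebesgue_on {a..b}) h'"
    and "s \<in> {a..b} \<Longrightarrow> h s = h a + integral\<^sup>L (lebesgue_on {a..s}) h'"
    using assms unfolding has_ac_derivative_def by blast+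
  show "s \<in> {a..b} \<Longrightarrow> integrable (lebesgue_on {a..s}) h'"
    by (rule integrable_subinterval[OF 1]) auto
qed

lemma has_ac_derivative_bounded_linear:
  fixes L :: "'b::euclidean_space \<Rightarrow> 'c::euclidean_space"
  assumes "has_ac_derivative h h' a b" "bounded_linear L"
  shows "has_ac_derivative (\<lambda>s. L (h s)) (\<lambda>s. L (h' s)) a b"
  unfolding has_ac_derivative_def
proof (intro conjI ballI)
  show "integrable (lebesgue_on {a..b}) (\<lambda>s. L (h' s))"
    by (rule integrable_bounded_linear[OF assms(2) has_ac_derivativeD(1)[OF assms(1)]])
  fix s assume s: "s \<in> {a..b}"
  have "integral\<^sup>L (lebesgue_on {a..s}) (\<lambda>s. L (h' s)) = L (integral\<^sup>L (lebesgue_on {a..s}) h')"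
    by (rule integral_bounded_linear[OF assms(2) has_ac_derivativeD(3)[OF assms(1) s]])
  then show "L (h s) = L (h a) + integral\<^sup>L (lebesgue_on {a..s}) (\<lambda>s. L (h' s))"
    using has_ac_derivativeD(2)[OF assms(1) s] linear_add[OF bounded_linear.linear[OF assms(2)]] by metis
qed

lemma has_ac_derivative_add:
  assumes "has_ac_derivative h h' a b" "has_ac_derivative k k' a b"
  shows "has_ac_derivative (\<lambda>s. h s + k s) (\<lambda>s. h' s + k' s) a b"
  unfolding has_ac_derivative_def
proof (intro conjI ballI)
  show "integrable (lebesgue_on {a..b}) (\<lambda>s. h' s + k' s)"
    by (intro Bochner_Integration.integrable_add has_ac_derivativeD(1)[OF assms(1)] has_ac_derivativeD(1)[OF assms(2)])
  fix s assume s: "s \<in> {a..b}"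
  have "integral\<^sup>L (lebesgue_on {a..s}) (\<lambda>s. h' s + k' s)
      = integral\<^sup>L (lebesgue_on {a..s}) h' + integral\<^sup>L (lebesgue_on {a..s}) k'"
    by (intro Bochner_Integration.integral_add has_ac_derivativeD(3)[OF assms(1) s] has_ac_derivativeD(3)[OF assms(2) s])
  then show "h s + k s = h a + k a + integral\<^sup>L (lebesgue_on {a..s}) (\<lambda>s. h' s + k' s)"
    using has_ac_derivativeD(2)[OF assms(1) s] has_ac_derivativeD(2)[OF assms(2) s] by simp
qed

lemma has_ac_derivative_Pair:
  fixes h :: "real \<Rightarrow> 'b::euclidean_space" and k :: "real \<Rightarrow> 'c::euclidean_space"
  assumes "has_ac_derivative h h' a b" "has_ac_derivative k k' a b"
  shows "has_ac_derivative (\<lambda>s. (h s, k s)) (\<lambda>s. (h' s, k' s)) a b"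
proof -
  have "bounded_linear (\<lambda>x. (x :: 'b, 0 :: 'c))" "bounded_linear (\<lambda>y. (0 :: 'b, y :: 'c))"
    by (intro bounded_linear_Pair bounded_linear_ident bounded_linear_zero)+
  from has_ac_derivative_add[OF has_ac_derivative_bounded_linear[OF assms(1) this(1)]
      has_ac_derivative_bounded_linear[OF assms(2) this(2)]]
  show ?thesis by simp
qed

text \<open>Concatenated controls and velocities are defined by cases, and on either piece they may
  differ from the original at the junction time \<open>m\<close> only.\<close>

lemma integrable_lebesgue_on_spike:
  fixes f :: "real \<Rightarrow> 'b::euclidean_space"
  assumes f: "integrable (lebesgue_on {a..b}) f" and eq: "\<And>x. x \<in> {a..b} \<Longrightarrow> x \<noteq> m \<Longrightarrow> g x = f x"
  shows "integrable (lebesgue_on {a..b}) g" "integral\<^sup>L (lebesgue_on {a..b}) g = integral\<^sup>L (lebesgue_on {a..b}) f"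
proof -
  have "f absolutely_integrable_on {a..b}"
    using f by (simp add: integrable_restrict_space set_integrable_def)
  then have "g absolutely_integrable_on {a..b}"
    by (rule absolutely_integrable_spike[where S = "{m}"]) (use eq in auto)
  then show g: "integrable (lebesgue_on {a..b}) g"
    by (rule absolutely_integrable_imp_integrable) auto
  have "integral {a..b} g = integral {a..b} f"
    by (rule integral_spike[where S = "{m}"]) (use eq in auto)
  then show "integral\<^sup>L (lebesgue_on {a..b}) g = integral\<^sup>L (lebesgue_on {a..b}) f"
    using f g by (simp add: lebesgue_integral_eq_integral)
qed

lemma has_ac_derivative_join:
  assumes h: "has_ac_derivative h h1 a m" "has_ac_derivative h h2 m b" and m: "a \<le> m" "m \<le> b"
  shows "has_ac_derivative h (\<lambda>s. if s \<le> m then h1 s else h2 s) a b" (is "has_ac_derivative h ?h a b")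
proof -
  have i1: "integrable (lebesgue_on {a..m}) h1" and i2: "integrable (lebesgue_on {m..b}) h2"
    using has_ac_derivativeD(1)[OF h(1)] has_ac_derivativeD(1)[OF h(2)] by auto
  have I1: "integrable (lebesgue_on {a..m}) ?h"
    by (rule integrable_lebesgue_on_spike(1)[OF i1, of m]) auto
  have I2: "integrable (lebesgue_on {m..b}) ?h"
    by (rule integrable_lebesgue_on_spike(1)[OF i2, of m]) auto
  have I: "integrable (lebesgue_on {a..b}) ?h"
    using integrable_combine[OF I1 I2 m] .
  have eq1: "h s = h a + integral\<^sup>L (lebesgue_on {a..s}) ?h" if s: "s \<in> {a..m}" for s
  proof -
    have "integral\<^sup>L (lebesgue_on {a..s}) ?h = integral\<^sup>L (lebesgue_on {a..s}) h1"
      by (rule integrable_lebesgue_on_spike(2)[OF has_ac_derivativeD(3)[OF h(1) s], of m]) (use s in auto)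
    then show ?thesis using has_ac_derivativeD(2)[OF h(1) s] by simp
  qed
  have "h s = h a + integral\<^sup>L (lebesgue_on {a..s}) ?h" if s: "s \<in> {a..b}" for s
  proof (cases "s \<le> m")
    case True
    then have "s \<in> {a..m}" using s by simp
    then show ?thesis by (rule eq1)
  next
    case False
    have s': "s \<in> {m..b}" using s False by auto
    have "integral\<^sup>L (lebesgue_on {m..s}) ?h = integral\<^sup>L (lebesgue_on {m..s}) h2"
      by (rule integrable_lebesgue_on_spike(2)[OF has_ac_derivativeD(3)[OF h(2) s'], of m]) (use s in auto)
    moreover have "integrable (lebesgue_on {a..s}) ?h"
      using I integrable_subinterval[of a b ?h a s] s by auto
    then have "integral\<^sup>L (lebesgue_on {a..s}) ?h = integral\<^sup>L (lebesgue_on {a..m}) ?h + integral\<^sup>L (lebesgue_on {m..s}) ?h"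
      by (rule Equivalence_Measurable_On_Borel.integral_combine) (use m False in auto)
    moreover have "h m = h a + integral\<^sup>L (lebesgue_on {a..m}) ?h" using m by (intro eq1) simp
    moreover have "h s = h m + integral\<^sup>L (lebesgue_on {m..s}) h2"
      by (rule has_ac_derivativeD(2)[OF h(2) s'])
    ultimately show ?thesis by (simp only: add.assoc)
  qed
  then show ?thesis using I unfolding has_ac_derivative_def by blast
qed

lemma has_ac_derivative_vector_derivative:
  fixes h :: "real \<Rightarrow> 'b::euclidean_space"
  assumes h: "\<And>s. s \<in> {a..b} \<Longrightarrow> (h has_vector_derivative h' s) (at s within {a..b})"
    and h': "continuous_on {a..b} h'"
  shows "has_ac_derivative h h' a b"
  unfolding has_ac_derivative_def
proof (intro conjI ballI)
  show "integrable (lebesgue_on {a..b}) h'" using h' by (rule continuous_imp_integrable_real)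
  fix s assume s: "s \<in> {a..b}"
  have "(h' has_integral h s - h a) {a..s}"
  proof (rule fundamental_theorem_of_calculus)
    show "(h has_vector_derivative h' x) (at x within {a..s})" if "x \<in> {a..s}" for x
      by (rule has_vector_derivative_within_subset[OF h]) (use that s in auto)
  qed (use s in auto)
  moreover have "integrable (lebesgue_on {a..s}) h'"
    using h' s by (intro continuous_imp_integrable_real) (auto intro: continuous_on_subset)
  ultimately show "h s = h a + integral\<^sup>L (lebesgue_on {a..s}) h'"
    by (simp add: lebesgue_integral_eq_integral integral_unique)
qed

lemma has_ac_derivative_cong:
  assumes "has_ac_derivative h h' a b" "\<And>s. s \<in> {a..b} \<Longrightarrow> h s = k s"
  shows "has_ac_derivative k h' a b"
  unfolding has_ac_derivative_def
proof (intro conjI ballI)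
  show "integrable (lebesgue_on {a..b}) h'" using has_ac_derivativeD(1)[OF assms(1)] .
  fix s assume s: "s \<in> {a..b}"
  then have "a \<in> {a..b}" by auto
  then show "k s = k a + integral\<^sup>L (lebesgue_on {a..s}) h'"
    using has_ac_derivativeD(2)[OF assms(1) s] assms(2)[OF s] assms(2)[of a] by metis
qed

lemma AE_lebesgue_on: "(AE s in lebesgue_on {a..b}. P s) \<longleftrightarrow> (AE s in lebesgue. s \<in> {a..b} \<longrightarrow> P s)" for a b :: real
  by (rule AE_restrict_space_iff) auto

lemma AE_lebesgue_neq: "AE s in lebesgue. s \<noteq> (m :: real)"
  by (rule AE_completion) (rule AE_lborel_singleton)

section \<open>The control system in coordinates\<close>

locale control_system = riemannian_manifold A G
  for A :: "('a, 'e::euclidean_space) atlas" and G :: "('a, 'e) metric_tensor" +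
  fixes W :: "'a \<Rightarrow> real" and f :: "'m::finite \<Rightarrow> 'a \<Rightarrow> ('a, 'e) tvec"
  assumes W: "smooth_function A W" and f: "\<And>j. smooth_vector_field A (f j)"
begin

lemma W_smooth: "c \<in> A \<Longrightarrow> class_C_on \<infinity> (chart_image c) (W \<circ> chart_inv c)"
  using W unfolding smooth_function_def by blast

lemma W_differentiable:
  assumes "c \<in> A" "p \<in> chart_dom c"
  shows "(W \<circ> chart_inv c) differentiable (at (chart_map c p))"
  by (rule class_C_on_differentiable[OF W_smooth[OF assms(1)] open_image[OF assms(1)] chart_map_image[OF assms(2)]])

lemma gradient_W_tangent: "p \<in> points A \<Longrightarrow> gradient A G W p \<in> tangent_space A p"
  by (rule gradient_properties(1)[where G = G and F = W, OF inner_product_G _ W_differentiable])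

lemma force_tangent:
  assumes p: "p \<in> points A"
  shows "force A G W f p u \<in> tangent_space A p"
proof -
  have "f j p \<in> tangent_space A p" for j using f p unfolding smooth_vector_field_def by blast
  then have "(\<lambda>c. \<Sum>j\<in>UNIV. (u $ j) *\<^sub>R f j p c) \<in> tangent_space A p"
    by (intro tangent_sum[OF p])
  from tangent_lincomb[OF gradient_W_tangent[OF p] this, of "-1" 1]
  show ?thesis by (simp add: force_def)
qed

lemma gradient_W_loclip:
  assumes c: "c \<in> A" "x \<in> chart_image c"
  shows "loclip_at (\<lambda>x. gradient A G W (chart_inv c x) c) x"
proof (rule loclip_at_riesz[OF open_image[OF c(1)] c(2), where B = "gc c"
      and \<phi> = "\<lambda>x. frechet_derivative (W \<circ> chart_inv c) (at x)"])
  show "bilinear (gc c y)" if "y \<in> chart_image c" for y using gc_inner_product(1)[OF c(1) that] .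
  show "gc c x v v > 0" if "v \<noteq> 0" for v using gc_inner_product(3)[OF c that] .
  show "loclip_at (\<lambda>x. gc c x u v) x" for u v
    using class_C_on_loclip[OF gc_smooth open_image] c by blast
  show "loclip_at (\<lambda>x. frechet_derivative (W \<circ> chart_inv c) (at x) b) x" for b
    using class_C_on_loclip[OF class_C_on_frechet_derivative[OF W_smooth open_image] open_image] c by blast
  fix y assume y: "y \<in> chart_image c"
  show "linear (frechet_derivative (W \<circ> chart_inv c) (at y))"
    by (rule linear_frechet_derivative[OF class_C_on_differentiable[OF W_smooth[OF c(1)] open_image[OF c(1)] y]])
  fix b
  have p: "chart_inv c y \<in> chart_dom c" "chart_inv c y \<in> points A" "chart_map c (chart_inv c y) = y"
    using chart_inv_dom[OF y] chart_map_inv[OF y] c unfolding points_def by blast+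
  have "gc c y (gradient A G W (chart_inv c y) c) b = G (chart_inv c y) (gradient A G W (chart_inv c y)) (vec_of_coords A c (chart_inv c y) b)"
    using gc_tangent[OF c(1) p(1) gradient_W_tangent[OF p(2)] vec_tangent[OF c(1) p(1)], of b]
    by (simp add: p vec_coord_self[OF c(1) p(1)])
  also have "\<dots> = frechet_derivative (W \<circ> chart_inv c) (at y) b"
    using gradient_properties(2)[where G = G and F = W, OF inner_product_G[OF p(2)] p(2) W_differentiable vec_tangent[OF c(1) p(1), of b] c(1) p(1)]
    by (simp add: p vec_coord_self[OF c(1) p(1)])
  finally show "gc c y (gradient A G W (chart_inv c y) c) b = frechet_derivative (W \<circ> chart_inv c) (at y) b" .
qed

section \<open>The vector field of the system in a chart of TM\<close>

text \<open>The right-hand side of the first order system for (q, v) with the control as a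
  parameter, as a function of coordinates; \<open>fld_spray\<close> relates it to the intrinsic
  description.\<close>

definition fld :: "('a, 'e) chart \<Rightarrow> 'e \<times> 'e \<Rightarrow> real^'m \<Rightarrow> 'e \<times> 'e" where
  "fld c z u = (snd z, force A G W f (chart_inv c (fst z)) u c - \<Gamma> c (fst z) (snd z) (snd z))"

lemma fld_spray:
  assumes "c \<in> A" "x \<in> chart_dom (tc c)"
  shows "fld c (chart_map (tc c) x) u = spray c x (force A G W f (fst x) u)"
  using assms by (simp add: fld_def spray_def tc_map tc_dom chart_inv_map)

text \<open>Coordinates of the vertical lift of \<open>f j\<close>: controls act on the velocity
  only.\<close>

definition ctl :: "('a, 'e) chart \<Rightarrow> 'm \<Rightarrow> 'e \<times> 'e \<Rightarrow> 'e \<times> 'e" where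
  "ctl c j z = (0, f j (chart_inv c (fst z)) c)"

text \<open>Reduces regularity and growth questions to the drift and finitely many control
  fields.\<close>

lemma fld_affine: "fld c z u = fld c z 0 + (\<Sum>j\<in>UNIV. (u $ j) *\<^sub>R ctl c j z)"
proof -
  have "(\<Sum>j\<in>UNIV. (u $ j) *\<^sub>R ctl c j z) = (0, \<Sum>j\<in>UNIV. (u $ j) *\<^sub>R f j (chart_inv c (fst z)) c)"
    by (simp add: ctl_def prod_eq_iff fst_sum snd_sum)
  then show ?thesis by (simp add: fld_def force_def)
qed

lemma ctl_loclip:
  assumes c: "c \<in> A" and z: "z \<in> chart_image (tc c)"
  shows "loclip_at (ctl c j) z"
proof -
  have x: "fst z \<in> chart_image c" using z tc_image[OF c] by auto
  have "class_C_on \<infinity> (chart_image c) (\<lambda>x. f j (chart_inv c x) c)"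
    using f c unfolding smooth_vector_field_def by blast
  then have "loclip_at (\<lambda>x. f j (chart_inv c x) c) (fst z)"
    using class_C_on_loclip open_image[OF c] x by blast
  then have "loclip_at (\<lambda>z. f j (chart_inv c (fst z)) c) z"
    by (rule loclip_at_comp_lipschitz[where p = fst]) (rule dist_fst_le)
  then show ?thesis unfolding ctl_def[abs_def] by (intro loclip_at_Pair loclip_at_const)
qed

lemma fld_loclip:
  assumes c: "c \<in> A" and z: "z \<in> chart_image (tc c)"
  shows "loclip_at (\<lambda>z. fld c z u) z"
proof -
  have x: "fst z \<in> chart_image c" using z tc_image[OF c] by auto
  have lsnd: "loclip_at (\<lambda>z. snd z \<bullet> i) z" for i :: 'e
    by (intro loclip_at_bounded_linear bounded_linear_compose[OF bounded_linear_inner_left bounded_linear_snd])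
  have "loclip_at (\<lambda>z. \<Gamma> c (fst z) i j) z" for i j
    by (rule loclip_at_comp_lipschitz[where p = fst, OF christoffel_loclip[OF c x]]) (rule dist_fst_le)
  \<comment> \<open>The quadratic term is expanded in the basis because Lipschitz continuity of the
    Christoffel symbols is known for fixed arguments only.\<close>
  then have "loclip_at (\<lambda>z. \<Sum>i\<in>Basis. \<Sum>j\<in>Basis. (snd z \<bullet> i) *\<^sub>R ((snd z \<bullet> j) *\<^sub>R \<Gamma> c (fst z) i j)) z"
    by (intro loclip_at_sum loclip_at_scaleR lsnd)
  then have \<Gamma>: "loclip_at (\<lambda>z. \<Gamma> c (fst z) (snd z) (snd z)) z"
  proof (rule loclip_at_cong[OF _ _ z])
    show "open (chart_image (tc c))" by (rule T.open_image[OF tc_atlas[OF c]])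
    fix w assume "w \<in> chart_image (tc c)"
    then have "bilinear (\<Gamma> c (fst w))" using tc_image[OF c] christoffel_properties(1)[OF c] by auto
    then show "(\<Sum>i\<in>Basis. \<Sum>j\<in>Basis. (snd w \<bullet> i) *\<^sub>R ((snd w \<bullet> j) *\<^sub>R \<Gamma> c (fst w) i j)) = \<Gamma> c (fst w) (snd w) (snd w)"
      using bilinear_basis_sum[of "\<Gamma> c (fst w)" "snd w" "snd w"] by simp
  qed
  have "loclip_at (\<lambda>z. gradient A G W (chart_inv c (fst z)) c) z"
    by (rule loclip_at_comp_lipschitz[where p = fst, OF gradient_W_loclip[OF c x]]) (rule dist_fst_le)
  then have "loclip_at (\<lambda>z. (-1) *\<^sub>R gradient A G W (chart_inv c (fst z)) c + (-1) *\<^sub>R \<Gamma> c (fst z) (snd z) (snd z)) z"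
    by (intro loclip_at_add loclip_at_scaleR loclip_at_const \<Gamma>)
  then have "loclip_at (\<lambda>z. (snd z, (-1) *\<^sub>R gradient A G W (chart_inv c (fst z)) c + (-1) *\<^sub>R \<Gamma> c (fst z) (snd z) (snd z))) z"
    by (rule loclip_at_Pair[OF loclip_at_bounded_linear[OF bounded_linear_snd]])
  then have "loclip_at (\<lambda>z. fld c z 0) z"
    by (simp add: fld_def force_def)
  then have "loclip_at (\<lambda>z. fld c z 0 + (\<Sum>j\<in>UNIV. (u $ j) *\<^sub>R ctl c j z)) z"
    by (intro loclip_at_add loclip_at_sum loclip_at_scaleR loclip_at_const ctl_loclip c z)
  then show ?thesis by (simp only: fld_affine[symmetric])
qed

lemma fld_continuous: "c \<in> A \<Longrightarrow> continuous_on (chart_image (tc c)) (\<lambda>z. fld c z u)"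
  by (intro continuous_at_imp_continuous_on ballI loclip_at_continuous fld_loclip)

lemma fld_joint_continuous:
  assumes "c \<in> A"
  shows "continuous_on (chart_image (tc c) \<times> UNIV) (\<lambda>w. fld c (fst w) (snd w))"
proof -
  have "continuous_on (chart_image (tc c)) (ctl c j)" for j
    by (intro continuous_at_imp_continuous_on ballI loclip_at_continuous ctl_loclip assms)
  then have "continuous_on (chart_image (tc c) \<times> (UNIV :: (real^'m) set)) (\<lambda>w. fld c (fst w) 0 + (\<Sum>j\<in>UNIV. (snd w $ j) *\<^sub>R ctl c j (fst w)))"
    by (intro continuous_intros continuous_on_compose2[OF fld_continuous[OF assms]]
        continuous_on_compose2[of "chart_image (tc c)" "ctl c j" _ fst for j]) auto
  then show ?thesis by (simp only: fld_affine[symmetric])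
qed

text \<open>Linear growth in the control, uniform near \<open>z\<close>. The quadratic lower bound
  of the Lagrangian is to be weighed against it.\<close>

lemma fld_bound:
  assumes c: "c \<in> A" and z: "z \<in> chart_image (tc c)"
  obtains r C where "r > 0" "C > 0" "\<And>w u. w \<in> ball z r \<Longrightarrow> norm (fld c w u) \<le> C * (1 + norm u)"
proof -
  obtain M r where M: "M > 0" "r > 0" "\<And>w. w \<in> ball z r \<Longrightarrow> norm (fld c w 0) \<le> M"
    using loclip_at_bounded[OF fld_loclip[OF c z]] by blast
  have "\<exists>N s. N > 0 \<and> s > 0 \<and> (\<forall>w\<in>ball z s. norm (ctl c j w) \<le> N)" for j
    using loclip_at_bounded[OF ctl_loclip[OF c z, of j]] by metis
  then obtain N s where N: "\<And>j. N j > 0" "\<And>j. s j > 0" "\<And>j w. w \<in> ball z (s j) \<Longrightarrow> norm (ctl c j w) \<le> N j"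
    by metis
  define r' where "r' = min r (Min (range s))"
  have r': "r' > 0" using M N by (simp add: r'_def Min_gr_iff)
  define C where "C = M + sum N UNIV"
  have C: "C > 0" using M N by (simp add: C_def add_pos_nonneg sum_nonneg less_imp_le)
  have "norm (fld c w u) \<le> C * (1 + norm u)" if w: "w \<in> ball z r'" for w u
  proof -
    have "w \<in> ball z (s j)" for j
      using w Min_le[of "range s" "s j"] by (auto simp: r'_def)
    then have ctl: "norm ((u $ j) *\<^sub>R ctl c j w) \<le> norm u * N j" for j
      using N(3)[of w j] by (auto intro!: mult_mono component_le_norm_cart)
    have "norm (fld c w u) \<le> norm (fld c w 0) + norm (\<Sum>j\<in>UNIV. (u $ j) *\<^sub>R ctl c j w)"
      unfolding fld_affine[of c w u] by (rule norm_triangle_ineq)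
    also have "\<dots> \<le> M + (\<Sum>j\<in>UNIV. norm u * N j)"
      using M(3)[of w] w by (intro add_mono sum_norm_le ctl) (auto simp: r'_def)
    also have "\<dots> = M + norm u * sum N UNIV" by (simp add: sum_distrib_left)
    also have "\<dots> \<le> C * (1 + norm u)"
      using M N by (simp add: C_def algebra_simps sum_nonneg less_imp_le)
    finally show ?thesis .
  qed
  then show ?thesis using that r' C by blast
qed

section \<open>Solutions in a chart, restriction and concatenation of trajectories\<close>

text \<open>One Caratheodory equation in the coordinates of TM in place of the pair of equations in
  \<open>trajectory\<close>; restriction and gluing are simpler in this form.\<close>

definition solves :: "('a, 'e) chart \<Rightarrow> (real \<Rightarrow> real^'m) \<Rightarrow> (real \<Rightarrow> ('a, 'e) tpoint) \<Rightarrow> real \<Rightarrow> real \<Rightarrow> bool" where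
  "solves c u \<gamma> a b \<longleftrightarrow> (\<exists>\<zeta>'. has_ac_derivative (\<lambda>s. chart_map (tc c) (\<gamma> s)) \<zeta>' a b \<and>
     (AE s in lebesgue_on {a..b}. \<zeta>' s = fld c (chart_map (tc c) (\<gamma> s)) (u s)))"

lemma solves_iff:
  assumes c: "c \<in> A" and \<gamma>: "\<gamma> ` {a..b} \<subseteq> chart_dom (tc c)"
  shows "solves c u \<gamma> a b \<longleftrightarrow> (let x = (\<lambda>s. chart_map c (fst (\<gamma> s))); y = (\<lambda>s. snd (\<gamma> s) c) in
         \<exists>x' y'. has_ac_derivative x x' a b \<and> has_ac_derivative y y' a b \<and>
           (AE s in lebesgue_on {a..b}.
              x' s = y s \<and>
              covariant_derivative_coords A G c (x s) (x' s) (y s) (y' s)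
                = force A G W f (fst (\<gamma> s)) (u s) c))"
proof -
  let ?x = "\<lambda>s. chart_map c (fst (\<gamma> s))" and ?y = "\<lambda>s. snd (\<gamma> s) c"
  have eq: "(x', y') = fld c (chart_map (tc c) (\<gamma> s)) (u s) \<longleftrightarrow>
      x' = ?y s \<and> covariant_derivative_coords A G c (?x s) x' (?y s) y' = force A G W f (fst (\<gamma> s)) (u s) c"
    if "s \<in> {a..b}" for s x' y'
  proof -
    have "\<gamma> s \<in> chart_dom (tc c)" using \<gamma> that by blast
    then show ?thesis
      using c by (auto simp: fld_spray spray_def covariant_derivative_coords_def algebra_simps)
  qed
  show ?thesis
    unfolding Let_def
  proof
    assume "solves c u \<gamma> a b"
    then obtain \<zeta>' where 1: "has_ac_derivative (\<lambda>s. (?x s, ?y s)) \<zeta>' a b"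
      and 2: "AE s in lebesgue_on {a..b}. \<zeta>' s = fld c (chart_map (tc c) (\<gamma> s)) (u s)"
      unfolding solves_def tc_map by blast
    have "has_ac_derivative ?x (\<lambda>s. fst (\<zeta>' s)) a b" "has_ac_derivative ?y (\<lambda>s. snd (\<zeta>' s)) a b"
      using has_ac_derivative_bounded_linear[OF 1 bounded_linear_fst]
        has_ac_derivative_bounded_linear[OF 1 bounded_linear_snd] by simp_all
    moreover have "AE s in lebesgue_on {a..b}. fst (\<zeta>' s) = ?y s \<and>
        covariant_derivative_coords A G c (?x s) (fst (\<zeta>' s)) (?y s) (snd (\<zeta>' s)) = force A G W f (fst (\<gamma> s)) (u s) c"
      using 2 unfolding AE_lebesgue_on by eventually_elim (metis eq prod.collapse)
    ultimately show "\<exists>x' y'. has_ac_derivative ?x x' a b \<and> has_ac_derivative ?y y' a b \<and>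
           (AE s in lebesgue_on {a..b}. x' s = ?y s \<and>
              covariant_derivative_coords A G c (?x s) (x' s) (?y s) (y' s) = force A G W f (fst (\<gamma> s)) (u s) c)"
      by blast
  next
    assume "\<exists>x' y'. has_ac_derivative ?x x' a b \<and> has_ac_derivative ?y y' a b \<and>
           (AE s in lebesgue_on {a..b}. x' s = ?y s \<and>
              covariant_derivative_coords A G c (?x s) (x' s) (?y s) (y' s) = force A G W f (fst (\<gamma> s)) (u s) c)"
    then obtain x' y' where 1: "has_ac_derivative ?x x' a b" "has_ac_derivative ?y y' a b"
      and 2: "AE s in lebesgue_on {a..b}. x' s = ?y s \<and>
              covariant_derivative_coords A G c (?x s) (x' s) (?y s) (y' s) = force A G W f (fst (\<gamma> s)) (u s) c"
      by blast
    have "AE s in lebesgue_on {a..b}. (x' s, y' s) = fld c (chart_map (tc c) (\<gamma> s)) (u s)"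
      using 2 unfolding AE_lebesgue_on by eventually_elim (use eq in blast)
    then show "solves c u \<gamma> a b"
      using has_ac_derivative_Pair[OF 1] unfolding solves_def tc_map by blast
  qed
qed

lemma trajectory_iff:
  "trajectory A G W f t T x\<^sub>0 u \<gamma> \<longleftrightarrow>
     continuous_map (top_of_set {t..T}) (manifold_topology TA) \<gamma> \<and> \<gamma> t = x\<^sub>0 \<and>
     (\<forall>c\<in>A. \<forall>a b. t \<le> a \<and> a \<le> b \<and> b \<le> T \<and> \<gamma> ` {a..b} \<subseteq> chart_dom (tc c) \<longrightarrow> solves c u \<gamma> a b)"
  unfolding trajectory_def using solves_iff by blast

lemma trajectory_solves:
  assumes "trajectory A G W f t T x\<^sub>0 u \<gamma>" "c \<in> A" "t \<le> a" "a \<le> b" "b \<le> T" "\<gamma> ` {a..b} \<subseteq> chart_dom (tc c)"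
  shows "solves c u \<gamma> a b"
  using assms unfolding trajectory_iff by blast

lemma solves_cong:
  assumes "solves c u \<gamma> a b" "\<And>s. s \<in> {a..b} \<Longrightarrow> \<gamma> s = \<gamma>' s" "\<And>s. s \<in> {a..b} \<Longrightarrow> s \<noteq> m \<Longrightarrow> u s = u' s"
  shows "solves c u' \<gamma>' a b"
proof -
  obtain \<zeta>' where 1: "has_ac_derivative (\<lambda>s. chart_map (tc c) (\<gamma> s)) \<zeta>' a b"
    and 2: "AE s in lebesgue_on {a..b}. \<zeta>' s = fld c (chart_map (tc c) (\<gamma> s)) (u s)"
    using assms(1) unfolding solves_def by blast
  have "AE s in lebesgue_on {a..b}. \<zeta>' s = fld c (chart_map (tc c) (\<gamma>' s)) (u' s)"
    using 2 AE_lebesgue_neq[of m] unfolding AE_lebesgue_on by eventually_elim (use assms in auto)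
  moreover have "has_ac_derivative (\<lambda>s. chart_map (tc c) (\<gamma>' s)) \<zeta>' a b"
    by (rule has_ac_derivative_cong[OF 1]) (simp add: assms(2))
  ultimately show ?thesis unfolding solves_def by blast
qed

lemma solves_join:
  assumes "solves c u \<gamma> a m" "solves c u \<gamma> m b" "a \<le> m" "m \<le> b"
  shows "solves c u \<gamma> a b"
proof -
  let ?E = "\<lambda>s. fld c (chart_map (tc c) (\<gamma> s)) (u s)"
  obtain z1 where 1: "has_ac_derivative (\<lambda>s. chart_map (tc c) (\<gamma> s)) z1 a m"
    and 2: "AE s in lebesgue_on {a..m}. z1 s = ?E s"
    using assms(1) unfolding solves_def by blast
  obtain z2 where 3: "has_ac_derivative (\<lambda>s. chart_map (tc c) (\<gamma> s)) z2 m b"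
    and 4: "AE s in lebesgue_on {m..b}. z2 s = ?E s"
    using assms(2) unfolding solves_def by blast
  have "AE s in lebesgue_on {a..b}. (if s \<le> m then z1 s else z2 s) = ?E s"
    using 2 4 unfolding AE_lebesgue_on by eventually_elim auto
  then show ?thesis
    using has_ac_derivative_join[OF 1 3 assms(3,4)] unfolding solves_def by blast
qed

lemma trajectory_subinterval:
  assumes "trajectory A G W f t T x\<^sub>0 u \<gamma>" "t \<le> t'" "T' \<le> T"
  shows "trajectory A G W f t' T' (\<gamma> t') u \<gamma>"
proof -
  have "continuous_map (top_of_set {t'..T'}) (manifold_topology TA) \<gamma>"
    by (rule continuous_map_from_subtopology_mono[of euclidean "{t..T}"])
      (use assms in \<open>auto simp: trajectory_iff\<close>)
  then show ?thesis using assms unfolding trajectory_iff by auto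
qed

text \<open>An interval on which the joined curve stays in a chart lies on one side of
  \<open>m\<close> or is cut at \<open>m\<close>; in the last case the two solutions are joined
  there.\<close>

lemma trajectory_join:
  assumes 1: "trajectory A G W f t m x\<^sub>0 u\<^sub>1 \<gamma>\<^sub>1" and 2: "trajectory A G W f m T (\<gamma>\<^sub>1 m) u\<^sub>2 \<gamma>\<^sub>2"
    and m: "t \<le> m" "m \<le> T"
  shows "trajectory A G W f t T x\<^sub>0 (\<lambda>s. if s \<le> m then u\<^sub>1 s else u\<^sub>2 s) (\<lambda>s. if s \<le> m then \<gamma>\<^sub>1 s else \<gamma>\<^sub>2 s)"
    (is "trajectory A G W f t T x\<^sub>0 ?u ?\<gamma>")
  unfolding trajectory_iff
proof (intro conjI ballI allI impI)
  have c1: "continuous_map (top_of_set {t..m}) (manifold_topology TA) \<gamma>\<^sub>1"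
    and c2: "continuous_map (top_of_set {m..T}) (manifold_topology TA) \<gamma>\<^sub>2"
    and start: "\<gamma>\<^sub>1 t = x\<^sub>0" "\<gamma>\<^sub>2 m = \<gamma>\<^sub>1 m"
    using 1 2 unfolding trajectory_iff by blast+
  have eq1: "?\<gamma> s = \<gamma>\<^sub>1 s" if "s \<le> m" for s using that by simp
  have eq2: "?\<gamma> s = \<gamma>\<^sub>2 s" if "m \<le> s" for s using that start(2) by (cases "s = m") auto
  show "?\<gamma> t = x\<^sub>0" using start(1) m by simp
  \<comment> \<open>Preimages of closed sets paste well: each piece is closed in a closed interval,
    and so is their union.\<close>
  show "continuous_map (top_of_set {t..T}) (manifold_topology TA) ?\<gamma>"
    unfolding continuous_map_closedin
  proof (intro conjI allI impI)
    have "\<gamma>\<^sub>1 ` {t..m} \<subseteq> topspace (manifold_topology TA)" "\<gamma>\<^sub>2 ` {m..T} \<subseteq> topspace (manifold_topology TA)"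
      using continuous_map_image_subset_topspace[OF c1] continuous_map_image_subset_topspace[OF c2] by simp_all
    then have "?\<gamma> s \<in> topspace (manifold_topology TA)" if "s \<in> {t..T}" for s
      using that by (cases "s \<le> m") (simp_all add: image_subset_iff)
    then show "?\<gamma> \<in> topspace (top_of_set {t..T}) \<rightarrow> topspace (manifold_topology TA)" by simp
    fix C assume C: "closedin (manifold_topology TA) C"
    have "closedin (top_of_set {t..m}) {s \<in> {t..m}. \<gamma>\<^sub>1 s \<in> C}" "closedin (top_of_set {m..T}) {s \<in> {m..T}. \<gamma>\<^sub>2 s \<in> C}"
      using closedin_continuous_map_preimage[OF c1 C] closedin_continuous_map_preimage[OF c2 C] by simp_all
    then have "closed {s \<in> {t..m}. \<gamma>\<^sub>1 s \<in> C}" "closed {s \<in> {m..T}. \<gamma>\<^sub>2 s \<in> C}"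
      by (auto intro: closedin_closed_trans)
    then have "closed ({s \<in> {t..m}. \<gamma>\<^sub>1 s \<in> C} \<union> {s \<in> {m..T}. \<gamma>\<^sub>2 s \<in> C})" by (rule closed_Un)
    moreover have "{s \<in> {t..T}. ?\<gamma> s \<in> C} = {s \<in> {t..m}. \<gamma>\<^sub>1 s \<in> C} \<union> {s \<in> {m..T}. \<gamma>\<^sub>2 s \<in> C}"
    proof (intro set_eqI)
      fix s
      show "s \<in> {s \<in> {t..T}. ?\<gamma> s \<in> C} \<longleftrightarrow> s \<in> {s \<in> {t..m}. \<gamma>\<^sub>1 s \<in> C} \<union> {s \<in> {m..T}. \<gamma>\<^sub>2 s \<in> C}"
        using eq1[of s] eq2[of s] m by (cases "s < m") (auto simp: not_less)
    qed
    ultimately show "closedin (top_of_set {t..T}) {s \<in> topspace (top_of_set {t..T}). ?\<gamma> s \<in> C}"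
      by (auto intro!: closed_subset)
  qed
  fix c a b assume c: "c \<in> A" and ab: "t \<le> a \<and> a \<le> b \<and> b \<le> T \<and> ?\<gamma> ` {a..b} \<subseteq> chart_dom (tc c)"
  then have sub: "?\<gamma> ` {a..b} \<subseteq> chart_dom (tc c)" by blast
  have s1: "solves c ?u ?\<gamma> a' b'" if "a \<le> a'" "a' \<le> b'" "b' \<le> b" "b' \<le> m" for a' b'
  proof (rule solves_cong)
    have "\<gamma>\<^sub>1 s \<in> chart_dom (tc c)" if "s \<in> {a'..b'}" for s
    proof -
      have "?\<gamma> s = \<gamma>\<^sub>1 s" "s \<in> {a..b}" using that \<open>b' \<le> m\<close> \<open>a \<le> a'\<close> \<open>b' \<le> b\<close> by auto
      then show ?thesis using subsetD[OF sub imageI[of s "{a..b}" ?\<gamma>]] by simp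
    qed
    then have "\<gamma>\<^sub>1 ` {a'..b'} \<subseteq> chart_dom (tc c)" by blast
    then show "solves c u\<^sub>1 \<gamma>\<^sub>1 a' b'" by (rule trajectory_solves[OF 1 c, rotated -1]) (use ab that in auto)
  qed (use that eq1 in auto)
  \<comment> \<open>At time \<open>m\<close> itself the joined control takes its value from the
    first piece, so controls agree except at \<open>m\<close>; the curves agree there because the
    second one starts where the first one ends.\<close>
  have s2: "solves c ?u ?\<gamma> a' b'" if "a \<le> a'" "a' \<le> b'" "b' \<le> b" "m \<le> a'" for a' b'
  proof (rule solves_cong[where m = m])
    have "\<gamma>\<^sub>2 s \<in> chart_dom (tc c)" if "s \<in> {a'..b'}" for s
    proof -
      have "?\<gamma> s = \<gamma>\<^sub>2 s" by (rule eq2) (use that \<open>m \<le> a'\<close> in auto)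
      moreover have "s \<in> {a..b}" using that \<open>a \<le> a'\<close> \<open>b' \<le> b\<close> by auto
      ultimately show ?thesis using subsetD[OF sub imageI[of s "{a..b}" ?\<gamma>]] by simp
    qed
    then have "\<gamma>\<^sub>2 ` {a'..b'} \<subseteq> chart_dom (tc c)" by blast
    then show "solves c u\<^sub>2 \<gamma>\<^sub>2 a' b'" by (rule trajectory_solves[OF 2 c, rotated -1]) (use ab that in auto)
    show "\<gamma>\<^sub>2 s = ?\<gamma> s" if "s \<in> {a'..b'}" for s
      by (rule eq2[symmetric]) (use that \<open>m \<le> a'\<close> in auto)
    show "u\<^sub>2 s = ?u s" if "s \<in> {a'..b'}" "s \<noteq> m" for s
      using that \<open>m \<le> a'\<close> by auto
  qed
  consider "b \<le> m" | "m \<le> a" | "a \<le> m" "m \<le> b" by linarith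
  then show "solves c ?u ?\<gamma> a b"
  proof cases
    case 3
    then show ?thesis using solves_join[OF s1 s2] by auto
  qed (use s1 s2 ab in auto)
qed

text \<open>The equation is solved in the given chart and the solution is carried to the manifold by
  the inverse chart. In any other chart the chain rule gives its derivative, and
  \<open>spray_change\<close> identifies this with the field of that chart, since the force is a
  tangent vector.\<close>

lemma trajectory_constant_control:
  assumes U: "openin (manifold_topology TA) U" "x\<^sub>0 \<in> U" and c: "c \<in> A" "x\<^sub>0 \<in> chart_dom (tc c)"
  obtains h0 where "h0 > 0" "\<And>t h. 0 \<le> h \<Longrightarrow> h \<le> h0 \<Longrightarrow> \<exists>\<gamma>. trajectory A G W f t (t+h) x\<^sub>0 (\<lambda>_. u) \<gamma> \<and>
     \<gamma> ` {t..t+h} \<subseteq> U \<inter> chart_dom (tc c) \<and>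
     (\<forall>s\<in>{t..t+h}. ((\<lambda>s. chart_map (tc c) (\<gamma> s)) has_vector_derivative fld c (chart_map (tc c) (\<gamma> s)) u) (at s within {t..t+h}))"
proof -
  define N where "N = chart_map (tc c) ` (U \<inter> chart_dom (tc c))"
  let ?z = "chart_map (tc c) x\<^sub>0"
  have N: "open N" "?z \<in> N" "N \<subseteq> chart_image (tc c)"
    unfolding N_def using T.open_chart_image_Int[OF U(1) tc_atlas[OF c(1)]] U c by (auto simp: chart_image_def)
  have Ninv: "chart_inv (tc c) w \<in> U \<inter> chart_dom (tc c)" if "w \<in> N" for w
    using that T.chart_inv_map[OF tc_atlas[OF c(1)]] unfolding N_def by force
  obtain h0 where h0: "h0 > 0" "\<And>t h. 0 \<le> h \<Longrightarrow> h \<le> h0 \<Longrightarrow> \<exists>\<phi>. \<phi> t = ?z \<and> \<phi> ` {t..t+h} \<subseteq> N \<and>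
     continuous_on {t..t+h} \<phi> \<and> (\<forall>s\<in>{t..t+h}. (\<phi> has_vector_derivative fld c (\<phi> s) u) (at s within {t..t+h}))"
    using picard_local[OF fld_loclip[OF c(1), of ?z u] N(1,2)] N by blast
  have "\<exists>\<gamma>. trajectory A G W f t (t+h) x\<^sub>0 (\<lambda>_. u) \<gamma> \<and> \<gamma> ` {t..t+h} \<subseteq> U \<inter> chart_dom (tc c) \<and>
     (\<forall>s\<in>{t..t+h}. ((\<lambda>s. chart_map (tc c) (\<gamma> s)) has_vector_derivative fld c (chart_map (tc c) (\<gamma> s)) u) (at s within {t..t+h}))"
    if h: "0 \<le> h" "h \<le> h0" for t h
  proof -
    obtain \<phi> where \<phi>: "\<phi> t = ?z" "\<phi> ` {t..t+h} \<subseteq> N" "continuous_on {t..t+h} \<phi>"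
      "\<And>s. s \<in> {t..t+h} \<Longrightarrow> (\<phi> has_vector_derivative fld c (\<phi> s) u) (at s within {t..t+h})"
      using h0(2)[OF h] by blast
    define \<gamma> where "\<gamma> s = chart_inv (tc c) (\<phi> s)" for s
    have \<gamma>: "\<gamma> s \<in> U \<inter> chart_dom (tc c)" "chart_map (tc c) (\<gamma> s) = \<phi> s" if "s \<in> {t..t+h}" for s
    proof -
      have "\<phi> s \<in> N" using \<phi>(2) that by blast
      then show "\<gamma> s \<in> U \<inter> chart_dom (tc c)" unfolding \<gamma>_def by (rule Ninv)
      have "\<phi> s \<in> chart_image (tc c)" using \<open>\<phi> s \<in> N\<close> N(3) by blast
      then show "chart_map (tc c) (\<gamma> s) = \<phi> s" unfolding \<gamma>_def by (rule T.chart_map_inv)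
    qed
    have solves: "solves c' (\<lambda>_. u) \<gamma> a b"
      if c': "c' \<in> A" and ab: "t \<le> a" "a \<le> b" "b \<le> t + h" "\<gamma> ` {a..b} \<subseteq> chart_dom (tc c')" for c' a b
    proof -
      let ?E = "\<lambda>s. fld c' (chart_map (tc c') (\<gamma> s)) u"
      have der: "((\<lambda>s. chart_map (tc c') (\<gamma> s)) has_vector_derivative ?E s) (at s within {a..b})"
        if s: "s \<in> {a..b}" for s
      proof -
        have sd: "\<gamma> r \<in> chart_dom (tc c)" "\<gamma> r \<in> chart_dom (tc c')" "chart_map (tc c) (\<gamma> r) = \<phi> r" if "r \<in> {a..b}" for r
          using that ab \<gamma>[of r] by auto
        have "(\<phi> has_vector_derivative fld c (\<phi> s) u) (at s within {a..b})"
          using \<phi>(4)[of s] s ab by (auto intro: has_vector_derivative_within_subset)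
        moreover have "(transition (tc c) (tc c') has_derivative T.dtrans (tc c) (tc c') (\<gamma> s)) (at (\<phi> s) within \<phi> ` {a..b})"
          using T.dtrans_has_derivative[OF tc_atlas[OF c(1)] tc_atlas[OF c'] sd(1,2)[OF s]] sd(3)[OF s]
          by (auto intro: has_derivative_at_withinI)
        ultimately have "((transition (tc c) (tc c') \<circ> \<phi>) has_vector_derivative T.dtrans (tc c) (tc c') (\<gamma> s) (fld c (\<phi> s) u)) (at s within {a..b})"
          by (rule vector_derivative_diff_chain_within)
        moreover have "T.dtrans (tc c) (tc c') (\<gamma> s) (fld c (\<phi> s) u) = ?E s"
        proof -
          have "fst (\<gamma> s) \<in> points A" using sd(1)[OF s] c tc_dom unfolding points_def by blast
          from spray_change[OF c(1) c' sd(1,2)[OF s] force_tangent[OF this]]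
          show ?thesis
            unfolding sd(3)[OF s, symmetric] fld_spray[OF c(1) sd(1)[OF s]] fld_spray[OF c' sd(2)[OF s]] .
        qed
        ultimately show ?thesis
        proof (intro has_vector_derivative_transform[OF s, of "\<lambda>s. chart_map (tc c') (\<gamma> s)" "transition (tc c) (tc c') \<circ> \<phi>"])
          fix r assume r: "r \<in> {a..b}"
          show "chart_map (tc c') (\<gamma> r) = (transition (tc c) (tc c') \<circ> \<phi>) r"
            using T.transition_map[OF tc_atlas[OF c(1)] sd(1)[OF r]] sd(3)[OF r] by simp
        qed simp
      qed
      have "continuous_on {a..b} (\<lambda>s. chart_map (tc c') (\<gamma> s))"
        using der has_vector_derivative_continuous continuous_on_eq_continuous_within by blast
      then have "continuous_on {a..b} ?E"
        by (rule continuous_on_compose2[OF fld_continuous[OF c']]) (use ab in \<open>auto simp: chart_image_def\<close>)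
      then have "has_ac_derivative (\<lambda>s. chart_map (tc c') (\<gamma> s)) ?E a b"
        using der by (rule has_ac_derivative_vector_derivative[rotated])
      then show ?thesis unfolding solves_def by blast
    qed
    have "continuous_map (top_of_set {t..t+h}) (manifold_topology TA) \<gamma>"
      unfolding \<gamma>_def by (rule T.continuous_map_chart_inv[OF tc_atlas[OF c(1)] \<phi>(3)]) (use \<phi>(2) N(3) in blast)
    moreover have "\<gamma> t = x\<^sub>0" unfolding \<gamma>_def \<phi>(1) by (rule T.chart_inv_map[OF tc_atlas[OF c(1)] c(2)])
    ultimately have "trajectory A G W f t (t+h) x\<^sub>0 (\<lambda>_. u) \<gamma>"
      unfolding trajectory_iff using solves by blast
    moreover have "((\<lambda>s. chart_map (tc c) (\<gamma> s)) has_vector_derivative fld c (chart_map (tc c) (\<gamma> s)) u) (at s within {t..t+h})"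
      if s: "s \<in> {t..t+h}" for s
      unfolding \<gamma>(2)[OF s]
      by (rule has_vector_derivative_transform[OF s _ \<phi>(4)[OF s]]) (use \<gamma> in auto)
    ultimately show ?thesis using \<gamma>(1) by blast
  qed
  then show ?thesis using that h0(1) by blast
qed

end

section \<open>Integrals of functions that are not known to be measurable\<close>

text \<open>The integral is a supremum over simple functions below the integrand, and a sum of
  simple minorants of \<open>f\<close> and \<open>h\<close> is a simple minorant of the sum.\<close>

lemma nn_integral_superadditive:
  "integral\<^sup>N M f + integral\<^sup>N M h \<le> integral\<^sup>N M (\<lambda>x. f x + h x)"
proof -
  have ne: "{g. simple_function M g \<and> g \<le> k} \<noteq> {}" for k :: "'a \<Rightarrow> ennreal"
  proof -
    have "(\<lambda>_. 0) \<in> {g. simple_function M g \<and> g \<le> k}" by (simp add: le_fun_def)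
    then show ?thesis by blast
  qed
  have "integral\<^sup>S M g + integral\<^sup>N M h \<le> integral\<^sup>N M (\<lambda>x. f x + h x)"
    if g: "simple_function M g" "g \<le> f" for g
  proof -
    have "integral\<^sup>S M g + integral\<^sup>S M k \<le> integral\<^sup>N M (\<lambda>x. f x + h x)"
      if k: "simple_function M k" "k \<le> h" for k
    proof -
      have "integral\<^sup>S M g + integral\<^sup>S M k = (\<integral>\<^sup>+x. g x + k x \<partial>M)"
        using g k by (simp add: nn_integral_eq_simple_integral[symmetric] nn_integral_add borel_measurable_simple_function)
      also have "\<dots> \<le> integral\<^sup>N M (\<lambda>x. f x + h x)"
        using g k by (intro nn_integral_mono add_mono) (auto simp: le_fun_def)
      finally show ?thesis .
    qed
    then have "(SUP k\<in>{k. simple_function M k \<and> k \<le> h}. integral\<^sup>S M g + integral\<^sup>S M k) \<le> integral\<^sup>N M (\<lambda>x. f x + h x)"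
      by (intro SUP_least) auto
    then show ?thesis
      unfolding nn_integral_def[of M h] using ne by (simp add: ennreal_SUP_add_right)
  qed
  then have "(SUP g\<in>{g. simple_function M g \<and> g \<le> f}. integral\<^sup>S M g + integral\<^sup>N M h) \<le> integral\<^sup>N M (\<lambda>x. f x + h x)"
    by (intro SUP_least) auto
  then show ?thesis
    unfolding nn_integral_def[of M f] using ne by (simp add: ennreal_SUP_add_left)
qed

text \<open>Subadditivity may fail for arbitrary integrands, but not for a cut along a measurable
  set: each simple minorant is cut along the same set, and there additivity is available.\<close>

lemma nn_integral_split_le:
  assumes S: "S \<in> sets M"
  shows "integral\<^sup>N M f \<le> (\<integral>\<^sup>+x. f x * indicator S x \<partial>M) + (\<integral>\<^sup>+x. f x * indicator (-S) x \<partial>M)"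
  unfolding nn_integral_def[of M f]
proof (rule SUP_least)
  fix g assume "g \<in> {g. simple_function M g \<and> g \<le> f}"
  then have g: "simple_function M g" "\<And>x. g x \<le> f x" by (auto simp: le_fun_def)
  have S': "{x \<in> space M. x \<in> - S} \<in> sets M"
    using sets.compl_sets[OF S] by (simp add: set_diff_eq)
  have m: "(\<lambda>x. g x * indicator S x) \<in> borel_measurable M" "(\<lambda>x. g x * indicator (-S) x) \<in> borel_measurable M"
    using borel_measurable_simple_function[OF g(1)] S S' by measurable
  have "integral\<^sup>S M g = (\<integral>\<^sup>+x. g x * indicator S x + g x * indicator (-S) x \<partial>M)"
    using g(1) by (auto simp: nn_integral_eq_simple_integral[symmetric] indicator_def intro!: nn_integral_cong)
  also have "\<dots> = (\<integral>\<^sup>+x. g x * indicator S x \<partial>M) + (\<integral>\<^sup>+x. g x * indicator (-S) x \<partial>M)"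
    by (rule nn_integral_add[OF m])
  also have "\<dots> \<le> (\<integral>\<^sup>+x. f x * indicator S x \<partial>M) + (\<integral>\<^sup>+x. f x * indicator (-S) x \<partial>M)"
    using g(2) by (intro add_mono nn_integral_mono mult_right_mono) auto
  finally show "integral\<^sup>S M g \<le> (\<integral>\<^sup>+x. f x * indicator S x \<partial>M) + (\<integral>\<^sup>+x. f x * indicator (-S) x \<partial>M)" .
qed

text \<open>The two preceding inequalities applied to the cut into [a,m] and (m,b]; adding
  \<open>m\<close> to the second piece changes nothing. It is the additivity of costs in
  time.\<close>

lemma nn_integral_interval_split:
  fixes f :: "real \<Rightarrow> ennreal"
  assumes m: "a \<le> m" "m \<le> b"
  shows "(\<integral>\<^sup>+s. f s \<partial>lebesgue_on {a..b}) = (\<integral>\<^sup>+s. f s \<partial>lebesgue_on {a..m}) + (\<integral>\<^sup>+s. f s \<partial>lebesgue_on {m..b})"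
proof -
  let ?I = "\<lambda>S. \<integral>\<^sup>+s. f s * indicator S s \<partial>lebesgue"
  have restrict: "(\<integral>\<^sup>+s. f s \<partial>lebesgue_on S) = ?I S" if "S \<in> sets lebesgue" for S
    using that by (simp add: nn_integral_restrict_space)
  have tail: "?I {m<..b} = ?I {m..b}"
  proof (rule nn_integral_cong_AE)
    show "AE s in lebesgue. f s * indicator {m<..b} s = f s * indicator {m..b} s"
      using AE_lebesgue_neq[of m] by eventually_elim (auto simp: indicator_def)
  qed
  have "?I {a..b} \<le> (\<integral>\<^sup>+s. f s * indicator {a..b} s * indicator {a..m} s \<partial>lebesgue)
      + (\<integral>\<^sup>+s. f s * indicator {a..b} s * indicator (-{a..m}) s \<partial>lebesgue)"
    by (rule nn_integral_split_le) auto
  also have "(\<integral>\<^sup>+s. f s * indicator {a..b} s * indicator {a..m} s \<partial>lebesgue) = ?I {a..m}"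
    using m by (intro nn_integral_cong) (auto simp: indicator_def)
  also have "(\<integral>\<^sup>+s. f s * indicator {a..b} s * indicator (-{a..m}) s \<partial>lebesgue) = ?I {m<..b}"
    using m by (intro nn_integral_cong) (auto simp: indicator_def)
  finally have "?I {a..b} \<le> ?I {a..m} + ?I {m<..b}" .
  moreover have "?I {a..m} + ?I {m<..b} \<le> ?I {a..b}"
  proof -
    have "?I {a..m} + ?I {m<..b} \<le> (\<integral>\<^sup>+s. f s * indicator {a..m} s + f s * indicator {m<..b} s \<partial>lebesgue)"
      by (rule nn_integral_superadditive)
    also have "\<dots> = ?I {a..b}"
      using m by (intro nn_integral_cong) (auto simp: indicator_def)
    finally show ?thesis .
  qed
  ultimately show ?thesis using tail by (simp add: restrict)
qed

text \<open>The minorant may change sign, so the comparison passes through its positive part. Of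
  \<open>g\<close> only monotonicity of the nonnegative integral is used, which asks for no
  measurability.\<close>

lemma integral_le_nn_integral:
  assumes "integrable M f" "AE x in M. f x \<le> g x"
  shows "ereal (integral\<^sup>L M f) \<le> enn2ereal (\<integral>\<^sup>+x. ennreal (g x) \<partial>M)"
proof -
  have int: "integrable M (\<lambda>x. max 0 (f x))" using assms(1) by auto
  have "ennreal (integral\<^sup>L M f) \<le> ennreal (integral\<^sup>L M (\<lambda>x. max 0 (f x)))"
    using assms(1) int by (intro ennreal_leI integral_mono) auto
  also have "\<dots> = (\<integral>\<^sup>+x. ennreal (max 0 (f x)) \<partial>M)"
    by (rule nn_integral_eq_integral[OF int, symmetric]) auto
  also have "\<dots> \<le> (\<integral>\<^sup>+x. ennreal (g x) \<partial>M)"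
    by (rule nn_integral_mono_AE) (use assms(2) in \<open>eventually_elim, auto simp: max_def intro: ennreal_leI\<close>)
  finally have "ennreal (integral\<^sup>L M f) \<le> (\<integral>\<^sup>+x. ennreal (g x) \<partial>M)" .
  then have "enn2ereal (ennreal (integral\<^sup>L M f)) \<le> enn2ereal (\<integral>\<^sup>+x. ennreal (g x) \<partial>M)"
    by (simp add: less_eq_ennreal.rep_eq)
  moreover have "ereal (integral\<^sup>L M f) \<le> enn2ereal (ennreal (integral\<^sup>L M f))"
    by (simp add: ennreal.rep_eq)
  ultimately show ?thesis by (rule order_trans[rotated])
qed

section \<open>Coercivity and localization\<close>

text \<open>If the Hamiltonian integrand is bounded below by a positive constant at one point, it is so
  nearby, uniformly in the control: on bounded sets of controls by compactness, for large controls
  by coercivity.  The error term \<open>\<epsilon> (1 + |F|)\<close> absorbs the remainder of a first order expansion.\<close>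

lemma hamiltonian_margin:
  fixes F :: "'z::euclidean_space \<Rightarrow> 'u::euclidean_space \<Rightarrow> 'z" and \<Lambda> :: "real \<Rightarrow> 'z \<Rightarrow> 'u \<Rightarrow> real"
  assumes t: "t \<in> {0..T}" and S: "open S" "z\<^sub>0 \<in> S"
    and F: "continuous_on (S \<times> UNIV) (\<lambda>w. F (fst w) (snd w))"
    and \<Lambda>: "continuous_on ({0..T} \<times> S \<times> UNIV) (\<lambda>(s, z, u). \<Lambda> s z u)"
    and coercive: "\<And>s z u. s \<in> {0..T} \<Longrightarrow> z \<in> S \<Longrightarrow> \<Lambda> s z u \<ge> \<beta> * (norm u)\<^sup>2" "\<beta> > 0"
    and C: "r\<^sub>0 > 0" "C > 0" "\<And>z u. z \<in> ball z\<^sub>0 r\<^sub>0 \<Longrightarrow> norm (F z u) \<le> C * (1 + norm u)"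
    and l: "bounded_linear l"
    and m: "m > 0" "\<And>u. u \<in> \<Omega> \<Longrightarrow> m \<le> a + l (F z\<^sub>0 u) + \<Lambda> t z\<^sub>0 u"
  obtains \<epsilon> \<eta> \<delta> :: real where "\<epsilon> > 0" "\<eta> > 0" "\<delta> > 0" "cball z\<^sub>0 \<delta> \<subseteq> S"
    "\<And>s z u. s \<in> {0..T} \<Longrightarrow> \<bar>s - t\<bar> \<le> \<delta> \<Longrightarrow> z \<in> cball z\<^sub>0 \<delta> \<Longrightarrow> u \<in> \<Omega> \<Longrightarrow>
       \<eta> + \<epsilon> * (1 + norm (F z u)) \<le> a + l (F z u) + \<Lambda> s z u"
proof -
  obtain B where B: "B > 0" "\<And>v. norm (l v) \<le> norm v * B"
    using bounded_linear.pos_bounded[OF l] by blast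
  obtain d where d: "d > 0" "cball z\<^sub>0 d \<subseteq> S" using S by (auto simp: open_contains_cball)
  define \<delta>\<^sub>0 where "\<delta>\<^sub>0 = min d (r\<^sub>0 / 2)"
  have \<delta>\<^sub>0: "\<delta>\<^sub>0 > 0" "cball z\<^sub>0 \<delta>\<^sub>0 \<subseteq> S" "cball z\<^sub>0 \<delta>\<^sub>0 \<subseteq> ball z\<^sub>0 r\<^sub>0"
    using d C by (auto simp: \<delta>\<^sub>0_def)
  \<comment> \<open>\<open>q (1 + |u|)\<close> dominates |l F| + |F|, by the bound \<open>B\<close>
    of \<open>l\<close> and the growth constant \<open>C\<close>.\<close>
  define q where "q = (B + 1) * C"
  \<comment> \<open>For |u| \<ge> R this gives \<beta> |u| \<ge> 2 q + |a| + 2, and with |u| \<ge> 1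
    the term \<beta> |u|^2 exceeds \<open>q (1 + |u|) + |a| + 2\<close>. The 2 provides the margin
    for large controls.\<close>
  define R where "R = 1 + (2 * q + \<bar>a\<bar> + 2) / \<beta>"
  have q: "q > 0" using B C by (simp add: q_def)
  have R: "R \<ge> 1" using q coercive(2) by (simp add: R_def)
  have large: "1 + 1 * (1 + norm (F z u)) \<le> a + l (F z u) + \<Lambda> s z u"
    if s: "s \<in> {0..T}" "z \<in> cball z\<^sub>0 \<delta>\<^sub>0" and u: "R \<le> norm u" for s z u
  proof -
    let ?n = "norm u"
    have n: "?n \<ge> 1" using u R by linarith
    have "\<beta> * R = \<beta> + (2 * q + \<bar>a\<bar> + 2)" using coercive(2) by (simp add: R_def field_simps)
    moreover have "\<beta> * R \<le> \<beta> * ?n" using u coercive(2) by (intro mult_left_mono) auto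
    ultimately have "2 * q + (\<bar>a\<bar> + 2) \<le> \<beta> * ?n" using coercive(2) by linarith
    then have "(2 * q + (\<bar>a\<bar> + 2)) * ?n \<le> \<beta> * ?n * ?n" using n by (intro mult_right_mono) auto
    moreover have "(\<bar>a\<bar> + 2) * 1 \<le> (\<bar>a\<bar> + 2) * ?n" "q * 1 \<le> q * ?n" using n q by (intro mult_left_mono; simp)+
    ultimately have 1: "q * (1 + ?n) + \<bar>a\<bar> + 2 \<le> \<beta> * ?n\<^sup>2"
      by (simp add: power2_eq_square algebra_simps)
    have F: "norm (F z u) \<le> C * (1 + ?n)" using C(3) \<delta>\<^sub>0(3) s(2) by blast
    have "\<bar>l (F z u)\<bar> + norm (F z u) \<le> (B + 1) * norm (F z u)"
      using B(2)[of "F z u"] by (simp add: algebra_simps)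
    also have "\<dots> \<le> (B + 1) * (C * (1 + ?n))" using F B by (intro mult_left_mono) auto
    also have "\<dots> = q * (1 + ?n)" by (simp add: q_def)
    finally have "\<bar>l (F z u)\<bar> + norm (F z u) \<le> q * (1 + ?n)" .
    moreover have "\<Lambda> s z u \<ge> \<beta> * ?n\<^sup>2" using s \<delta>\<^sub>0(2) by (intro coercive(1)) auto
    ultimately have "\<Lambda> s z u \<ge> \<bar>l (F z u)\<bar> + norm (F z u) + \<bar>a\<bar> + 2" using 1 by linarith
    moreover have "1 + 1 * (1 + k) \<le> y + x + w" if "\<bar>x\<bar> + k + \<bar>y\<bar> + 2 \<le> w" for k w x y :: real
      using that abs_ge_minus_self[of x] abs_ge_minus_self[of y] by (simp add: algebra_simps)
    ultimately show ?thesis by blast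
  qed
  let ?\<Psi> = "\<lambda>(s, z, u). a + l (F z u) + \<Lambda> s z u"
  let ?Q = "{0..T} \<times> cball z\<^sub>0 \<delta>\<^sub>0 \<times> cball (0::'u) R"
  have "continuous_on ?Q (\<lambda>w. a + l (F (fst (snd w)) (snd (snd w))) + (\<lambda>(s, z, u). \<Lambda> s z u) w)"
  proof (intro continuous_intros)
    have "continuous_on ?Q (\<lambda>w. F (fst (snd w)) (snd (snd w)))"
      by (rule continuous_on_compose2[OF F, of _ snd, simplified]) (use \<delta>\<^sub>0(2) in \<open>auto intro!: continuous_intros\<close>)
    then show "continuous_on ?Q (\<lambda>w. l (F (fst (snd w)) (snd (snd w))))"
      by (rule bounded_linear.continuous_on[OF l])
    show "continuous_on ?Q (\<lambda>(s, z, u). \<Lambda> s z u)"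
      by (rule continuous_on_subset[OF \<Lambda>]) (use \<delta>\<^sub>0(2) in auto)
  qed
  then have "continuous_on ?Q ?\<Psi>" by (simp add: case_prod_unfold)
  moreover have "compact ?Q" by (intro compact_Times compact_Icc compact_cball)
  ultimately have "uniformly_continuous_on ?Q ?\<Psi>" by (rule compact_uniformly_continuous)
  moreover have "m / 4 > 0" using m(1) by simp
  ultimately obtain e where e: "e > 0"
    "\<And>w w'. w \<in> ?Q \<Longrightarrow> w' \<in> ?Q \<Longrightarrow> dist w' w < e \<Longrightarrow> dist (?\<Psi> w') (?\<Psi> w) < m / 4"
    unfolding uniformly_continuous_on_def by blast
  \<comment> \<open>For |u| < R the margin \<open>m\<close> is shared out: less than a quarter is
    lost by moving the point, where time and space together move by at most 2 \<delta> < e; at most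
    a quarter goes to \<epsilon> (1 + |F|), as \<open>K\<close> bounds 1 + |F|; and \<eta> is at
    most another quarter.\<close>
  define \<delta> where "\<delta> = min \<delta>\<^sub>0 (e / 3)"
  define K where "K = 1 + C * (1 + R)"
  define \<epsilon> where "\<epsilon> = min 1 (m / (4 * K))"
  define \<eta> where "\<eta> = min 1 (m / 4)"
  have K: "K > 0" using C R by (simp add: K_def add_pos_nonneg)
  have pos: "\<epsilon> > 0" "\<eta> > 0" "\<delta> > 0" using K m \<delta>\<^sub>0 e by (auto simp: \<epsilon>_def \<eta>_def \<delta>_def)
  have "\<eta> + \<epsilon> * (1 + norm (F z u)) \<le> a + l (F z u) + \<Lambda> s z u"
    if s: "s \<in> {0..T}" "\<bar>s - t\<bar> \<le> \<delta>" "z \<in> cball z\<^sub>0 \<delta>" and u: "u \<in> \<Omega>" for s z u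
  proof (cases "R \<le> norm u")
    case True
    have "z \<in> cball z\<^sub>0 \<delta>\<^sub>0" using s(3) by (auto simp: \<delta>_def)
    note large[OF s(1) this True]
    moreover have "\<epsilon> * (1 + norm (F z u)) \<le> 1 * (1 + norm (F z u))"
      by (intro mult_right_mono) (auto simp: \<epsilon>_def)
    ultimately show ?thesis by (simp add: \<eta>_def)
  next
    case False
    have "dist (s, z, u) (t, z\<^sub>0, u) \<le> dist s t + dist (z, u) (z\<^sub>0, u)"
      by (simp add: dist_Pair_Pair sqrt_sum_squares_le_sum)
    also have "dist (z, u) (z\<^sub>0, u) = dist z z\<^sub>0" by (simp add: dist_Pair_Pair)
    also have "dist s t + dist z z\<^sub>0 \<le> 2 * \<delta>" using s by (simp add: dist_real_def dist_commute)
    also have "\<dots> < e" using e(1) by (simp add: \<delta>_def min_def)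
    finally have "dist (s, z, u) (t, z\<^sub>0, u) < e" .
    then have "dist (?\<Psi> (s, z, u)) (?\<Psi> (t, z\<^sub>0, u)) < m / 4"
      using s t False \<delta>\<^sub>0(1) by (intro e(2)) (auto simp: \<delta>_def)
    then have "a + l (F z\<^sub>0 u) + \<Lambda> t z\<^sub>0 u - m / 4 < a + l (F z u) + \<Lambda> s z u"
      by (simp only: dist_real_def abs_diff_less_iff prod.case)
    then have 1: "m - m / 4 \<le> a + l (F z u) + \<Lambda> s z u"
      using m(2)[OF u] by linarith
    have "z \<in> ball z\<^sub>0 r\<^sub>0" using s(3) \<delta>\<^sub>0(3) by (auto simp: \<delta>_def)
    then have "norm (F z u) \<le> C * (1 + norm u)" by (rule C(3))
    also have "\<dots> \<le> C * (1 + R)" using False C(2) by (intro mult_left_mono) auto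
    finally have "\<epsilon> * (1 + norm (F z u)) \<le> m / (4 * K) * K"
      using K m by (intro mult_mono) (auto simp: \<epsilon>_def K_def)
    also have "\<dots> = m / 4" using K by simp
    finally show ?thesis using 1 m(1) by (simp add: \<eta>_def min_def)
  qed
  moreover have "cball z\<^sub>0 \<delta> \<subseteq> S" using \<delta>\<^sub>0(2) by (auto simp: \<delta>_def)
  ultimately show ?thesis using that pos by blast
qed

section \<open>Compact coordinate balls and the continuation of curves\<close>

context differentiable_atlas
begin

lemma continuous_map_smooth_function:
  assumes F: "smooth_function A F"
  shows "continuous_map (manifold_topology A) euclideanreal F"
  unfolding continuous_map
proof (intro conjI allI impI)
  fix U :: "real set" assume "openin euclideanreal U"
  then have U: "open U" by simp
  have "open (chart_map c ` ({p \<in> points A. F p \<in> U} \<inter> chart_dom c))" if c: "c \<in> A" for c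
  proof -
    have "chart_map c ` ({p \<in> points A. F p \<in> U} \<inter> chart_dom c) = (F \<circ> chart_inv c) -` U \<inter> chart_image c"
    proof (intro set_eqI iffI)
      fix z assume "z \<in> chart_map c ` ({p \<in> points A. F p \<in> U} \<inter> chart_dom c)"
      then obtain p where "p \<in> chart_dom c" "F p \<in> U" "z = chart_map c p" by blast
      then show "z \<in> (F \<circ> chart_inv c) -` U \<inter> chart_image c"
        using chart_inv_map[OF c] chart_map_image by simp
    next
      fix z assume z: "z \<in> (F \<circ> chart_inv c) -` U \<inter> chart_image c"
      then have "chart_inv c z \<in> chart_dom c" "chart_map c (chart_inv c z) = z" "F (chart_inv c z) \<in> U"
        using chart_inv_dom[of z c] chart_map_inv[of z c] by auto
      moreover from this(1) have "chart_inv c z \<in> points A" using c unfolding points_def by blast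
      ultimately show "z \<in> chart_map c ` ({p \<in> points A. F p \<in> U} \<inter> chart_dom c)" by force
    qed
    moreover have "continuous_on (chart_image c) (F \<circ> chart_inv c)"
      using F c class_C_on_continuous unfolding smooth_function_def by blast
    ultimately show ?thesis using iffD1[OF continuous_on_open_vimage[OF open_image[OF c]]] U by metis
  qed
  then show "openin (manifold_topology A) {p \<in> topspace (manifold_topology A). F p \<in> U}"
    unfolding topspace_manifold openin_topology by blast
qed simp

lemma compactin_chart_inv:
  assumes c: "c \<in> A" and Q: "compact Q" "Q \<subseteq> chart_image c"
  shows "compactin (manifold_topology A) (chart_inv c ` Q)"
proof -
  have "compactin (top_of_set Q) Q" using Q(1) by (simp add: compactin_subtopology)
  moreover have "continuous_map (top_of_set Q) (manifold_topology A) (\<lambda>s. chart_inv c s)"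
    by (rule continuous_map_chart_inv[OF c]) (use Q in auto)
  ultimately show ?thesis by (rule image_compactin)
qed

text \<open>Hausdorffness excludes a jump out of the chart.\<close>

lemma curve_stays_in_ball:
  fixes \<gamma> :: "real \<Rightarrow> 'a" and t T :: real
  assumes H: "Hausdorff_space (manifold_topology A)"
    and \<gamma>: "continuous_map (top_of_set {t..T}) (manifold_topology A) \<gamma>"
    and c: "c \<in> A" and sub: "cball z\<^sub>0 \<rho> \<subseteq> chart_image c" and start: "\<gamma> t \<in> chart_inv c ` cball z\<^sub>0 \<rho>"
    and step: "\<And>s. s \<in> {t..T} \<Longrightarrow> \<gamma> ` {t..s} \<subseteq> chart_inv c ` cball z\<^sub>0 \<rho> \<Longrightarrow> chart_map c (\<gamma> s) \<in> ball z\<^sub>0 \<rho>"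
  shows "\<gamma> ` {t..T} \<subseteq> chart_inv c ` cball z\<^sub>0 \<rho>"
proof (rule ccontr)
  let ?B = "chart_inv c ` cball z\<^sub>0 \<rho>"
  define Q where "Q = {s \<in> {t..T}. \<gamma> s \<notin> ?B}"
  assume "\<not> \<gamma> ` {t..T} \<subseteq> ?B"
  then have Q: "Q \<noteq> {}" "bdd_below Q" unfolding Q_def by (blast, auto intro!: bdd_belowI)
  \<comment> \<open>The infimum of the times at which the curve is outside the ball. Since the ball
    is closed in the manifold, the curve is still in it at \<tau>. The step hypothesis then puts it
    into the open ball, so it remains inside a little longer, against the choice of \<tau>.\<close>
  define \<tau> where "\<tau> = Inf Q"
  have \<tau>: "t \<le> \<tau>" "\<tau> \<le> T"
    using Q cInf_greatest[OF Q(1), of t] cInf_lower[OF _ Q(2)] unfolding \<tau>_def Q_def by fastforce+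
  have before: "\<gamma> s \<in> ?B" if "s \<in> {t..<\<tau>}" for s
    using cInf_lower[OF _ Q(2), of s] that \<tau> unfolding \<tau>_def Q_def by force
  have "closedin (manifold_topology A) ?B"
    by (rule compactin_imp_closedin[OF H compactin_chart_inv[OF c compact_cball sub]])
  from closedin_continuous_map_preimage[OF \<gamma> this]
  have "closedin (top_of_set {t..T}) {s \<in> {t..T}. \<gamma> s \<in> ?B}" by simp
  then have cl: "closed {s \<in> {t..T}. \<gamma> s \<in> ?B}" by (rule closedin_closed_trans) simp
  have \<tau>B: "\<gamma> \<tau> \<in> ?B"
  proof (cases "t = \<tau>")
    case False
    then have "t < \<tau>" using \<tau> by simp
    have "{t..<\<tau>} \<subseteq> {s \<in> {t..T}. \<gamma> s \<in> ?B}" using before \<tau> by auto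
    then have "closure {t..<\<tau>} \<subseteq> {s \<in> {t..T}. \<gamma> s \<in> ?B}" using cl by (rule closure_minimal)
    moreover have "\<tau> \<in> closure {t..<\<tau>}" using \<open>t < \<tau>\<close> by simp
    ultimately show ?thesis by blast
  qed (use start in simp)
  have "\<gamma> s \<in> ?B" if "s \<in> {t..\<tau>}" for s
    using before[of s] \<tau>B that by (cases "s = \<tau>") auto
  then have "chart_map c (\<gamma> \<tau>) \<in> ball z\<^sub>0 \<rho>" using \<tau> by (intro step) auto
  moreover have "\<gamma> \<tau> \<in> chart_dom c"
  proof -
    obtain z where "z \<in> cball z\<^sub>0 \<rho>" "\<gamma> \<tau> = chart_inv c z" using \<tau>B by blast
    then show ?thesis using chart_inv_dom[of z c] sub by auto
  qed
  ultimately have "\<tau> \<in> {s \<in> {t..T}. \<gamma> s \<in> {p \<in> chart_dom c. chart_map c p \<in> ball z\<^sub>0 \<rho>}}"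
    using \<tau> by simp
  moreover have "openin (top_of_set {t..T}) {s \<in> {t..T}. \<gamma> s \<in> {p \<in> chart_dom c. chart_map c p \<in> ball z\<^sub>0 \<rho>}}"
    using openin_continuous_map_preimage[OF \<gamma> openin_chart_preimage[OF c open_ball]] by simp
  ultimately obtain e where e: "e > 0" "\<And>s. s \<in> {t..T} \<Longrightarrow> dist s \<tau> < e \<Longrightarrow>
      \<gamma> s \<in> chart_dom c \<and> chart_map c (\<gamma> s) \<in> ball z\<^sub>0 \<rho>"
    unfolding openin_euclidean_subtopology_iff by blast
  obtain s where s: "s \<in> Q" "s < \<tau> + e"
    using cInf_lessD[OF Q(1), of "\<tau> + e"] e(1) unfolding \<tau>_def by auto
  have "\<tau> \<le> s" using cInf_lower[OF s(1) Q(2)] unfolding \<tau>_def .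
  then have "\<gamma> s \<in> chart_dom c" "chart_map c (\<gamma> s) \<in> ball z\<^sub>0 \<rho>"
    using e(2)[of s] s unfolding Q_def by (auto simp: dist_real_def)
  then have "\<gamma> s \<in> ?B" using chart_inv_map[OF c] by (intro image_eqI[of _ _ "chart_map c (\<gamma> s)"]) auto
  then show False using s(1) unfolding Q_def by blast
qed

end

section \<open>Dynamic programming\<close>

text \<open>The value is infinite off the compact set \<open>K\<close>, so finiteness and regularity
  are asked on an open set \<open>D\<close> of states.\<close>

locale optimal_control = control_system A G W f
  for A :: "('a, 'e::euclidean_space) atlas" and G :: "('a, 'e) metric_tensor"
    and W :: "'a \<Rightarrow> real" and f :: "'m::finite \<Rightarrow> 'a \<Rightarrow> ('a, 'e) tvec" +
  fixes \<Omega> :: "(real^'m) set" and K D :: "('a, 'e) tpoint set"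
    and L :: "real \<Rightarrow> ('a, 'e) tpoint \<Rightarrow> real^'m \<Rightarrow> real"
    and g :: "('a, 'e) tpoint \<Rightarrow> real" and T \<beta> :: real
  assumes T: "T > 0" and K: "compactin (manifold_topology TA) K"
    and L: "smooth_lagrangian A T L" and g: "smooth_function TA g"
    and \<beta>: "\<beta> > 0"
    and coercive: "\<And>t x u. t \<in> {0..T} \<Longrightarrow> x \<in> points TA \<Longrightarrow> L t x u \<ge> \<beta> * (norm u)\<^sup>2"
    and D: "openin (manifold_topology TA) D"
    and V_C1: "finite_C1_on TA T D (value_function A G W f \<Omega> K L g T)"
begin

abbreviation adm :: "real \<Rightarrow> ('a, 'e) tpoint \<Rightarrow> ((real \<Rightarrow> real^'m) \<times> (real \<Rightarrow> ('a, 'e) tpoint)) set" where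
  "adm t x \<equiv> admissible A G W f \<Omega> K t T x"

abbreviation V :: "real \<Rightarrow> ('a, 'e) tpoint \<Rightarrow> ereal" where
  "V \<equiv> value_function A G W f \<Omega> K L g T"

section \<open>Running cost and the dynamic programming inequalities\<close>

text \<open>The positive part of the integral in \<open>cost\<close>. Along admissible pairs the
  negative part is zero by coercivity, which is the content of \<open>cost_eq\<close>.\<close>

definition run :: "real \<Rightarrow> real \<Rightarrow> (real \<Rightarrow> real^'m) \<Rightarrow> (real \<Rightarrow> ('a, 'e) tpoint) \<Rightarrow> ereal" where
  "run a b u \<gamma> = enn2ereal (\<integral>\<^sup>+ s. ennreal (L s (\<gamma> s) (u s)) \<partial>lebesgue_on {a..b})"

lemma run_split:
  assumes "a \<le> m" "m \<le> b"
  shows "run a b u \<gamma> = run a m u \<gamma> + run m b u \<gamma>"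
  unfolding run_def nn_integral_interval_split[OF assms] by (simp add: plus_ennreal.rep_eq)

lemma run_cong:
  assumes "\<And>s. s \<in> {a..b} \<Longrightarrow> s \<noteq> m \<Longrightarrow> \<gamma> s = \<gamma>' s \<and> u s = u' s"
  shows "run a b u \<gamma> = run a b u' \<gamma>'"
proof -
  have "AE s in lebesgue_on {a..b}. ennreal (L s (\<gamma> s) (u s)) = ennreal (L s (\<gamma>' s) (u' s))"
    using AE_lebesgue_neq[of m] unfolding AE_lebesgue_on by eventually_elim (use assms in auto)
  then show ?thesis unfolding run_def by (simp add: nn_integral_cong_AE)
qed

lemma admD:
  assumes "(u, \<gamma>) \<in> adm t x"
  shows "u \<in> borel_measurable (lebesgue_on {t..T})" "integrable (lebesgue_on {t..T}) (\<lambda>s. (norm (u s))\<^sup>2)"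
    "AE s in lebesgue_on {t..T}. u s \<in> \<Omega>" "trajectory A G W f t T x u \<gamma>" "\<gamma> ` {t..T} \<subseteq> K"
  using assms unfolding admissible_def by auto

lemma K_points: "K \<subseteq> points TA"
  using compactin_subset_topspace[OF K] unfolding T.topspace_manifold .

lemma cost_eq:
  assumes adm: "(u, \<gamma>) \<in> adm t x" and t: "0 \<le> t"
  shows "cost L g t T u \<gamma> = run t T u \<gamma> + ereal (g (\<gamma> T))"
proof -
  have "ennreal (- L s (\<gamma> s) (u s)) = 0" if "s \<in> {t..T}" for s
  proof -
    have "\<gamma> s \<in> points TA" using admD(5)[OF adm] K_points that by blast
    then have "L s (\<gamma> s) (u s) \<ge> \<beta> * (norm (u s))\<^sup>2" using that t by (intro coercive) auto
    moreover have "\<beta> * (norm (u s))\<^sup>2 \<ge> 0" using \<beta> by simp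
    ultimately show ?thesis by (intro ennreal_neg) linarith
  qed
  then have "(\<integral>\<^sup>+ s. ennreal (- L s (\<gamma> s) (u s)) \<partial>lebesgue_on {t..T}) = (\<integral>\<^sup>+ s. 0 \<partial>lebesgue_on {t..T})"
    by (intro nn_integral_cong) simp
  then show ?thesis by (simp add: cost_def run_def zero_ennreal.rep_eq)
qed

lemma V_le_cost: "(u, \<gamma>) \<in> adm t x \<Longrightarrow> V t x \<le> cost L g t T u \<gamma>"
  unfolding value_function_def by (rule INF_lower2[of "(u, \<gamma>)"]) auto

lemma near_optimal:
  assumes "V t x < b"
  obtains u \<gamma> where "(u, \<gamma>) \<in> adm t x" "cost L g t T u \<gamma> < b"
  using assms unfolding value_function_def INF_less_iff by auto

lemma adm_subinterval:
  assumes adm: "(u, \<gamma>) \<in> adm t x" and m: "t \<le> m"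
  shows "(u, \<gamma>) \<in> adm m (\<gamma> m)"
proof -
  have sub: "{m..T} \<subseteq> {t..T}" using m by auto
  have "AE s in lebesgue_on {m..T}. u s \<in> \<Omega>"
    using admD(3)[OF adm] unfolding AE_lebesgue_on by eventually_elim (use m in auto)
  moreover have "trajectory A G W f m T (\<gamma> m) u \<gamma>"
    using trajectory_subinterval[OF admD(4)[OF adm] m order_refl] .
  moreover have "u \<in> borel_measurable (lebesgue_on {m..T})"
    using measurable_restrict_mono[OF admD(1)[OF adm] sub] .
  moreover have "integrable (lebesgue_on {m..T}) (\<lambda>s. (norm (u s))\<^sup>2)"
    using integrable_subinterval[OF admD(2)[OF adm] sub] .
  moreover have "\<gamma> ` {m..T} \<subseteq> K" using admD(5)[OF adm] sub by blast
  ultimately show ?thesis unfolding admissible_def by blast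
qed

text \<open>The remainder of an admissible pair is admissible from the state reached at time
  \<open>m\<close>, so its cost is at least the value there.\<close>

lemma dynamic_programming_lower:
  assumes adm: "(u, \<gamma>) \<in> adm t x" and m: "0 \<le> t" "t \<le> m" "m \<le> T"
  shows "run t m u \<gamma> + V m (\<gamma> m) \<le> cost L g t T u \<gamma>"
proof -
  have a: "(u, \<gamma>) \<in> adm m (\<gamma> m)" using adm_subinterval[OF adm m(2)] .
  have "V m (\<gamma> m) \<le> run m T u \<gamma> + ereal (g (\<gamma> T))"
    using V_le_cost[OF a] cost_eq[OF a] m by simp
  then have "run t m u \<gamma> + V m (\<gamma> m) \<le> run t m u \<gamma> + (run m T u \<gamma> + ereal (g (\<gamma> T)))"
    by (rule add_left_mono)
  also have "\<dots> = cost L g t T u \<gamma>"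
    unfolding cost_eq[OF adm m(1)] run_split[OF m(2,3)] by (simp add: add.assoc)
  finally show ?thesis .
qed

lemma adm_prepend:
  assumes tr: "trajectory A G W f t m x (\<lambda>_. v) \<gamma>" and v: "v \<in> \<Omega>" and inK: "\<gamma> ` {t..m} \<subseteq> K"
    and m: "t \<le> m" "m \<le> T" and adm: "(u\<^sub>2, \<gamma>\<^sub>2) \<in> adm m (\<gamma> m)"
  shows "(\<lambda>s. if s \<le> m then v else u\<^sub>2 s, \<lambda>s. if s \<le> m then \<gamma> s else \<gamma>\<^sub>2 s) \<in> adm t x" (is "(?u, ?\<gamma>) \<in> _")
proof -
  have "?u \<in> borel_measurable (lebesgue_on {t..T})"
  proof (subst measurable_If_restrict_space_iff)
    have "{s \<in> space (lebesgue_on {t..T}). s \<le> m} = {t..min m T}" by auto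
    moreover have "{t..min m T} \<in> sets (lebesgue_on {t..T})" by (auto simp: sets_restrict_space_iff)
    ultimately show "{s \<in> space (lebesgue_on {t..T}). s \<le> m} \<in> sets (lebesgue_on {t..T})" by simp
    have "restrict_space (lebesgue_on {t..T}) {s. \<not> s \<le> m} = lebesgue_on ({t..T} \<inter> {m<..})"
      by (simp add: restrict_restrict_space not_le greaterThan_def[symmetric])
    moreover have "u\<^sub>2 \<in> borel_measurable (lebesgue_on ({t..T} \<inter> {m<..}))"
      by (rule measurable_restrict_mono[OF admD(1)[OF adm]]) auto
    ultimately show "(\<lambda>_. v) \<in> borel_measurable (restrict_space (lebesgue_on {t..T}) {s. s \<le> m}) \<and>
        u\<^sub>2 \<in> borel_measurable (restrict_space (lebesgue_on {t..T}) {s. \<not> s \<le> m})"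
      by simp
  qed
  moreover have "integrable (lebesgue_on {t..T}) (\<lambda>s. (norm (?u s))\<^sup>2)"
  proof (rule integrable_combine[OF _ _ m])
    show "integrable (lebesgue_on {t..m}) (\<lambda>s. (norm (?u s))\<^sup>2)"
      by (rule integrable_lebesgue_on_spike(1)[of _ _ "\<lambda>_. (norm v)\<^sup>2" m]) auto
    show "integrable (lebesgue_on {m..T}) (\<lambda>s. (norm (?u s))\<^sup>2)"
      by (rule integrable_lebesgue_on_spike(1)[OF admD(2)[OF adm], of m]) auto
  qed
  moreover have "AE s in lebesgue_on {t..T}. ?u s \<in> \<Omega>"
    using admD(3)[OF adm] unfolding AE_lebesgue_on by eventually_elim (use v in auto)
  moreover have "trajectory A G W f t T x ?u ?\<gamma>"
    by (rule trajectory_join[OF tr admD(4)[OF adm] m])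
  moreover have "?\<gamma> ` {t..T} \<subseteq> K"
    using inK admD(5)[OF adm] by auto
  ultimately show ?thesis unfolding admissible_def by blast
qed

text \<open>An almost optimal continuation from the state reached at \<open>m\<close> is glued to
  the constant control. Finiteness of the value at that state provides the continuation and lets the
  error tend to 0.\<close>

lemma dynamic_programming_upper:
  assumes tr: "trajectory A G W f t m x (\<lambda>_. v) \<gamma>" and v: "v \<in> \<Omega>" and inK: "\<gamma> ` {t..m} \<subseteq> K"
    and m: "0 \<le> t" "t \<le> m" "m \<le> T" and fin: "V m (\<gamma> m) = ereal w"
  shows "V t x \<le> run t m (\<lambda>_. v) \<gamma> + ereal w"
proof (rule ereal_le_epsilon2)
  fix e :: real assume "0 < e"
  then have "V m (\<gamma> m) < ereal (w + e)" using fin by simp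
  then obtain u\<^sub>2 \<gamma>\<^sub>2 where adm: "(u\<^sub>2, \<gamma>\<^sub>2) \<in> adm m (\<gamma> m)" and c2: "cost L g m T u\<^sub>2 \<gamma>\<^sub>2 < ereal (w + e)"
    by (rule near_optimal)
  let ?u = "\<lambda>s. if s \<le> m then v else u\<^sub>2 s" and ?\<gamma> = "\<lambda>s. if s \<le> m then \<gamma> s else \<gamma>\<^sub>2 s"
  have a: "(?u, ?\<gamma>) \<in> adm t x" by (rule adm_prepend[OF tr v inK m(2,3) adm])
  have start: "\<gamma>\<^sub>2 m = \<gamma> m" using admD(4)[OF adm] by (simp add: trajectory_iff)
  have "V t x \<le> cost L g t T ?u ?\<gamma>" by (rule V_le_cost[OF a])
  also have "\<dots> = run t m ?u ?\<gamma> + (run m T ?u ?\<gamma> + ereal (g (?\<gamma> T)))"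
    unfolding cost_eq[OF a m(1)] run_split[OF m(2,3)] by (simp only: add.assoc)
  also have "run t m ?u ?\<gamma> = run t m (\<lambda>_. v) \<gamma>" by (rule run_cong[of _ _ m]) auto
  also have "run m T ?u ?\<gamma> = run m T u\<^sub>2 \<gamma>\<^sub>2" by (rule run_cong[of _ _ m]) auto
  also have "?\<gamma> T = \<gamma>\<^sub>2 T" using m(3) start by (cases "T = m") auto
  also have "run m T u\<^sub>2 \<gamma>\<^sub>2 + ereal (g (\<gamma>\<^sub>2 T)) = cost L g m T u\<^sub>2 \<gamma>\<^sub>2"
    using cost_eq[OF adm] m by simp
  also have "run t m (\<lambda>_. v) \<gamma> + cost L g m T u\<^sub>2 \<gamma>\<^sub>2 \<le> run t m (\<lambda>_. v) \<gamma> + ereal (w + e)"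
    using c2 by (intro add_left_mono) simp
  finally show "V t x \<le> run t m (\<lambda>_. v) \<gamma> + ereal w + ereal e"
    by (simp add: add.assoc)
qed

lemma V_finite: "t \<in> {0..T} \<Longrightarrow> x \<in> D \<Longrightarrow> V t x = ereal (real_of_ereal (V t x))"
  using V_C1 unfolding finite_C1_on_def by (auto simp: ereal_real)

lemma adm_nonempty:
  assumes "t \<in> {0..T}" "x \<in> D"
  obtains u \<gamma> where "(u, \<gamma>) \<in> adm t x"
proof -
  have "V t x < \<infinity>" using V_finite[OF assms] by (metis ereal_less(4) ereal_infty_less(1) PInfty_neq_ereal(1))
  then show ?thesis using near_optimal that by metis
qed

lemma D_points: "D \<subseteq> points TA"
  using openin_subset[OF D] unfolding T.topspace_manifold .

lemma D_K: "D \<subseteq> K"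
proof
  fix x assume "x \<in> D"
  then obtain u \<gamma> where a: "(u, \<gamma>) \<in> adm 0 x" using adm_nonempty[of 0 x] T by auto
  then show "x \<in> K" using admD(4,5)[OF a] T unfolding trajectory_iff by (metis atLeastAtMost_iff image_subset_iff less_eq_real_def)
qed

text \<open>Without a lower bound a very negative terminal cost could pay for a large control
  energy. Compactness of \<open>K\<close>, in which admissible curves end, excludes this.\<close>

lemma g_bounded_below: obtains g0 where "\<And>x. x \<in> K \<Longrightarrow> g0 \<le> g x"
proof -
  have "compactin euclideanreal (g ` K)"
    by (rule image_compactin[OF K T.continuous_map_smooth_function[OF g]])
  then have "bounded (g ` K)" by (simp add: compact_imp_bounded)
  then obtain b where "\<And>x. x \<in> K \<Longrightarrow> \<bar>g x\<bar> \<le> b" unfolding bounded_iff by auto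
  then have "- b \<le> g x" if "x \<in> K" for x using that by (metis abs_le_D2 minus_le_iff)
  then show ?thesis by (rule that)
qed

section \<open>The value function in a chart of TM\<close>

definition Vc :: "(('a, 'e) tpoint, 'e \<times> 'e) chart \<Rightarrow> real \<Rightarrow> 'e \<times> 'e \<Rightarrow> real" where
  "Vc C s z = real_of_ereal (V s (chart_inv C z))"

definition Dc :: "(('a, 'e) tpoint, 'e \<times> 'e) chart \<Rightarrow> ('e \<times> 'e) set" where
  "Dc C = chart_map C ` (D \<inter> chart_dom C)"

lemma Dc_open: "C \<in> TA \<Longrightarrow> open (Dc C)"
  unfolding Dc_def by (rule T.open_chart_image_Int[OF D])

lemma Dc_image: "Dc C \<subseteq> chart_image C"
  unfolding Dc_def chart_image_def by blast

lemma Dc_inv: "C \<in> TA \<Longrightarrow> z \<in> Dc C \<Longrightarrow> chart_inv C z \<in> D \<inter> chart_dom C"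
  unfolding Dc_def using T.chart_inv_map by fastforce

lemma V_Vc:
  assumes "C \<in> TA" "s \<in> {0..T}" "x \<in> D" "x \<in> chart_dom C"
  shows "V s x = ereal (Vc C s (chart_map C x))"
  using V_finite[OF assms(2,3)] unfolding Vc_def by (simp add: T.chart_inv_map assms)

text \<open>The joint derivative in time and state, one-sided in time at 0 and at T.
  \<open>P (1, 0)\<close> is the time derivative and \<open>P (0, v)\<close> the spatial
  differential applied to \<open>v\<close>.\<close>

abbreviation has_dV :: "(('a, 'e) tpoint, 'e \<times> 'e) chart \<Rightarrow> real \<Rightarrow> 'e \<times> 'e \<Rightarrow> (real \<times> ('e \<times> 'e) \<Rightarrow> real) \<Rightarrow> bool" where
  "has_dV C s z P \<equiv> ((\<lambda>p. Vc C (fst p) (snd p)) has_derivative P) (at (s, z) within {0..T} \<times> Dc C)"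

text \<open>The derivative is taken from a local C^1 extension, so it is continuous on a full
  neighbourhood. This continuity is what the passage to the final time uses.\<close>

lemma has_dV_obtain:
  assumes C: "C \<in> TA" and t: "t \<in> {0..T}" and z: "z \<in> Dc C"
  obtains N P where "open N" "(t, z) \<in> N" "\<And>s w. (s, w) \<in> N \<Longrightarrow> s \<in> {0..T} \<Longrightarrow> w \<in> Dc C \<Longrightarrow> has_dV C s w (P (s, w))"
    "\<And>v. continuous_on N (\<lambda>p. P p v)"
proof -
  have "class_C_on 1 ({0..T} \<times> Dc C) (\<lambda>(t, z). real_of_ereal (V t (chart_inv C z)))"
    using V_C1 C unfolding finite_C1_on_def Dc_def by blast
  moreover have "(t, z) \<in> {0..T} \<times> Dc C" using t z by simp
  ultimately have "\<exists>N F. open N \<and> (t, z) \<in> N \<and> (\<forall>k. enat k \<le> 1 \<longrightarrow> C_diff_open k F N) \<and>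
      (\<forall>p\<in>N \<inter> {0..T} \<times> Dc C. F p = (\<lambda>(t, z). real_of_ereal (V t (chart_inv C z))) p)"
    unfolding class_C_on_def by (rule bspec)
  then obtain N F where *: "open N \<and> (t, z) \<in> N \<and> (\<forall>k. enat k \<le> 1 \<longrightarrow> C_diff_open k F N) \<and>
      (\<forall>p\<in>N \<inter> {0..T} \<times> Dc C. F p = (\<lambda>(t, z). real_of_ereal (V t (chart_inv C z))) p)"
    by (elim exE)
  then have N: "open N" "(t, z) \<in> N" by simp_all
  have F: "C_diff_open k F N" if "enat k \<le> 1" for k
    using * that by (elim conjE) (drule spec, erule mp)
  have eq: "F p = (\<lambda>(t, z). real_of_ereal (V t (chart_inv C z))) p" if "p \<in> N \<inter> {0..T} \<times> Dc C" for p
    using * that by (elim conjE) (drule bspec)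
  have "C_diff_open (Suc 0) F N" using F[of "Suc 0"] by (simp add: one_enat_def)
  then have diff: "\<And>p. p \<in> N \<Longrightarrow> F differentiable (at p)"
    and cont: "\<And>v. continuous_on N (\<lambda>p. frechet_derivative F (at p) v)" by auto
  have "has_dV C s w (frechet_derivative F (at (s, w)))"
    if p: "(s, w) \<in> N" "s \<in> {0..T}" "w \<in> Dc C" for s w
  proof (rule has_derivative_transform_eventually)
    show "(F has_derivative frechet_derivative F (at (s, w))) (at (s, w) within {0..T} \<times> Dc C)"
      using diff[OF p(1)] frechet_derivative_works has_derivative_at_withinI by blast
    show "\<forall>\<^sub>F q in at (s, w) within {0..T} \<times> Dc C. F q = Vc C (fst q) (snd q)"
      unfolding eventually_at_topological using N(1) p(1) eq by (auto simp: Vc_def intro!: exI[of _ N])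
    show "F (s, w) = Vc C (fst (s, w)) (snd (s, w))" using eq[of "(s, w)"] p by (simp add: Vc_def)
  qed (use p in simp)
  then show ?thesis using that[OF N, of "\<lambda>p. frechet_derivative F (at p)"] cont by blast
qed

lemma has_dV_linear:
  assumes "has_dV C s z P"
  shows "P (r, v) = P (1, 0) * r + P (0, v)" "bounded_linear (\<lambda>v. P (0, v))"
proof -
  have l: "linear P" using assms by (rule has_derivative_linear)
  have "P (r, v) = P (r *\<^sub>R (1, 0) + (0, v))" by simp
  also have "\<dots> = r * P (1, 0) + P (0, v)" by (simp only: linear_add[OF l] linear_scale[OF l] real_scaleR_def)
  finally show "P (r, v) = P (1, 0) * r + P (0, v)" by simp
  have "bounded_linear P" using assms by (rule has_derivative_bounded_linear)
  then show "bounded_linear (\<lambda>v. P (0, v))"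
    by (rule bounded_linear_compose) (intro bounded_linear_Pair bounded_linear_zero bounded_linear_ident)
qed

lemma Vc_time_derivative:
  assumes "has_dV C s z P" "z \<in> Dc C"
  shows "((\<lambda>r. Vc C r z) has_real_derivative P (1, 0)) (at s within {0..T})"
proof -
  have "((\<lambda>r. (r, z)) has_derivative (\<lambda>h. (h, 0))) (at s within {0..T})"
    by (auto intro!: derivative_eq_intros)
  moreover have "((\<lambda>p. Vc C (fst p) (snd p)) has_derivative P) (at (s, z) within (\<lambda>r. (r, z)) ` {0..T})"
    by (rule has_derivative_subset[OF assms(1)]) (use assms(2) in auto)
  ultimately have "((\<lambda>r. Vc C r z) has_derivative (\<lambda>h. P (h, 0))) (at s within {0..T})"
    using has_derivative_in_compose[of "\<lambda>r. (r, z)"] by fastforce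
  moreover have "(\<lambda>h. P (h, 0)) = (*) (P (1, 0))"
  proof
    fix h
    have "P (0, 0) = 0" using linear_0[OF has_derivative_linear[OF assms(1)]] by (simp add: zero_prod_def)
    with has_dV_linear(1)[OF assms(1), of h 0] show "P (h, 0) = P (1, 0) * h" by linarith
  qed
  ultimately show ?thesis unfolding has_field_derivative_def by argo
qed

lemma Vc_space_derivative:
  assumes C: "C \<in> TA" and P: "has_dV C s z P" and s: "s \<in> {0..T}" "z \<in> Dc C"
  shows "(Vc C s has_derivative (\<lambda>v. P (0, v))) (at z)"
proof -
  have "((\<lambda>w. (s, w)) has_derivative (\<lambda>v. (0, v))) (at z within Dc C)"
    by (auto intro!: derivative_eq_intros)
  moreover have "((\<lambda>p. Vc C (fst p) (snd p)) has_derivative P) (at (s, z) within (\<lambda>w. (s, w)) ` Dc C)"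
    by (rule has_derivative_subset[OF P]) (use s in auto)
  ultimately have "((\<lambda>w. Vc C s w) has_derivative (\<lambda>v. P (0, v))) (at z within Dc C)"
    using has_derivative_in_compose[of "\<lambda>w. (s, w)"] by fastforce
  then show ?thesis using at_within_open[OF s(2) Dc_open[OF C]] by simp
qed

section \<open>The two differential inequalities before the final time\<close>

lemma L_continuous:
  assumes C: "C \<in> TA"
  shows "continuous_on ({0..T} \<times> chart_image C \<times> UNIV) (\<lambda>(s, z, u). L s (chart_inv C z) u)"
  using L C class_C_on_continuous unfolding smooth_lagrangian_def by blast

text \<open>With t < T there is room to the right of \<open>t\<close>. The curve is taken inside
  \<open>D\<close>, which gives both a finite differentiable value and, as \<open>D\<close> lies in
  \<open>K\<close>, the state constraint.\<close>

lemma subsolution: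
  assumes c: "c \<in> A" "x \<in> chart_dom (tc c)" and x: "x \<in> D" and t: "0 \<le> t" "t < T"
    and P: "has_dV (tc c) t (chart_map (tc c) x) P" and u: "u \<in> \<Omega>"
  shows "0 \<le> P (1, fld c (chart_map (tc c) x) u) + L t x u"
proof (rule ccontr)
  let ?C = "tc c" and ?z = "chart_map (tc c) x"
  note C = tc_atlas[OF c(1)]
  assume neg: "\<not> ?thesis"
  obtain h0 where h0: "h0 > 0" "\<And>t h. 0 \<le> h \<Longrightarrow> h \<le> h0 \<Longrightarrow> \<exists>\<gamma>. trajectory A G W f t (t+h) x (\<lambda>_. u) \<gamma> \<and>
     \<gamma> ` {t..t+h} \<subseteq> D \<inter> chart_dom ?C \<and>
     (\<forall>s\<in>{t..t+h}. ((\<lambda>s. chart_map ?C (\<gamma> s)) has_vector_derivative fld c (chart_map ?C (\<gamma> s)) u) (at s within {t..t+h}))"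
    using trajectory_constant_control[OF D x c, of u] by blast
  define h where "h = min h0 (T - t)"
  have h: "0 < h" "t + h \<le> T" using h0(1) t by (auto simp: h_def)
  have "h \<le> h0" by (simp add: h_def)
  then obtain \<gamma> where tr: "trajectory A G W f t (t+h) x (\<lambda>_. u) \<gamma>" and \<gamma>: "\<gamma> ` {t..t+h} \<subseteq> D \<inter> chart_dom ?C"
    and der: "\<And>s. s \<in> {t..t+h} \<Longrightarrow> ((\<lambda>s. chart_map ?C (\<gamma> s)) has_vector_derivative fld c (chart_map ?C (\<gamma> s)) u) (at s within {t..t+h})"
    using h0(2)[of h t] h(1) by auto
  define \<zeta> where "\<zeta> s = chart_map ?C (\<gamma> s)" for s
  let ?I = "{t..t+h}"
  have in_D: "\<gamma> s \<in> D" "\<gamma> s \<in> chart_dom ?C" "\<zeta> s \<in> Dc ?C" "chart_inv ?C (\<zeta> s) = \<gamma> s" "s \<in> {0..T}" if "s \<in> ?I" for s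
  proof -
    show *: "\<gamma> s \<in> D" "\<gamma> s \<in> chart_dom ?C" using \<gamma> that by blast+
    then show "\<zeta> s \<in> Dc ?C" unfolding \<zeta>_def Dc_def by blast
    show "chart_inv ?C (\<zeta> s) = \<gamma> s" unfolding \<zeta>_def by (rule T.chart_inv_map[OF C *(2)])
    show "s \<in> {0..T}" using that h t by auto
  qed
  have start: "\<gamma> t = x" "\<zeta> t = ?z" using tr unfolding trajectory_iff \<zeta>_def by auto
  have cont\<zeta>: "continuous_on ?I \<zeta>"
    unfolding \<zeta>_def using der has_vector_derivative_continuous continuous_on_eq_continuous_within by blast
  define \<Lambda> where "\<Lambda> s = L s (\<gamma> s) u" for s
  have "continuous_on ?I (\<lambda>s. (\<lambda>(s, z, u). L s (chart_inv ?C z) u) (s, \<zeta> s, u))"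
    by (rule continuous_on_compose2[OF L_continuous[OF C]])
      (intro continuous_intros cont\<zeta>, use in_D(3,5) subsetD[OF Dc_image[of ?C]] in \<open>simp add: image_subset_iff\<close>)
  then have cont\<Lambda>: "continuous_on ?I \<Lambda>"
    by (rule continuous_on_eq) (simp add: \<Lambda>_def in_D(4))
  define \<phi> where "\<phi> r = integral {t..r} \<Lambda> + Vc ?C r (\<zeta> r)" for r
  have ge: "\<phi> t \<le> \<phi> r" if r: "r \<in> ?I" for r
  proof -
    have "V r (\<gamma> r) = ereal (Vc ?C r (\<zeta> r))" unfolding \<zeta>_def by (rule V_Vc[OF C]) (use in_D[OF r] in auto)
    moreover have "trajectory A G W f t r x (\<lambda>_. u) \<gamma>"
      using trajectory_subinterval[OF tr order_refl, of r] start r by auto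
    moreover have "\<gamma> ` {t..r} \<subseteq> K" using \<gamma> D_K r by fastforce
    ultimately have le: "V t x \<le> run t r (\<lambda>_. u) \<gamma> + ereal (Vc ?C r (\<zeta> r))"
      using r h t by (intro dynamic_programming_upper[OF _ u]) auto
    have int: "integrable (lebesgue_on {t..r}) \<Lambda>"
      by (intro continuous_imp_integrable_real continuous_on_subset[OF cont\<Lambda>]) (use r in auto)
    have nn: "0 \<le> \<Lambda> s" if s: "s \<in> {t..r}" for s
    proof -
      have s': "s \<in> ?I" using s r by auto
      have "\<Lambda> s \<ge> \<beta> * (norm u)\<^sup>2"
        unfolding \<Lambda>_def using in_D(1,5)[OF s'] D_points by (intro coercive) auto
      moreover have "\<beta> * (norm u)\<^sup>2 \<ge> 0" using \<beta> by simp
      ultimately show ?thesis by linarith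
    qed
    \<comment> \<open>Along this curve the integrand is continuous and nonnegative, so the extended
      cost is an ordinary integral that can be differentiated in its upper limit.\<close>
    have "(\<integral>\<^sup>+ s. ennreal (\<Lambda> s) \<partial>lebesgue_on {t..r}) = ennreal (integral\<^sup>L (lebesgue_on {t..r}) \<Lambda>)"
      by (rule nn_integral_eq_integral[OF int]) (use nn in \<open>auto simp: AE_lebesgue_on\<close>)
    also have "integral\<^sup>L (lebesgue_on {t..r}) \<Lambda> = integral {t..r} \<Lambda>"
      by (rule lebesgue_integral_eq_integral[OF int]) auto
    finally have run_eq: "(\<integral>\<^sup>+ s. ennreal (\<Lambda> s) \<partial>lebesgue_on {t..r}) = ennreal (integral {t..r} \<Lambda>)" .
    have pos: "0 \<le> integral {t..r} \<Lambda>"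
      by (rule Henstock_Kurzweil_Integration.integral_nonneg[OF integrable_on_lebesgue_on[OF int] nn]) auto
    have "run t r (\<lambda>_. u) \<gamma> = ereal (integral {t..r} \<Lambda>)"
      unfolding run_def \<Lambda>_def[symmetric] run_eq
      by (simp add: enn2ereal_ennreal pos)
    moreover have "V t x = ereal (Vc ?C t ?z)"
      by (rule V_Vc[OF C]) (use x c t in auto)
    ultimately show ?thesis using le start by (simp add: \<phi>_def)
  qed
  have tI: "t \<in> ?I" using h by simp
  have "(\<zeta> has_derivative (\<lambda>h. h *\<^sub>R fld c ?z u)) (at t within ?I)"
    using der[OF tI] start unfolding \<zeta>_def[abs_def] has_vector_derivative_def by simp
  then have "((\<lambda>r. (r, \<zeta> r)) has_derivative (\<lambda>h. (h, h *\<^sub>R fld c ?z u))) (at t within ?I)"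
    by (intro has_derivative_Pair has_derivative_ident)
  moreover have "((\<lambda>p. Vc ?C (fst p) (snd p)) has_derivative P) (at (t, \<zeta> t) within (\<lambda>r. (r, \<zeta> r)) ` ?I)"
    unfolding start(2) by (rule has_derivative_subset[OF P]) (use in_D(3,5) in \<open>simp add: image_subset_iff\<close>)
  ultimately have "((\<lambda>r. Vc ?C r (\<zeta> r)) has_derivative (\<lambda>h. P (h, h *\<^sub>R fld c ?z u))) (at t within ?I)"
    using has_derivative_in_compose[of "\<lambda>r. (r, \<zeta> r)"] by fastforce
  moreover have "((\<lambda>r. integral {t..r} \<Lambda>) has_derivative (\<lambda>h. h *\<^sub>R \<Lambda> t)) (at t within ?I)"
    using integral_has_vector_derivative[OF cont\<Lambda> tI] unfolding has_vector_derivative_def .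
  ultimately have "(\<phi> has_derivative (\<lambda>h. h *\<^sub>R \<Lambda> t + P (h, h *\<^sub>R fld c ?z u))) (at t within ?I)"
    unfolding \<phi>_def[abs_def] by (intro has_derivative_add)
  moreover have "(\<lambda>h. h *\<^sub>R \<Lambda> t + P (h, h *\<^sub>R fld c ?z u)) = (*) (P (1, fld c ?z u) + L t x u)"
  proof
    fix h :: real
    have "P (h, h *\<^sub>R fld c ?z u) = P (h *\<^sub>R (1, fld c ?z u))" by simp
    also have "\<dots> = h * P (1, fld c ?z u)" by (simp only: linear_scale[OF has_derivative_linear[OF P]] real_scaleR_def)
    finally show "h *\<^sub>R \<Lambda> t + P (h, h *\<^sub>R fld c ?z u) = (P (1, fld c ?z u) + L t x u) * h"
      unfolding \<Lambda>_def start by (simp only: real_scaleR_def distrib_left distrib_right mult.commute add.commute)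
  qed
  ultimately have "(\<phi> has_real_derivative P (1, fld c ?z u) + L t x u) (at t within ?I)"
    unfolding has_field_derivative_def by argo
  \<comment> \<open>A negative one-sided derivative would make \<phi> drop below its initial value
    at once, against \<open>ge\<close>.\<close>
  from has_real_derivative_neg_dec_right[OF this] neg
  obtain d where d: "d > 0" "\<And>k. 0 < k \<Longrightarrow> t + k \<in> ?I \<Longrightarrow> k < d \<Longrightarrow> \<phi> (t + k) < \<phi> t" by auto
  define k where "k = min (d / 2) h"
  have "0 < k" "k < d" "t + k \<in> ?I" using d(1) h(1) by (auto simp: k_def min_def)
  with d(2)[of k] ge[of "t + k"] show False by auto
qed

text \<open>Integrating the coercivity inequality along the pair and bounding the terminal cost from
  below gives \<beta> times the energy plus \<open>g0\<close> as a lower bound of the cost.\<close>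

lemma control_integral_bound:
  assumes adm: "(u, \<gamma>) \<in> adm t x" and t: "0 \<le> t" "t \<le> T" and cost: "cost L g t T u \<gamma> \<le> ereal b"
    and g0: "\<And>x. x \<in> K \<Longrightarrow> g0 \<le> g x"
  shows "integral\<^sup>L (lebesgue_on {t..T}) (\<lambda>s. (norm (u s))\<^sup>2) \<le> (b - g0) / \<beta>"
proof -
  let ?J = "integral\<^sup>L (lebesgue_on {t..T}) (\<lambda>s. (norm (u s))\<^sup>2)"
  have "AE s in lebesgue_on {t..T}. \<beta> * (norm (u s))\<^sup>2 \<le> L s (\<gamma> s) (u s)"
    unfolding AE_lebesgue_on
  proof (intro AE_I2 impI)
    fix s assume s: "s \<in> {t..T}"
    then have "\<gamma> s \<in> points TA" using admD(5)[OF adm] K_points by blast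
    then show "\<beta> * (norm (u s))\<^sup>2 \<le> L s (\<gamma> s) (u s)" using s t by (intro coercive) auto
  qed
  from integral_le_nn_integral[OF _ this] admD(2)[OF adm]
  have "ereal (\<beta> * ?J) \<le> run t T u \<gamma>" unfolding run_def by simp
  moreover have "\<gamma> T \<in> K" using admD(5)[OF adm] t by (intro subsetD[OF admD(5)[OF adm]] imageI) simp
  then have "g0 \<le> g (\<gamma> T)" by (rule g0)
  ultimately have "ereal (\<beta> * ?J) + ereal g0 \<le> run t T u \<gamma> + ereal (g (\<gamma> T))"
    by (intro add_mono) auto
  then have "ereal (\<beta> * ?J + g0) \<le> cost L g t T u \<gamma>" unfolding cost_eq[OF adm t(1)] by simp
  then have "ereal (\<beta> * ?J + g0) \<le> ereal b" using cost by (rule order_trans)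
  then have "\<beta> * ?J \<le> b - g0" by simp
  then show ?thesis using \<beta> by (simp add: pos_le_divide_eq mult.commute)
qed

text \<open>\<open>P (1, v)\<close> is split into \<open>P (1, 0)\<close> and
  \<open>P (0, v)\<close> to match the affine form of \<open>hamiltonian_margin\<close>. The time T
  is included, because the margin is also needed there.\<close>

lemma hamiltonian_margin_chart:
  assumes c: "c \<in> A" "x \<in> chart_dom (tc c)" and x: "x \<in> D" and t: "t \<in> {0..T}"
    and P: "has_dV (tc c) t (chart_map (tc c) x) P" and m: "m > 0"
    and low: "\<And>u. u \<in> \<Omega> \<Longrightarrow> m \<le> P (1, fld c (chart_map (tc c) x) u) + L t x u"
  obtains \<epsilon> \<eta> \<delta> :: real where "\<epsilon> > 0" "\<eta> > 0" "\<delta> > 0" "cball (chart_map (tc c) x) \<delta> \<subseteq> Dc (tc c)"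
    "\<And>s w u. s \<in> {0..T} \<Longrightarrow> \<bar>s - t\<bar> \<le> \<delta> \<Longrightarrow> w \<in> cball (chart_map (tc c) x) \<delta> \<Longrightarrow> u \<in> \<Omega> \<Longrightarrow>
       \<eta> + \<epsilon> * (1 + norm (fld c w u)) \<le> P (1, fld c w u) + L s (chart_inv (tc c) w) u"
proof -
  let ?C = "tc c" and ?z = "chart_map (tc c) x"
  note C = tc_atlas[OF c(1)]
  have l: "bounded_linear (\<lambda>v. P (0, v))" by (rule has_dV_linear(2)[OF P])
  have Pal: "P (1, v) = P (1, 0) + P (0, v)" for v using has_dV_linear(1)[OF P, of 1 v] by linarith
  have zD: "?z \<in> Dc ?C" "?z \<in> chart_image ?C" using x c unfolding Dc_def chart_image_def by auto
  have inv_z: "chart_inv ?C ?z = x" by (rule T.chart_inv_map[OF C c(2)])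
  obtain r\<^sub>0 B where B: "r\<^sub>0 > 0" "B > 0" "\<And>w u. w \<in> ball ?z r\<^sub>0 \<Longrightarrow> norm (fld c w u) \<le> B * (1 + norm u)"
    using fld_bound[OF c(1) zD(2)] by blast
  have Lco: "L s (chart_inv ?C w) u \<ge> \<beta> * (norm u)\<^sup>2" if "s \<in> {0..T}" "w \<in> Dc ?C" for s w u
    by (rule coercive[OF that(1)]) (use Dc_inv[OF C that(2)] D_points in blast)
  have F: "continuous_on (Dc ?C \<times> UNIV) (\<lambda>w. fld c (fst w) (snd w))"
    by (rule continuous_on_subset[OF fld_joint_continuous[OF c(1)]]) (use Dc_image[of ?C] in auto)
  have \<Lambda>: "continuous_on ({0..T} \<times> Dc ?C \<times> UNIV) (\<lambda>(s, w, u). L s (chart_inv ?C w) u)"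
    by (rule continuous_on_subset[OF L_continuous[OF C]]) (use Dc_image[of ?C] in auto)
  have low': "m \<le> P (1, 0) + P (0, fld c ?z u) + L t (chart_inv ?C ?z) u" if "u \<in> \<Omega>" for u
    unfolding inv_z using low[OF that] Pal[of "fld c ?z u"] by linarith
  show ?thesis
  proof (rule hamiltonian_margin[OF t Dc_open[OF C] zD(1) F \<Lambda> Lco \<beta> B l m low'])
    fix \<epsilon> \<eta> \<delta> :: real
    assume *: "\<epsilon> > 0" "\<eta> > 0" "\<delta> > 0" "cball ?z \<delta> \<subseteq> Dc ?C"
      and **: "\<And>s w u. s \<in> {0..T} \<Longrightarrow> \<bar>s - t\<bar> \<le> \<delta> \<Longrightarrow> w \<in> cball ?z \<delta> \<Longrightarrow> u \<in> \<Omega> \<Longrightarrow>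
         \<eta> + \<epsilon> * (1 + norm (fld c w u)) \<le> P (1, 0) + P (0, fld c w u) + L s (chart_inv ?C w) u"
    show thesis
    proof (rule that[OF *])
      fix s w u assume "s \<in> {0..T}" "\<bar>s - t\<bar> \<le> \<delta>" "w \<in> cball ?z \<delta>" "u \<in> \<Omega>"
      from **[OF this] show "\<eta> + \<epsilon> * (1 + norm (fld c w u)) \<le> P (1, fld c w u) + L s (chart_inv ?C w) u"
        unfolding Pal[of "fld c w u"] .
    qed
  qed
qed

text \<open>Integrated along a pair that is optimal up to \<eta> h / 2, the margin bounds running
  cost plus first order change of V from below by \<eta> h + \<epsilon> (h + X), where X is the
  coordinate length of the curve. The remainder costs at most \<epsilon> (h + X), so \<eta> h
  remains, twice the allowed excess.\<close>

lemma supersolution: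
  assumes c: "c \<in> A" "x \<in> chart_dom (tc c)" and x: "x \<in> D" and t: "0 \<le> t" "t < T"
    and P: "has_dV (tc c) t (chart_map (tc c) x) P" and m: "m > 0"
    and low: "\<And>u. u \<in> \<Omega> \<Longrightarrow> m \<le> P (1, fld c (chart_map (tc c) x) u) + L t x u"
  shows False
proof -
  let ?C = "tc c"
  define z where "z = chart_map (tc c) x"
  define a where "a = P (1, 0)"
  define l where "l v = P (0, v)" for v
  note C = tc_atlas[OF c(1)]
  have Pal: "P (r, v) = a * r + l v" for r v unfolding a_def l_def by (rule has_dV_linear(1)[OF P])
  have l: "bounded_linear l" unfolding l_def[abs_def] by (rule has_dV_linear(2)[OF P])
  have zD: "z \<in> Dc ?C" "z \<in> chart_image ?C" using x c unfolding z_def Dc_def chart_image_def by auto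
  have inv_z: "chart_inv ?C z = x" unfolding z_def by (rule T.chart_inv_map[OF C c(2)])
  obtain r\<^sub>0 B where B: "r\<^sub>0 > 0" "B > 0" "\<And>w u. w \<in> ball z r\<^sub>0 \<Longrightarrow> norm (fld c w u) \<le> B * (1 + norm u)"
    using fld_bound[OF c(1) zD(2)] by blast
  have t': "t \<in> {0..T}" using t by simp
  obtain \<epsilon> \<eta> \<delta> :: real where \<epsilon>: "\<epsilon> > 0" and \<eta>: "\<eta> > 0" and \<delta>: "\<delta> > 0" "cball z \<delta> \<subseteq> Dc ?C"
    and margin: "\<And>s w u. s \<in> {0..T} \<Longrightarrow> \<bar>s - t\<bar> \<le> \<delta> \<Longrightarrow> w \<in> cball z \<delta> \<Longrightarrow> u \<in> \<Omega> \<Longrightarrow>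
       \<eta> + \<epsilon> * (1 + norm (fld c w u)) \<le> P (1, fld c w u) + L s (chart_inv ?C w) u"
    using hamiltonian_margin_chart[OF c x t' P m low] unfolding z_def by metis
  \<comment> \<open>The tolerance of the differential is the \<epsilon> of the margin, so that the
    remainder can be absorbed.\<close>
  obtain d where d: "d > 0" "\<And>y. y \<in> {0..T} \<times> Dc ?C \<Longrightarrow> norm (y - (t, z)) < d \<Longrightarrow>
      norm (Vc ?C (fst y) (snd y) - Vc ?C t z - P (y - (t, z))) \<le> \<epsilon> * norm (y - (t, z))"
    using P \<epsilon> unfolding has_derivative_within_alt z_def[symmetric] by (metis fst_conv snd_conv)
  obtain g0 where g0: "\<And>x. x \<in> K \<Longrightarrow> g0 \<le> g x" using g_bounded_below by blast
  define v0 where "v0 = Vc ?C t z"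
  have Vt: "V t x = ereal v0" unfolding v0_def z_def by (rule V_Vc[OF C]) (use x c t in auto)
  \<comment> \<open>In this ball the margin and the growth bound hold. With h \<le> \<rho> and a
    displacement of at most \<rho>, the condition 2 \<rho> < d keeps the end point where the
    expansion of V is valid.\<close>
  define \<rho> where "\<rho> = min \<delta> (min (r\<^sub>0 / 2) (d / 3))"
  have \<rho>: "\<rho> > 0" "\<rho> \<le> \<delta>" "\<rho> < r\<^sub>0" "2 * \<rho> < d" using \<delta> B d by (auto simp: \<rho>_def min_def)
  \<comment> \<open>Bounds the energy of every control whose cost exceeds \<open>v0\<close> by at
    most 1; the choice h \<le> 1 / \<eta> below puts the almost optimal control in this
    class.\<close>
  define M where "M = \<bar>(v0 + 1 - g0) / \<beta>\<bar> + 1"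
  have M: "M > 0" unfolding M_def by (intro add_nonneg_pos abs_ge_zero zero_less_one)
  \<comment> \<open>The weight in |u| \<le> 1/\<kappa> + \<kappa> |u|^2, chosen so that the
    quadratic part contributes B \<kappa> M = \<rho>/4 to the length. The constant part is
    \<open>q\<close> per unit time, and h \<le> \<rho> / (4 q) makes it another \<rho>/4.\<close>
  define \<kappa> where "\<kappa> = \<rho> / (4 * B * M)"
  have \<kappa>: "\<kappa> > 0" using \<rho> B M by (simp add: \<kappa>_def)
  define q where "q = B * (1 + 1 / \<kappa>)"
  have q: "q > 0" using B \<kappa> by (simp add: q_def add_pos_pos)
  define h where "h = min (T - t) (min \<rho> (min (\<rho> / (4 * q)) (1 / \<eta>)))"
  have h: "h > 0" "t + h \<le> T" "h \<le> \<rho>" "h \<le> \<rho> / (4 * q)" "h \<le> 1 / \<eta>"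
    using t \<rho> q \<eta> by (auto simp: h_def)
  have hq: "q * h \<le> \<rho> / 4" using h(4) q by (simp add: field_simps)
  have h\<eta>: "\<eta> * h \<le> 1" using h(5) \<eta> by (simp add: field_simps)
  have "V t x < ereal (v0 + \<eta> * h / 2)" using Vt \<eta> h(1) by simp
  then obtain u \<gamma> where adm: "(u, \<gamma>) \<in> adm t x" and cost: "cost L g t T u \<gamma> < ereal (v0 + \<eta> * h / 2)"
    by (rule near_optimal)
  have int2: "integrable (lebesgue_on {t..T}) (\<lambda>s. (norm (u s))\<^sup>2)" by (rule admD(2)[OF adm])
  have uM: "integral\<^sup>L (lebesgue_on {t..T}) (\<lambda>s. (norm (u s))\<^sup>2) \<le> M"
  proof -
    have "cost L g t T u \<gamma> \<le> ereal (v0 + 1)"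
      using cost h\<eta> by (intro order_trans[OF less_imp_le[OF cost]]) simp
    from control_integral_bound[OF adm t(1) _ this g0] t
    have "integral\<^sup>L (lebesgue_on {t..T}) (\<lambda>s. (norm (u s))\<^sup>2) \<le> (v0 + 1 - g0) / \<beta>" by simp
    also have "\<dots> \<le> M" unfolding M_def using abs_ge_self[of "(v0 + 1 - g0) / \<beta>"] by linarith
    finally show ?thesis .
  qed
  have u_int: "integrable (lebesgue_on {t..s}) (\<lambda>s. B * (1 + norm (u s)))"
    "integral\<^sup>L (lebesgue_on {t..s}) (\<lambda>s. B * (1 + norm (u s))) \<le> \<rho> / 2" if s: "s \<in> {t..t+h}" for s
  proof -
    have pw: "B * (1 + norm (u r)) \<le> q + B * \<kappa> * (norm (u r))\<^sup>2" for r
    proof -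
      \<comment> \<open>Either |u| \<le> 1/\<kappa>, or \<kappa> |u| \<ge> 1 and then |u| \<le>
        \<kappa> |u|^2.\<close>
      have "norm (u r) \<le> 1 / \<kappa> + \<kappa> * (norm (u r))\<^sup>2"
      proof (cases "norm (u r) \<le> 1 / \<kappa>")
        case True
        then show ?thesis using \<kappa> by (simp add: add_increasing2)
      next
        case False
        then have "1 \<le> \<kappa> * norm (u r)" using \<kappa> by (simp add: field_simps)
        then have "norm (u r) * 1 \<le> norm (u r) * (\<kappa> * norm (u r))" by (rule mult_left_mono) simp
        also have "\<dots> = \<kappa> * (norm (u r))\<^sup>2" by (simp add: power2_eq_square)
        finally show ?thesis using \<kappa> by (simp add: add_increasing)
      qed
      then have "B * (1 + norm (u r)) \<le> B * (1 + (1 / \<kappa> + \<kappa> * (norm (u r))\<^sup>2))"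
        using B by (intro mult_left_mono) auto
      then show ?thesis by (simp add: q_def algebra_simps)
    qed
    have sub: "{t..s} \<subseteq> {t..T}" using s h by auto
    have i2: "integrable (lebesgue_on {t..s}) (\<lambda>s. (norm (u s))\<^sup>2)"
      by (rule integrable_subinterval[OF int2 sub])
    have ib: "integrable (lebesgue_on {t..s}) (\<lambda>r. q + B * \<kappa> * (norm (u r))\<^sup>2)"
      by (rule Bochner_Integration.integrable_add[OF Lebesgue_Measure.integrable_const_ivl integrable_mult_right[OF i2]])
    have meas: "u \<in> borel_measurable (lebesgue_on {t..s})"
      by (rule measurable_restrict_mono[OF admD(1)[OF adm] sub])
    show i1: "integrable (lebesgue_on {t..s}) (\<lambda>s. B * (1 + norm (u s)))"
    proof (rule Bochner_Integration.integrable_bound[OF ib])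
      show "(\<lambda>s. B * (1 + norm (u s))) \<in> borel_measurable (lebesgue_on {t..s})" using meas by measurable
      show "AE r in lebesgue_on {t..s}. norm (B * (1 + norm (u r))) \<le> norm (q + B * \<kappa> * (norm (u r))\<^sup>2)"
      proof (intro AE_I2)
        fix r
        have "0 \<le> B * (1 + norm (u r))" using B by simp
        then show "norm (B * (1 + norm (u r))) \<le> norm (q + B * \<kappa> * (norm (u r))\<^sup>2)" using pw[of r] by simp
      qed
    qed
    have "integral\<^sup>L (lebesgue_on {t..s}) (\<lambda>s. B * (1 + norm (u s)))
        \<le> integral\<^sup>L (lebesgue_on {t..s}) (\<lambda>r. q + B * \<kappa> * (norm (u r))\<^sup>2)"
      by (rule integral_mono[OF i1 ib]) (rule pw)
    also have "\<dots> = q * (s - t) + B * \<kappa> * integral\<^sup>L (lebesgue_on {t..s}) (\<lambda>r. (norm (u r))\<^sup>2)"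
    proof -
      have ic: "integrable (lebesgue_on {t..s}) (\<lambda>_. q)" by (rule Lebesgue_Measure.integrable_const_ivl)
      have "integral\<^sup>L (lebesgue_on {t..s}) (\<lambda>_. q) = q * (s - t)"
        using s by (subst lebesgue_integral_eq_integral[OF ic]) auto
      then show ?thesis
        unfolding Bochner_Integration.integral_add[OF ic integrable_mult_right[OF i2]] by simp
    qed
    also have "\<dots> \<le> q * h + B * \<kappa> * M"
    proof (intro add_mono mult_left_mono)
      have "integral\<^sup>L (lebesgue_on {t..T}) (\<lambda>r. (norm (u r))\<^sup>2) = integral\<^sup>L (lebesgue_on {t..s}) (\<lambda>r. (norm (u r))\<^sup>2)
          + integral\<^sup>L (lebesgue_on {s..T}) (\<lambda>r. (norm (u r))\<^sup>2)"
        by (rule Equivalence_Measurable_On_Borel.integral_combine[OF int2]) (use s h in auto)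
      moreover have "0 \<le> integral\<^sup>L (lebesgue_on {s..T}) (\<lambda>r. (norm (u r))\<^sup>2)"
        by (rule Bochner_Integration.integral_nonneg) simp
      ultimately show "integral\<^sup>L (lebesgue_on {t..s}) (\<lambda>r. (norm (u r))\<^sup>2) \<le> M" using uM by linarith
    qed (use s q B \<kappa> in auto)
    also have "B * \<kappa> * M = \<rho> / 4" using B M by (simp add: \<kappa>_def)
    finally show "integral\<^sup>L (lebesgue_on {t..s}) (\<lambda>s. B * (1 + norm (u s))) \<le> \<rho> / 2" using hq by simp
  qed
  define \<zeta> where "\<zeta> s = chart_map ?C (\<gamma> s)" for s
  let ?B = "chart_inv ?C ` cball z \<rho>"
  have sub\<rho>: "cball z \<rho> \<subseteq> Dc ?C" "cball z \<rho> \<subseteq> chart_image ?C" "cball z \<rho> \<subseteq> ball z r\<^sub>0"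
    using \<rho> \<delta>(2) Dc_image by (auto simp: subset_eq)
  have inB: "\<gamma> s \<in> D" "\<gamma> s \<in> chart_dom ?C" "\<zeta> s \<in> cball z \<rho>" "chart_inv ?C (\<zeta> s) = \<gamma> s" if s: "\<gamma> s \<in> ?B" for s
  proof -
    obtain w where w: "w \<in> cball z \<rho>" "\<gamma> s = chart_inv ?C w" using s by blast
    then have "w \<in> Dc ?C" "w \<in> chart_image ?C" using sub\<rho> by auto
    then show "\<gamma> s \<in> D" "\<gamma> s \<in> chart_dom ?C" using w Dc_inv[OF C] by auto
    have "\<zeta> s = w" unfolding \<zeta>_def w(2) by (rule T.chart_map_inv) fact
    then show "\<zeta> s \<in> cball z \<rho>" "chart_inv ?C (\<zeta> s) = \<gamma> s" using w by auto
  qed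
  have trj: "trajectory A G W f t T x u \<gamma>" by (rule admD(4)[OF adm])
  have start: "\<gamma> t = x" "\<zeta> t = z" using trj unfolding trajectory_iff \<zeta>_def z_def by auto
  \<comment> \<open>The length bound is conditional on staying in the ball, where the growth bound
    holds; it gives only half the radius, so the curve cannot reach the boundary sphere and the
    condition can be removed next.\<close>
  have velocity: "\<exists>\<zeta>'. has_ac_derivative \<zeta> \<zeta>' t s \<and> (AE r in lebesgue_on {t..s}. \<zeta>' r = fld c (\<zeta> r) (u r)) \<and>
      integral\<^sup>L (lebesgue_on {t..s}) (\<lambda>r. norm (\<zeta>' r)) \<le> \<rho> / 2"
    if s: "s \<in> {t..t+h}" and stay: "\<gamma> ` {t..s} \<subseteq> ?B" for s
  proof -
    have "\<gamma> ` {t..s} \<subseteq> chart_dom ?C" using stay inB(2) by blast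
    then have "solves c u \<gamma> t s"
      by (intro trajectory_solves[OF trj c(1)]) (use s h in auto)
    then obtain \<zeta>' where 1: "has_ac_derivative \<zeta> \<zeta>' t s" and 2: "AE r in lebesgue_on {t..s}. \<zeta>' r = fld c (\<zeta> r) (u r)"
      unfolding solves_def \<zeta>_def[symmetric] by blast
    have "AE r in lebesgue_on {t..s}. norm (\<zeta>' r) \<le> B * (1 + norm (u r))"
      using 2 unfolding AE_lebesgue_on
    proof eventually_elim
      case (elim r)
      show ?case
      proof
        assume r: "r \<in> {t..s}"
        then have "\<zeta> r \<in> ball z r\<^sub>0" using inB(3)[of r] stay sub\<rho>(3) by blast
        then show "norm (\<zeta>' r) \<le> B * (1 + norm (u r))" using elim r B(3) by auto
      qed
    qed
    then have "integral\<^sup>L (lebesgue_on {t..s}) (\<lambda>r. norm (\<zeta>' r)) \<le> integral\<^sup>L (lebesgue_on {t..s}) (\<lambda>s. B * (1 + norm (u s)))"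
      by (intro integral_mono_AE integrable_norm has_ac_derivativeD(1)[OF 1] u_int(1)[OF s])
    then show ?thesis using 1 2 u_int(2)[OF s] by fastforce
  qed
  have stays: "\<gamma> ` {t..t+h} \<subseteq> ?B"
  proof (rule T.curve_stays_in_ball[OF Hausdorff_TA _ C sub\<rho>(2)])
    have "trajectory A G W f t (t+h) (\<gamma> t) u \<gamma>" by (rule trajectory_subinterval[OF trj]) (use h in auto)
    then show "continuous_map (top_of_set {t..t+h}) (manifold_topology TA) \<gamma>" unfolding trajectory_iff by blast
    show "\<gamma> t \<in> ?B" using start inv_z \<rho>(1) by (intro image_eqI[of _ _ z]) auto
    fix s assume s: "s \<in> {t..t+h}" and stay: "\<gamma> ` {t..s} \<subseteq> ?B"
    obtain \<zeta>' where 1: "has_ac_derivative \<zeta> \<zeta>' t s" and 2: "integral\<^sup>L (lebesgue_on {t..s}) (\<lambda>r. norm (\<zeta>' r)) \<le> \<rho> / 2"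
      using velocity[OF s stay] by blast
    have "\<zeta> s - z = integral\<^sup>L (lebesgue_on {t..s}) \<zeta>'"
      using has_ac_derivativeD(2)[OF 1, of s] s start(2) by simp
    then have "norm (\<zeta> s - z) \<le> integral\<^sup>L (lebesgue_on {t..s}) (\<lambda>r. norm (\<zeta>' r))"
      using integral_norm_bound by simp
    then show "chart_map ?C (\<gamma> s) \<in> ball z \<rho>" using 2 \<rho>(1) by (simp add: \<zeta>_def dist_norm norm_minus_commute)
  qed
  have end_I: "t + h \<in> {t..t+h}" using h by simp
  obtain \<zeta>' where ac: "has_ac_derivative \<zeta> \<zeta>' t (t+h)"
    and eq: "AE r in lebesgue_on {t..t+h}. \<zeta>' r = fld c (\<zeta> r) (u r)"
    using velocity[OF end_I stays] by blast
  define \<Delta> where "\<Delta> = \<zeta> (t+h) - z"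
  define X where "X = integral\<^sup>L (lebesgue_on {t..t+h}) (\<lambda>r. norm (\<zeta>' r))"
  have int\<zeta>: "integrable (lebesgue_on {t..t+h}) \<zeta>'" by (rule has_ac_derivativeD(1)[OF ac])
  have \<Delta>: "\<Delta> = integral\<^sup>L (lebesgue_on {t..t+h}) \<zeta>'"
    using has_ac_derivativeD(2)[OF ac end_I] start(2) by (simp add: \<Delta>_def)
  have \<Delta>X: "norm \<Delta> \<le> X" unfolding \<Delta> X_def by (rule integral_norm_bound)
  \<comment> \<open>The margin solved for the Lagrangian, with the field replaced by the velocity.
    It depends on the velocity only and is thus integrable.\<close>
  let ?lo = "\<lambda>r. (\<eta> + \<epsilon> - a) + \<epsilon> * norm (\<zeta>' r) - l (\<zeta>' r)"
  have int_l: "integrable (lebesgue_on {t..t+h}) (\<lambda>r. l (\<zeta>' r))" by (rule integrable_bounded_linear[OF l int\<zeta>])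
  have int_n: "integrable (lebesgue_on {t..t+h}) (\<lambda>r. \<epsilon> * norm (\<zeta>' r))"
    by (intro integrable_mult_right integrable_norm int\<zeta>)
  have "integral\<^sup>L (lebesgue_on {t..t+h}) (\<lambda>_. \<eta> + \<epsilon> - a) = (\<eta> + \<epsilon> - a) * h"
    using h(1) by (subst lebesgue_integral_eq_integral[OF Lebesgue_Measure.integrable_const_ivl]) auto
  \<comment> \<open>The fixed linear form \<open>l\<close> integrates to its value on the total
    displacement \<Delta>, so only the differential of V at the initial point enters.\<close>
  then have Ilo: "integral\<^sup>L (lebesgue_on {t..t+h}) ?lo = (\<eta> + \<epsilon> - a) * h + \<epsilon> * X - l \<Delta>"
    unfolding X_def \<Delta> integral_bounded_linear[OF l int\<zeta>, symmetric]
    unfolding Bochner_Integration.integral_diff[OF Bochner_Integration.integrable_add[OF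
          Lebesgue_Measure.integrable_const_ivl int_n] int_l]
      Bochner_Integration.integral_add[OF Lebesgue_Measure.integrable_const_ivl int_n]
    by simp
  have "AE r in lebesgue_on {t..t+h}. ?lo r \<le> L r (\<gamma> r) (u r)"
    using eq admD(3)[OF adm] unfolding AE_lebesgue_on
  proof eventually_elim
    case (elim r)
    show ?case
    proof
      assume r: "r \<in> {t..t+h}"
      have B': "\<gamma> r \<in> ?B" using stays r by blast
      have "\<eta> + \<epsilon> * (1 + norm (fld c (\<zeta> r) (u r))) \<le> P (1, fld c (\<zeta> r) (u r)) + L r (chart_inv ?C (\<zeta> r)) (u r)"
        by (rule margin) (use r t h \<rho>(2) elim inB(3)[OF B'] in auto)
      then have "\<eta> + \<epsilon> * (1 + norm (fld c (\<zeta> r) (u r))) \<le> a + l (fld c (\<zeta> r) (u r)) + L r (chart_inv ?C (\<zeta> r)) (u r)"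
        using Pal[of 1] by simp
      then show "?lo r \<le> L r (\<gamma> r) (u r)"
        using elim r unfolding inB(4)[OF B'] by (simp add: algebra_simps)
    qed
  qed
  then have "ereal (integral\<^sup>L (lebesgue_on {t..t+h}) ?lo) \<le> run t (t+h) u \<gamma>"
    unfolding run_def
    by (rule integral_le_nn_integral[OF Bochner_Integration.integrable_diff[OF
          Bochner_Integration.integrable_add[OF Lebesgue_Measure.integrable_const_ivl int_n] int_l]])
  moreover have end_B: "\<gamma> (t+h) \<in> ?B" using stays end_I by blast
  then have Vh: "V (t+h) (\<gamma> (t+h)) = ereal (Vc ?C (t+h) (\<zeta> (t+h)))"
    unfolding \<zeta>_def by (intro V_Vc[OF C]) (use inB t h in auto)
  ultimately have "ereal ((\<eta> + \<epsilon> - a) * h + \<epsilon> * X - l \<Delta>) + ereal (Vc ?C (t+h) (\<zeta> (t+h))) \<le> run t (t+h) u \<gamma> + V (t+h) (\<gamma> (t+h))"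
    unfolding Ilo by (intro add_mono) auto
  also have "\<dots> \<le> cost L g t T u \<gamma>"
    by (rule dynamic_programming_lower[OF adm t(1)]) (use h in auto)
  also have "\<dots> < ereal (v0 + \<eta> * h / 2)" by (rule cost)
  finally have upper: "(\<eta> + \<epsilon> - a) * h + \<epsilon> * X - l \<Delta> + Vc ?C (t+h) (\<zeta> (t+h)) < v0 + \<eta> * h / 2" by simp
  have n: "norm (h, \<Delta>) \<le> h + norm \<Delta>" using norm_Pair_le[of h \<Delta>] h(1) by simp
  have "norm \<Delta> \<le> \<rho>" using inB(3)[OF end_B] by (simp add: \<Delta>_def dist_norm norm_minus_commute)
  then have "norm (h, \<Delta>) < d" using n h(3) \<rho>(4) by linarith
  moreover have "(t+h, \<zeta> (t+h)) - (t, z) = (h, \<Delta>)" by (simp add: \<Delta>_def)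
  moreover have "(t+h, \<zeta> (t+h)) \<in> {0..T} \<times> Dc ?C" using inB(3)[OF end_B] sub\<rho>(1) t h by auto
  ultimately have "norm (Vc ?C (t+h) (\<zeta> (t+h)) - v0 - P (h, \<Delta>)) \<le> \<epsilon> * norm (h, \<Delta>)"
    using d(2)[of "(t+h, \<zeta> (t+h))"] by (simp add: v0_def)
  also have "\<dots> \<le> \<epsilon> * (h + X)" using n \<Delta>X \<epsilon> by (intro mult_left_mono) auto
  \<comment> \<open>The terms \<epsilon> h + \<epsilon> X of \<open>upper\<close> cancel against
    this remainder.\<close>
  finally have "- (\<epsilon> * (h + X)) \<le> Vc ?C (t+h) (\<zeta> (t+h)) - v0 - (a * h + l \<Delta>)"
    unfolding Pal real_norm_def by (simp only: abs_le_iff) linarith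
  then have "v0 + \<eta> * h < v0 + \<eta> * h / 2" using upper by (simp add: algebra_simps)
  then show False using \<eta> h(1) by simp
qed

end

section \<open>The Hamilton-Jacobi-Bellman equation\<close>

context optimal_control
begin

text \<open>Before the final time the two inequalities are applied at the point itself. At t = T
  there is no time left to run the system, and they are recovered from times s < T at the same
  state.\<close>

lemma hjb_in_chart:
  assumes c: "c \<in> A" "x \<in> chart_dom (tc c)" and x: "x \<in> D" and t: "t \<in> {0..T}"
  obtains P where "has_dV (tc c) t (chart_map (tc c) x) P"
    "\<And>u. u \<in> \<Omega> \<Longrightarrow> 0 \<le> P (1, fld c (chart_map (tc c) x) u) + L t x u"
    "\<And>m. m > 0 \<Longrightarrow> \<exists>u\<in>\<Omega>. P (1, fld c (chart_map (tc c) x) u) + L t x u < m"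
proof -
  let ?C = "tc c"
  define z where "z = chart_map ?C x"
  note C = tc_atlas[OF c(1)]
  have zD: "z \<in> Dc ?C" "z \<in> chart_image ?C" using x c unfolding z_def Dc_def chart_image_def by auto
  have inv_z: "chart_inv ?C z = x" unfolding z_def by (rule T.chart_inv_map[OF C c(2)])
  obtain N P where N: "open N" "(t, z) \<in> N"
    and P: "\<And>s w. (s, w) \<in> N \<Longrightarrow> s \<in> {0..T} \<Longrightarrow> w \<in> Dc ?C \<Longrightarrow> has_dV ?C s w (P (s, w))"
    and contP: "\<And>v. continuous_on N (\<lambda>p. P p v)"
    using has_dV_obtain[OF C t zD(1)] by blast
  have Pt: "has_dV ?C t z (P (t, z))" by (rule P[OF N(2) t zD(1)])
  show ?thesis
  proof (cases "t < T")
    case True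
    have "0 \<le> t" using t by simp
    have "\<exists>u\<in>\<Omega>. P (t, z) (1, fld c z u) + L t x u < m" if m: "m > 0" for m
    proof (rule ccontr)
      assume "\<not> ?thesis"
      then have "m \<le> P (t, z) (1, fld c z u) + L t x u" if "u \<in> \<Omega>" for u using that by force
      then show False
        unfolding z_def by (rule supersolution[OF c x \<open>0 \<le> t\<close> True Pt[unfolded z_def] m])
    qed
    moreover have "0 \<le> P (t, z) (1, fld c z u) + L t x u" if "u \<in> \<Omega>" for u
      using subsolution[OF c x \<open>0 \<le> t\<close> True Pt[unfolded z_def] that] unfolding z_def .
    ultimately show ?thesis using that Pt unfolding z_def by blast
  next
    case False
    then have tT: "t = T" using t by simp
    have lim_sz: "((\<lambda>s. (s, z)) \<longlongrightarrow> (T, z)) (at_left T)" by (intro tendsto_intros)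
    have ev_N: "\<forall>\<^sub>F s in at_left T. (s, z) \<in> N"
      using topological_tendstoD[OF lim_sz N(1)] N(2) tT by simp
    have ev_I: "\<forall>\<^sub>F s in at_left T. s \<in> {0<..<T}"
      by (rule eventually_at_left_real) (rule T)
    have limP: "((\<lambda>s. P (s, z) v) \<longlongrightarrow> P (T, z) v) (at_left T)" for v
    proof -
      have "continuous (at (T, z)) (\<lambda>p. P p v)"
        using contP N tT by (simp add: continuous_on_eq_continuous_at)
      then show ?thesis unfolding isCont_def[symmetric] using isCont_tendsto_compose lim_sz by blast
    qed
    \<comment> \<open>For a fixed control this is a limit of weak inequalities.\<close>
    have sub: "0 \<le> P (T, z) (1, fld c z u) + L T x u" if u: "u \<in> \<Omega>" for u
    proof (rule tendsto_lowerbound)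
      have "continuous_on {0..T} (\<lambda>s. (\<lambda>(s, z, u). L s (chart_inv ?C z) u) (s, z, u))"
        by (rule continuous_on_compose2[OF L_continuous[OF C]])
          (intro continuous_intros, use zD in \<open>simp add: image_subset_iff\<close>)
      then have "continuous_on {0..T} (\<lambda>s. L s x u)" by (simp add: inv_z)
      then have "((\<lambda>s. L s x u) \<longlongrightarrow> L T x u) (at_left T)"
        using T unfolding continuous_on_def at_within_Icc_at_left[OF T, symmetric] by auto
      then show "((\<lambda>s. P (s, z) (1, fld c z u) + L s x u) \<longlongrightarrow> P (T, z) (1, fld c z u) + L T x u) (at_left T)"
        by (intro tendsto_add limP)
      show "\<forall>\<^sub>F s in at_left T. 0 \<le> P (s, z) (1, fld c z u) + L s x u"
        using ev_N ev_I
      proof eventually_elim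
        case (elim s)
        then have "has_dV ?C s z (P (s, z))" by (intro P zD(1)) auto
        from subsolution[OF c x _ _ this[unfolded z_def] u] elim(2) show ?case unfolding z_def by simp
      qed
    qed simp
    \<comment> \<open>An infimum over a possibly unbounded set of controls need not pass to the
      limit. Instead a positive lower bound at T is carried, uniformly in the control, to some s <
      T, where \<open>supersolution\<close> refutes it.\<close>
    have super: "\<exists>u\<in>\<Omega>. P (T, z) (1, fld c z u) + L T x u < m" if m: "m > 0" for m
    proof (rule ccontr)
      assume "\<not> ?thesis"
      then have low: "m \<le> P (T, z) (1, fld c z u) + L T x u" if "u \<in> \<Omega>" for u using that by force
      have PT: "has_dV ?C T z (P (T, z))" using Pt tT by simp
      have TI: "T \<in> {0..T}" using T by simp
      obtain \<epsilon> \<eta> \<delta> :: real where \<epsilon>: "\<epsilon> > 0" and \<eta>: "\<eta> > 0" and \<delta>: "\<delta> > 0"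
        and margin: "\<And>s w u. s \<in> {0..T} \<Longrightarrow> \<bar>s - T\<bar> \<le> \<delta> \<Longrightarrow> w \<in> cball z \<delta> \<Longrightarrow> u \<in> \<Omega> \<Longrightarrow>
          \<eta> + \<epsilon> * (1 + norm (fld c w u)) \<le> P (T, z) (1, fld c w u) + L s (chart_inv ?C w) u"
        using hamiltonian_margin_chart[OF c x TI PT[unfolded z_def] m low[unfolded z_def]] unfolding z_def by metis
      \<comment> \<open>The derivatives at s and at T differ on a vector w by at most
        \<open>E s\<close> times |w|. For w = (1, F) and E s < \<epsilon> this is covered by the
        \<epsilon> (1 + |F|) of the margin.\<close>
      define E where "E s = (\<Sum>b\<in>Basis. \<bar>P (s, z) b - P (T, z) b\<bar>)" for s
      have "(E \<longlongrightarrow> (\<Sum>b\<in>(Basis :: (real \<times> 'e \<times> 'e) set). \<bar>P (T, z) b - P (T, z) b\<bar>)) (at_left T)"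
        unfolding E_def[abs_def] by (intro tendsto_intros limP)
      then have "(E \<longlongrightarrow> 0) (at_left T)" by simp
      then have ev_E: "\<forall>\<^sub>F s in at_left T. E s < \<epsilon>" using \<epsilon> by (rule order_tendstoD)
      have ev_\<delta>: "\<forall>\<^sub>F s in at_left T. s \<in> {T - \<delta><..<T}"
        by (rule eventually_at_left_real) (use \<delta> in simp)
      have "\<forall>\<^sub>F s in at_left T. (s, z) \<in> N \<and> s \<in> {0<..<T} \<and> E s < \<epsilon> \<and> s \<in> {T - \<delta><..<T}"
        using ev_N ev_I ev_E ev_\<delta> by eventually_elim blast
      then obtain s where s: "(s, z) \<in> N" "0 < s" "s < T" "E s < \<epsilon>" "T - \<delta> < s"
        using eventually_happens[of _ "at_left T"] by force
      have Ps: "has_dV ?C s z (P (s, z))" by (rule P[OF s(1) _ zD(1)]) (use s in auto)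
      have "\<eta> \<le> P (s, z) (1, fld c z u) + L s x u" if u: "u \<in> \<Omega>" for u
      proof -
        let ?w = "(1 :: real, fld c z u)"
        have "P (T, z) ?w - P (s, z) ?w = (\<Sum>b\<in>Basis. (?w \<bullet> b) * (P (T, z) b - P (s, z) b))"
          unfolding linear_basis[OF has_derivative_linear[OF PT], of ?w] linear_basis[OF has_derivative_linear[OF Ps], of ?w]
          by (simp only: sum_subtractf right_diff_distrib real_scaleR_def)
        also have "\<dots> \<le> (\<Sum>b\<in>Basis. norm ?w * \<bar>P (s, z) b - P (T, z) b\<bar>)"
        proof (rule sum_mono)
          fix b :: "real \<times> 'e \<times> 'e" assume "b \<in> Basis"
          have "(?w \<bullet> b) * (P (T, z) b - P (s, z) b) \<le> \<bar>?w \<bullet> b\<bar> * \<bar>P (T, z) b - P (s, z) b\<bar>"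
            unfolding abs_mult[symmetric] by (rule abs_ge_self)
          also have "\<dots> \<le> norm ?w * \<bar>P (s, z) b - P (T, z) b\<bar>"
            unfolding abs_minus_commute[of "P (T, z) b"] by (rule mult_right_mono[OF Basis_le_norm]) (use \<open>b \<in> Basis\<close> in auto)
          finally show "(?w \<bullet> b) * (P (T, z) b - P (s, z) b) \<le> norm ?w * \<bar>P (s, z) b - P (T, z) b\<bar>" .
        qed
        also have "\<dots> = norm ?w * E s" unfolding E_def by (simp only: sum_distrib_left)
        also have "\<dots> \<le> norm ?w * \<epsilon>" using s(4) by (intro mult_left_mono) auto
        also have "\<dots> \<le> (1 + norm (fld c z u)) * \<epsilon>"
          using norm_Pair_le[of "1 :: real" "fld c z u"] \<epsilon> by (intro mult_right_mono) auto
        finally have "P (T, z) ?w - P (s, z) ?w \<le> \<epsilon> * (1 + norm (fld c z u))" by (simp only: mult.commute)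
        moreover have "\<eta> + \<epsilon> * (1 + norm (fld c z u)) \<le> P (T, z) ?w + L s x u"
          using margin[of s z u] s \<delta> u unfolding inv_z by simp
        ultimately show ?thesis by linarith
      qed
      then show False
        unfolding z_def
        by (rule supersolution[OF c x less_imp_le[OF s(2)] s(3) Ps[unfolded z_def] \<eta>])
    qed
    show ?thesis by (rule that[of "P (T, z)"]) (use Pt sub super tT in \<open>simp_all add: z_def\<close>)
  qed
qed

lemma terminal_value:
  assumes x: "x \<in> D"
  shows "V T x = ereal (g x)"
proof -
  have "cost L g T T u \<gamma> = ereal (g x)" if adm: "(u, \<gamma>) \<in> adm T x" for u \<gamma>
  proof -
    have "AE s in lebesgue_on {T..T}. ennreal (L s (\<gamma> s) (u s)) = 0"
      using AE_lebesgue_neq[of T] unfolding AE_lebesgue_on by eventually_elim auto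
    then have "(\<integral>\<^sup>+ s. ennreal (L s (\<gamma> s) (u s)) \<partial>lebesgue_on {T..T}) = (\<integral>\<^sup>+ s. 0 \<partial>lebesgue_on {T..T})"
      by (rule nn_integral_cong_AE)
    then have "run T T u \<gamma> = 0" unfolding run_def by (simp add: zero_ennreal.rep_eq)
    moreover have "\<gamma> T = x" using admD(4)[OF adm] unfolding trajectory_iff by blast
    ultimately show ?thesis using cost_eq[OF adm] T by simp
  qed
  then have *: "(\<lambda>(u, \<gamma>). cost L g T T u \<gamma>) p = ereal (g x)" if "p \<in> adm T x" for p
    using that by (cases p) simp
  \<comment> \<open>All costs at time T equal \<open>g x\<close>, but the infimum of an empty set
    would be infinite. Finiteness of the value on \<open>D\<close> supplies an admissible
    pair.\<close>
  have "adm T x \<noteq> {}" using adm_nonempty[of T x] x T by auto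
  then show ?thesis unfolding value_function_def using * by (simp cong: INF_cong)
qed

text \<open>By \<open>gradient_spray\<close> the two products in the Hamiltonian are the spatial
  differential of V in the direction of the field. Both sides thus reduce to the chart, where
  \<open>hjb_in_chart\<close> says that the infimum of the integrand is minus the time
  derivative.\<close>

lemma hamilton_jacobi_bellman:
  assumes t: "t \<in> {0..T}" and x: "x \<in> D"
  defines "gr \<equiv> gradient TA (sasaki_metric A G) (\<lambda>y. real_of_ereal (V t y)) x"
  shows "\<exists>V\<^sub>t. ((\<lambda>s. real_of_ereal (V s x)) has_real_derivative V\<^sub>t) (at t within {0..T}) \<and>
    ereal V\<^sub>t + hamiltonian A G W f \<Omega> L t x (horizontal_part A x gr) (vertical_part A G x gr) = 0"
proof -
  have xp: "x \<in> points TA" using x D_points by blast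
  obtain c where c: "c \<in> A" "fst x \<in> chart_dom c" using xp points_TA unfolding points_def by blast
  have d: "x \<in> chart_dom (tc c)" using xp c points_TA tc_dom by blast
  let ?z = "chart_map (tc c) x"
  note C = tc_atlas[OF c(1)]
  obtain P where P: "has_dV (tc c) t ?z P"
    and sub: "\<And>u. u \<in> \<Omega> \<Longrightarrow> 0 \<le> P (1, fld c ?z u) + L t x u"
    and super: "\<And>m. m > 0 \<Longrightarrow> \<exists>u\<in>\<Omega>. P (1, fld c ?z u) + L t x u < m"
    using hjb_in_chart[OF c(1) d x t] by blast
  have zD: "chart_map B x \<in> Dc B" if "x \<in> chart_dom B" for B using x that unfolding Dc_def by blast
  have comp: "(\<lambda>y. real_of_ereal (V t y)) \<circ> chart_inv B = Vc B t" for B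
    by (simp add: Vc_def fun_eq_iff)
  have diff: "((\<lambda>y. real_of_ereal (V t y)) \<circ> chart_inv B) differentiable (at (chart_map B x))"
    if B: "B \<in> TA" "x \<in> chart_dom B" for B
  proof -
    have "\<exists>Q. has_dV B t (chart_map B x) Q"
    proof (rule has_dV_obtain[OF B(1) t zD[OF B(2)]])
      fix N Q assume "(t, chart_map B x) \<in> N"
        and "\<And>s w. (s, w) \<in> N \<Longrightarrow> s \<in> {0..T} \<Longrightarrow> w \<in> Dc B \<Longrightarrow> has_dV B s w (Q (s, w))"
      from this(2)[OF this(1) t zD[OF B(2)]] show ?thesis by blast
    qed
    then obtain Q where "has_dV B t (chart_map B x) Q" by (elim exE)
    from Vc_space_derivative[OF B(1) this t zD[OF B(2)]] show ?thesis
      unfolding comp differentiable_def by blast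
  qed
  have dP: "frechet_derivative (Vc (tc c) t) (at ?z) = (\<lambda>v. P (0, v))"
    using frechet_derivative_at[OF Vc_space_derivative[OF C P t zD[OF d]]] by simp
  have pA: "fst x \<in> points A" using xp points_TA by blast
  have ham: "G (fst x) (horizontal_part A x gr) (snd x) + G (fst x) (vertical_part A G x gr) (force A G W f (fst x) u)
      = P (0, fld c ?z u)" for u
    using gradient_spray[where \<Phi> = "\<lambda>y. real_of_ereal (V t y)", OF xp c force_tangent[OF pA, of u] diff]
    unfolding gr_def comp dP fld_spray[OF c(1) d] by simp
  have P1: "P (1, v) = P (1, 0) + P (0, v)" for v using has_dV_linear(1)[OF P, of 1 v] by linarith
  let ?H = "hamiltonian A G W f \<Omega> L t x (horizontal_part A x gr) (vertical_part A G x gr)"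
  have H: "?H = (INF u\<in>\<Omega>. ereal (P (0, fld c ?z u) + L t x u))"
    unfolding hamiltonian_def ham ..
  have "?H = ereal (- P (1, 0))"
  proof (rule antisym)
    show "ereal (- P (1, 0)) \<le> ?H"
      unfolding H
    proof (rule INF_greatest)
      fix u assume "u \<in> \<Omega>"
      from sub[OF this] show "ereal (- P (1, 0)) \<le> ereal (P (0, fld c ?z u) + L t x u)"
        using P1[of "fld c ?z u"] by simp
    qed
    show "?H \<le> ereal (- P (1, 0))"
    \<comment> \<open>The infimum may fail to be attained, so it is approached by controls with
      error \<open>e\<close>.\<close>
    proof (rule ereal_le_epsilon2)
      fix e :: real assume "0 < e"
      then obtain u where u: "u \<in> \<Omega>" "P (1, fld c ?z u) + L t x u < e" using super by blast
      have "?H \<le> ereal (P (0, fld c ?z u) + L t x u)" unfolding H by (rule INF_lower[OF u(1)])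
      also have "\<dots> \<le> ereal (- P (1, 0) + e)" using u(2) P1[of "fld c ?z u"] by simp
      finally show "?H \<le> ereal (- P (1, 0)) + ereal e" by simp
    qed
  qed
  moreover have "((\<lambda>s. real_of_ereal (V s x)) has_real_derivative P (1, 0)) (at t within {0..T})"
    using Vc_time_derivative[OF P zD[OF d]] unfolding Vc_def T.chart_inv_map[OF C d] .
  ultimately show ?thesis by (intro exI[of _ "P (1, 0)"]) (simp add: zero_ereal_def)
qed

end

theorem theoremV1:
  fixes A :: "('a, 'e::euclidean_space) atlas"
    and G :: "('a, 'e) metric_tensor"
    and W :: "'a \<Rightarrow> real"
    and f :: "'m::finite \<Rightarrow> 'a \<Rightarrow> ('a, 'e) tvec"
    and \<Omega> :: "(real^'m) set"
    and K D :: "('a, 'e) tpoint set"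
    and L :: "real \<Rightarrow> ('a, 'e) tpoint \<Rightarrow> real^'m \<Rightarrow> real"
    and g :: "('a, 'e) tpoint \<Rightarrow> real"
    and T \<beta> :: real
  defines "V \<equiv> value_function A G W f \<Omega> K L g T"
  assumes "smooth_manifold A"
    and "riemannian_metric A G"
    and "smooth_function A W"
    and "\<And>j. smooth_vector_field A (f j)"
    and "T > 0"
    and "compactin (manifold_topology (tangent_atlas A)) K"
    and "smooth_lagrangian A T L"
    and "smooth_function (tangent_atlas A) g"
    and "\<beta> > 0"
    and "\<And>t x u. t \<in> {0..T} \<Longrightarrow> x \<in> points (tangent_atlas A) \<Longrightarrow> L t x u \<ge> \<beta> * (norm u)\<^sup>2"
    and "openin (manifold_topology (tangent_atlas A)) D"
    and "finite_C1_on (tangent_atlas A) T D V"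
  shows "(\<forall>t\<in>{0..T}. \<forall>x\<in>D.
            let nablaV = gradient (tangent_atlas A) (sasaki_metric A G) (\<lambda>y. real_of_ereal (V t y)) x;
                nabla_qV = horizontal_part A x nablaV;
                nabla_vV = vertical_part A G x nablaV
            in \<exists>V\<^sub>t. ((\<lambda>s. real_of_ereal (V s x)) has_real_derivative V\<^sub>t) (at t within {0..T}) \<and>
                 ereal V\<^sub>t + hamiltonian A G W f \<Omega> L t x nabla_qV nabla_vV = 0)
       \<and> (\<forall>x\<in>D. V T x = ereal (g x))"
proof -
  interpret riemannian_manifold A G by unfold_locales fact+
  interpret control_system A G W f by unfold_locales fact+
  interpret optimal_control A G W f \<Omega> K D L g T \<beta>
    by unfold_locales (use assms in simp_all)
  show ?thesis
    unfolding V_def Let_def using hamilton_jacobi_bellman terminal_value by blast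
qed

end
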